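(* Let $H\in C^2(\mathbb{R}^d)$ be convex and coercive (i.e. $H(p)\to+\infty$ as $|p|\to\infty$), let $g:\mathbb{T}^d\to\mathbb{R}$ be Lipschitz continuous and semiconcave, and let $F\in C^2(\mathbb{R}^{d}\times\mathbb{R}^d)$ be convex with $F(-p,p)=H(p)$ for every $p\in\mathbb{R}^d$. Let $R>0$ be a constant, and let $\varepsilon=(h,\Delta t)$ be chosen so that the monotonicity condition with constant $R$ holds. Let $u$ be the viscosity solution of $$\partial_t u+H(Du)=0 \ \text{ in } \mathbb{T}^d\times(0,T),\qquad u(\cdot,0)=g \ \text{ on }\mathbb{T}^d ,$$ and let $\tilde u^\varepsilon_n:\mathbb{T}^d\to\mathbb{R}$, $n=0,\dots,N$, be the piecewise-multilinear interpolants of the solution of the fully discrete finite difference scheme. Then, with a constant $C>0$ independent of $\varepsilon$, $$\sup_{n=0,\dots,N}\|\tilde u_n^\varepsilon(\cdot)-u(\cdot,n\Delta t)\|_{L^1(\mathbb{T}^d)}\le C\,|\varepsilon|.$$ Moreover, for any $p\in[1,+\infty]$, with a constant $C>0$ independent of $\varepsilon$, $$\sup_{n=0,\dots,N}\|\tilde u_n^\varepsilon(\cdot)-u(\cdot,n\Delta t)\|_{L^p(\mathbb{T}^d)}\le C\,|\varepsilon|^{\frac12+\frac1{2p}},$$ where $1/p=0$ for $p=+\infty$.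
   Context: $\mathbb{T}^d$ is the $d$-dimensional flat torus, identified with $[0,1]^d$ with periodic boundary conditions; $T>0$ is fixed and $e_1,\dots,e_d$ is the standard basis. A function $u:\mathbb{T}^d\to\mathbb{R}$ is semiconcave with constant $C_{conc}>0$ if for all $x_1,x_2\in\mathbb{T}^d$ and $\lambda\in(0,1)$: $u(\lambda x_1+(1-\lambda)x_2)\ge\lambda u(x_1)+(1-\lambda)u(x_2)-\lambda(1-\lambda)C_{conc}|x_1-x_2|^2$. Discretization parameters: a space step $h=1/I$ with $I\ge1$ an integer and a time step $\Delta t>0$ with $N\Delta t=T$, $N$ a positive integer; $\varepsilon=(h,\Delta t)$ and $|\varepsilon|=h+\Delta t$. Difference operators: $\delta_h^{(i)}v(x)=\frac{v(x+he_i)-v(x)}{h}$, $\delta_{-h}^{(i)}v(x)=\frac{v(x)-v(x-he_i)}{h}$, $\delta_{\pm h}v=(\delta_{\pm h}^{(1)}v,\dots,\delta_{\pm h}^{(d)}v)$. Monotonicity condition with constant $R>0$: $\varepsilon=(h,\Delta t)$ is such that the update operator $$G\big(v(x),\{v(x\pm he_i)\}_{i=1}^d\big):=v(x)-\Delta t\,F\big(-\delta_hv(x),\delta_{-h}v(x)\big)$$ is a nondecreasing function of each of the grid values involved (the central value $v(x)$ and the neighboring values $v(x\pm he_i)$), provided that the absolute value of the discrete slopes $-\delta_hv(x)$ and $\delta_{-h}v(x)$ is bounded by $R$. Grid: $\mathcal{G}=\{x_i=hi:\ i=(i_1,\dots,i_d)\in\{0,\dots,I-1\}^d\}\subset\mathbb{T}^d$,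 with indices understood modulo $I$. Fully discrete finite difference scheme: grid functions $U_n:\mathcal{G}\to\mathbb{R}$ with $U_0(x_i)=g(x_i)$ and $U_{n+1}(x_i)-U_n(x_i)+\Delta t\,F(-\delta_hU_n(x_i),\delta_{-h}U_n(x_i))=0$ for $x_i\in\mathcal{G}$, $n=0,\dots,N-1$. Piecewise-multilinear interpolant: $\tilde u_n^\varepsilon=\mathcal{I}[U_n]$ where, for $x$ in the cell $Q_i=x_i+[0,h)^d$, $\mathcal{I}[U](x)=\sum_{\sigma\in\{0,1\}^d}\lambda_\sigma(x)U(x_{i+\sigma})$, $\lambda_\sigma(x)$ being the multilinear interpolation weights, which satisfy $\lambda_\sigma(x)\ge0$ and $\sum_\sigma\lambda_\sigma(x)=1$.
   Formalization: The constant R is additionally required to be at least a Lipschitz constant of g; for arbitrary small R the claim fails, e.g. d=1, H(p)=max(0,|p|-1)^3, F(a,b)=H((b-a)/2), R=1/2, where monotonicity holds for every h and Δt. *)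

theory Defs
  imports "HOL-Analysis.Analysis" "HOL-Probability.Essential_Supremum"
begin

text \<open>
  Functions on the flat torus are represented by functions on \<open>real ^ 'd\<close> that are
  1-periodic in every coordinate; the torus itself is integrated over as the unit cube.
\<close>

definition torus_periodic :: "(real ^ 'd::finite \<Rightarrow> 'b) \<Rightarrow> bool" where
  "torus_periodic v \<longleftrightarrow> (\<forall>x j. v (x + axis j 1) = v x)"

definition C2 :: "('a::real_normed_vector \<Rightarrow> real) \<Rightarrow> bool" where
  "C2 f \<longleftrightarrow> (\<exists>(f' :: 'a \<Rightarrow> 'a \<Rightarrow>\<^sub>L real) (f'' :: 'a \<Rightarrow> 'a \<Rightarrow>\<^sub>L 'a \<Rightarrow>\<^sub>L real).
     (\<forall>x. (f has_derivative blinfun_apply (f' x)) (at x)) \<and>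
     (\<forall>x. (f' has_derivative blinfun_apply (f'' x)) (at x)) \<and>
     continuous_on UNIV f'')"

definition coercive :: "(real ^ 'd::finite \<Rightarrow> real) \<Rightarrow> bool" where
  "coercive H \<longleftrightarrow> filterlim H at_top at_infinity"

definition semiconcave :: "(real ^ 'd::finite \<Rightarrow> real) \<Rightarrow> bool" where
  "semiconcave v \<longleftrightarrow> (\<exists>C>0. \<forall>x1 x2. \<forall>l\<in>{0<..<1}.
     v (l *\<^sub>R x1 + (1 - l) *\<^sub>R x2)
       \<ge> l * v x1 + (1 - l) * v x2 - l * (1 - l) * C * (norm (x1 - x2))\<^sup>2)"

text \<open>
  \<open>C1_test T \<phi> a q\<close>: the function \<open>\<phi>\<close> is continuously differentiable on \<open>UNIV \<times> {0<..<T}\<close>, with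
  time derivative \<open>a\<close> and spatial gradient \<open>q\<close>. Test functions need not be periodic, because
  they are only used near a local extremum.
\<close>

definition C1_test ::
  "real \<Rightarrow> ((real ^ 'd::finite) \<times> real \<Rightarrow> real) \<Rightarrow> ((real ^ 'd) \<times> real \<Rightarrow> real)
    \<Rightarrow> ((real ^ 'd) \<times> real \<Rightarrow> real ^ 'd) \<Rightarrow> bool" where
  "C1_test T \<phi> a q \<longleftrightarrow>
     (\<forall>z \<in> UNIV \<times> {0<..<T}. (\<phi> has_derivative (\<lambda>(y, s). a z * s + q z \<bullet> y)) (at z)) \<and>
     continuous_on (UNIV \<times> {0<..<T}) a \<and> continuous_on (UNIV \<times> {0<..<T}) q"

definition viscosity_subsolution ::
  "(real ^ 'd::finite \<Rightarrow> real) \<Rightarrow> real \<Rightarrow> (real ^ 'd \<Rightarrow> real \<Rightarrow> real) \<Rightarrow> bool" where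
  "viscosity_subsolution H T u \<longleftrightarrow>
     (\<forall>\<phi> a q. C1_test T \<phi> a q \<longrightarrow> (\<forall>x. \<forall>t\<in>{0<..<T}.
        (\<forall>\<^sub>F (y, s) in nhds (x, t). u y s - \<phi> (y, s) \<le> u x t - \<phi> (x, t)) \<longrightarrow>
        a (x, t) + H (q (x, t)) \<le> 0))"

definition viscosity_supersolution ::
  "(real ^ 'd::finite \<Rightarrow> real) \<Rightarrow> real \<Rightarrow> (real ^ 'd \<Rightarrow> real \<Rightarrow> real) \<Rightarrow> bool" where
  "viscosity_supersolution H T u \<longleftrightarrow>
     (\<forall>\<phi> a q. C1_test T \<phi> a q \<longrightarrow> (\<forall>x. \<forall>t\<in>{0<..<T}.
        (\<forall>\<^sub>F (y, s) in nhds (x, t). u y s - \<phi> (y, s) \<ge> u x t - \<phi> (x, t)) \<longrightarrow>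
        a (x, t) + H (q (x, t)) \<ge> 0))"

text \<open>Continuity up to \<open>t = T\<close> gives \<open>u\<close> its value at the final time.\<close>

definition viscosity_solution ::
  "(real ^ 'd::finite \<Rightarrow> real) \<Rightarrow> (real ^ 'd \<Rightarrow> real) \<Rightarrow> real
    \<Rightarrow> (real ^ 'd \<Rightarrow> real \<Rightarrow> real) \<Rightarrow> bool" where
  "viscosity_solution H g T u \<longleftrightarrow>
     (\<forall>t\<in>{0..T}. torus_periodic (\<lambda>x. u x t)) \<and>
     continuous_on (UNIV \<times> {0..T}) (\<lambda>(x, t). u x t) \<and>
     viscosity_subsolution H T u \<and> viscosity_supersolution H T u \<and>
     (\<forall>x. u x 0 = g x)"

definition discretization :: "real \<Rightarrow> real \<Rightarrow> real \<Rightarrow> nat \<Rightarrow> bool" where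
  "discretization T h \<Delta>t N \<longleftrightarrow>
     (\<exists>I::nat. I \<ge> 1 \<and> h = 1 / real I) \<and> \<Delta>t > 0 \<and> N \<ge> 1 \<and> real N * \<Delta>t = T"

definition diff_fwd :: "real \<Rightarrow> (real ^ 'd::finite \<Rightarrow> real) \<Rightarrow> real ^ 'd \<Rightarrow> real ^ 'd" where
  "diff_fwd h v x = (\<chi> i. (v (x + h *\<^sub>R axis i 1) - v x) / h)"

definition diff_bwd :: "real \<Rightarrow> (real ^ 'd::finite \<Rightarrow> real) \<Rightarrow> real ^ 'd \<Rightarrow> real ^ 'd" where
  "diff_bwd h v x = (\<chi> i. (v x - v (x - h *\<^sub>R axis i 1)) / h)"

definition update_op ::
  "((real ^ 'd::finite) \<times> (real ^ 'd) \<Rightarrow> real) \<Rightarrow> real \<Rightarrow> real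
    \<Rightarrow> (real ^ 'd \<Rightarrow> real) \<Rightarrow> real ^ 'd \<Rightarrow> real" where
  "update_op F h \<Delta>t v x = v x - \<Delta>t * F (- diff_fwd h v x, diff_bwd h v x)"

definition slopes_bounded ::
  "real \<Rightarrow> real \<Rightarrow> (real ^ 'd::finite \<Rightarrow> real) \<Rightarrow> real ^ 'd \<Rightarrow> bool" where
  "slopes_bounded R h v x \<longleftrightarrow> (\<forall>i. \<bar>diff_fwd h v x $ i\<bar> \<le> R \<and> \<bar>diff_bwd h v x $ i\<bar> \<le> R)"

definition stencil :: "real \<Rightarrow> real ^ 'd::finite \<Rightarrow> (real ^ 'd) set" where
  "stencil h x = {x} \<union> (\<Union>i. {x + h *\<^sub>R axis i 1, x - h *\<^sub>R axis i 1})"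

text \<open>
  The update operator is monotone in each of its \<open>2d + 1\<close> arguments separately: raising the value of
  \<open>v\<close> at one stencil point \<open>y\<close> does not decrease it. Here \<open>v\<close> is not required to be periodic, so the
  stencil values are independent arguments also for \<open>h = 1\<close> and \<open>h = 1/2\<close>.
\<close>

definition monotonicity_condition ::
  "((real ^ 'd::finite) \<times> (real ^ 'd) \<Rightarrow> real) \<Rightarrow> real \<Rightarrow> real \<Rightarrow> real \<Rightarrow> bool" where
  "monotonicity_condition F R h \<Delta>t \<longleftrightarrow>
     (\<forall>v x. \<forall>y \<in> stencil h x. \<forall>b. v y \<le> b \<longrightarrow>
        slopes_bounded R h v x \<longrightarrow> slopes_bounded R h (v(y := b)) x \<longrightarrow>
        update_op F h \<Delta>t v x \<le> update_op F h \<Delta>t (v(y := b)) x)"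

text \<open>
  The lift of the grid to \<open>real ^ 'd\<close>; for \<open>h = 1/I\<close>, periodicity below is exactly the convention that
  indices are understood modulo \<open>I\<close>. Values of \<open>U n\<close> outside the lattice are irrelevant.
\<close>

definition lattice :: "real \<Rightarrow> (real ^ 'd::finite) set" where
  "lattice h = range (\<lambda>k :: int ^ 'd. \<chi> j. h * of_int (k $ j))"

definition fd_solution ::
  "((real ^ 'd::finite) \<times> (real ^ 'd) \<Rightarrow> real) \<Rightarrow> (real ^ 'd \<Rightarrow> real) \<Rightarrow> real \<Rightarrow> real \<Rightarrow> nat
    \<Rightarrow> (nat \<Rightarrow> real ^ 'd \<Rightarrow> real) \<Rightarrow> bool" where
  "fd_solution F g h \<Delta>t N U \<longleftrightarrow>
     (\<forall>n\<le>N. \<forall>x\<in>lattice h. \<forall>j. U n (x + axis j 1) = U n x) \<and>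
     (\<forall>x\<in>lattice h. U 0 x = g x) \<and>
     (\<forall>n<N. \<forall>x\<in>lattice h.
        U (Suc n) x - U n x + \<Delta>t * F (- diff_fwd h (U n) x, diff_bwd h (U n) x) = 0)"

text \<open>
  Multilinear interpolation. The vertex \<open>\<sigma> \<in> {0,1}\<^sup>d\<close> of a cell is encoded as the set of coordinates
  \<open>j\<close> with \<open>\<sigma>\<^sub>j = 1\<close>, and the cell containing \<open>x\<close> has index \<open>\<lfloor>x $ j / h\<rfloor>\<close>.
\<close>

definition cell_vertex :: "real \<Rightarrow> real ^ 'd::finite \<Rightarrow> 'd set \<Rightarrow> real ^ 'd" where
  "cell_vertex h x \<sigma> = (\<chi> j. h * of_int (\<lfloor>x $ j / h\<rfloor> + (if j \<in> \<sigma> then 1 else 0)))"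

definition interp_weight :: "real \<Rightarrow> real ^ 'd::finite \<Rightarrow> 'd set \<Rightarrow> real" where
  "interp_weight h x \<sigma> =
     (\<Prod>j\<in>UNIV. if j \<in> \<sigma> then frac (x $ j / h) else 1 - frac (x $ j / h))"

definition interpolant ::
  "real \<Rightarrow> (real ^ 'd::finite \<Rightarrow> real) \<Rightarrow> real ^ 'd \<Rightarrow> real" where
  "interpolant h U x = (\<Sum>\<sigma>\<in>UNIV. interp_weight h x \<sigma> * U (cell_vertex h x \<sigma>))"

text \<open>
  The norm takes values in \<open>ennreal\<close>, so that no integrability is needed for it to be meaningful.
\<close>

definition torus_Lp_norm :: "ereal \<Rightarrow> (real ^ 'd::finite \<Rightarrow> real) \<Rightarrow> ennreal" where
  "torus_Lp_norm p f =
     (if p = \<infinity> then esssup (lebesgue_on (cbox 0 1)) (\<lambda>x. ennreal \<bar>f x\<bar>)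
      else let J = (\<integral>\<^sup>+ x. ennreal (\<bar>f x\<bar> powr real_of_ereal p) \<partial>lebesgue_on (cbox 0 1))
        in if J = \<infinity> then \<infinity> else ennreal (enn2real J powr (1 / real_of_ereal p)))"

end

theory Submission
  imports Defs
begin

text \<open>
  The update operator acts on functions on the whole space, and its iterates \<open>V\<^sub>n\<close> from \<open>g\<close>
  coincide with the grid solution on the lattice. They are Lipschitz continuous, so the
  interpolant differs from \<open>V\<^sub>n\<close> by \<open>O(h)\<close>, and it suffices to bound \<open>V\<^sub>n - u(n \<Delta>t)\<close> by
  \<open>O(\<bar>\<epsilon>\<bar>)\<close> in \<open>L\<^sup>1\<close> and by the square root of this uniformly; the other norms follow by
  interpolation.

  As \<open>F\<close> is convex, one step of the scheme is a minimum over slopes \<open>z\<close> of an average over the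
  stencil, with weights given by \<open>DF(z)\<close>, plus a running cost (\<open>S_le_lin\<close>, \<open>S_eq_lin\<close>).
  Monotonicity says that the weights are nonnegative. The scheme is thus a stochastic control
  problem whose steps have a mean velocity and a variance of order \<open>h \<Delta>t\<close>. It follows that
  Lipschitz and semiconcavity constants are preserved.

  Inserting the controls of the scheme into the transport inequality satisfied by subsolutions
  gives \<open>u - V\<^sub>n = O(sqrt h)\<close> by doubling the variables (\<open>doubling_estimate\<close>). In the other
  direction, averaging a semiconcave function exceeds its value at the mean by at most the
  variance, so that \<open>V\<^sub>n - u = O(\<bar>\<epsilon>\<bar>)\<close>: the scheme lies below a Hopf-Lax function, up to this
  error, and the Hopf-Lax function lies below the supersolution \<open>u\<close> (\<open>iterate_le_hopf_lax\<close>,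
  \<open>hopf_lax_le_supersolution\<close>).

  Since \<open>V\<^sub>n - u\<close> has an upper bound of the right order, only the integral of \<open>u - V\<^sub>n\<close> is
  left to estimate. Let \<open>v\<close> be \<open>V\<^sub>n\<close> mollified at scale \<open>h\<close>. The integral of \<open>u\<close> changes at
  the rate \<open>- \<integral> H(Du) \<le> - \<integral> H(Dv) - \<integral> DH(Dv) \<bullet> D(u - v)\<close>, and the last term is \<open>\<integral> div(DH(Dv))
  (u - v)\<close>, where the divergence is bounded from above because \<open>H\<close> is convex and \<open>v\<close>
  semiconcave (\<open>torus_mass_growth\<close>). The integral of \<open>V\<^sub>n\<close> decreases at the rate of the
  integral of the numerical Hamiltonian, which is at most \<open>\<integral> H(Dv) + O(h)\<close>: second differences
  of a periodic semiconcave function are bounded on one side and have mean zero, so they are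
  bounded in \<open>L\<^sup>1\<close> (\<open>numerical_flux_integral\<close>). Gronwall's inequality concludes.

  All test functions for the viscosity solution are mollifications, for which the dynamic
  programming inequalities become classical differential inequalities.
\<close>

section \<open>Mollification\<close>

lemma has_derivative_imp_continuous:
  fixes f :: "'a::real_normed_vector \<Rightarrow> 'b::real_normed_vector"
  assumes "\<And>x. (f has_derivative f' x) (at x)" shows "continuous_on UNIV f"
  using assms by (intro has_derivative_continuous_on) (auto intro: has_derivative_at_withinI)

text \<open>
  The cube is what makes this kernel twice continuously differentiable across the sphere of
  radius \<open>\<delta>\<close>. It is not normalised; \<open>bump_mass\<close> below is its integral.
\<close>
definition bump :: "real \<Rightarrow> 'a::euclidean_space \<Rightarrow> real" where
  "bump \<delta> y = (max 0 (\<delta>\<^sup>2 - y \<bullet> y)) ^ 3"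

text \<open>
  Integrals are taken over this box, which contains the support of the kernel, because the
  continuity and Fubini theorems used here are about boxes.
\<close>
definition kbox :: "real \<Rightarrow> 'a::euclidean_space set" where
  "kbox \<delta> = cbox (- (\<delta> *\<^sub>R One)) (\<delta> *\<^sub>R One)"

definition kconv :: "real \<Rightarrow> ('a::euclidean_space \<Rightarrow> 'b::euclidean_space) \<Rightarrow> ('a \<Rightarrow> real) \<Rightarrow> 'a \<Rightarrow> 'b" where
  "kconv \<delta> k f x = integral (kbox \<delta>) (\<lambda>y. f (x + y) *\<^sub>R k y)"

lemma norm_ge_outside_kbox:
  assumes "y \<notin> kbox \<delta>" shows "norm y \<ge> \<delta>"
proof (rule ccontr)
  assume "\<not> norm y \<ge> \<delta>"
  then have "\<bar>y \<bullet> i\<bar> \<le> \<delta>" if "i \<in> Basis" for i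
    using Basis_le_norm[OF that, of y] by linarith
  then have "y \<in> kbox \<delta>"
    by (force simp: kbox_def mem_box abs_le_iff)
  with assms show False by simp
qed

text \<open>
  On a ball around \<open>x0\<close> the convolution is an integral over a fixed box with the variable \<open>x\<close>
  moved into the kernel; this is the form to which differentiation under the integral sign
  applies.
\<close>
lemma kconv_local:
  assumes k0: "\<And>y. norm y \<ge> \<delta> \<Longrightarrow> k y = 0" and f: "continuous_on UNIV f" and k: "continuous_on UNIV k"
    and x: "x \<in> ball x0 1"
  shows "kconv \<delta> k f x = integral (cbox (x0 - (1 + \<delta>) *\<^sub>R One) (x0 + (1 + \<delta>) *\<^sub>R One)) (\<lambda>w. f w *\<^sub>R k (w - x))"
proof -
  have int: "(\<lambda>y. f (x + y) *\<^sub>R k y) integrable_on kbox \<delta>"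
    unfolding kbox_def by (intro integrable_continuous continuous_intros continuous_on_compose2[OF f] continuous_on_compose2[OF k]) auto
  have "((\<lambda>w. f w *\<^sub>R k (w - x)) has_integral kconv \<delta> k f x) (cbox (- (\<delta> *\<^sub>R One) + x) (\<delta> *\<^sub>R One + x))"
    using has_integral_affinity'[of "\<lambda>y. f (x + y) *\<^sub>R k y" "kconv \<delta> k f x" "- (\<delta> *\<^sub>R One)" "\<delta> *\<^sub>R One" 1 "- x"]
      integrable_integral[OF int] by (simp add: kconv_def kbox_def)
  then have "((\<lambda>w. f w *\<^sub>R k (w - x)) has_integral kconv \<delta> k f x)
      (cbox (x0 - (1 + \<delta>) *\<^sub>R One) (x0 + (1 + \<delta>) *\<^sub>R One))"
  proof (rule has_integral_on_superset)
    fix w assume "w \<notin> cbox (- (\<delta> *\<^sub>R One) + x) (\<delta> *\<^sub>R One + x)"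
    then have "w - x \<notin> kbox \<delta>"
      by (auto simp: kbox_def mem_box algebra_simps)
    then show "f w *\<^sub>R k (w - x) = 0"
      using k0 norm_ge_outside_kbox by fastforce
  next
    have "\<bar>(x - x0) \<bullet> i\<bar> \<le> 1" if "i \<in> Basis" for i
      using Basis_le_norm[OF that, of "x - x0"] x by (simp add: dist_norm norm_minus_commute)
    then show "cbox (- (\<delta> *\<^sub>R One) + x) (\<delta> *\<^sub>R One + x) \<subseteq> cbox (x0 - (1 + \<delta>) *\<^sub>R One) (x0 + (1 + \<delta>) *\<^sub>R One)"
      by (intro subset_box_imp) (auto simp: inner_simps abs_le_iff algebra_simps)
  qed
  then show ?thesis by (simp add: integral_unique)
qed

lemma kconv_continuous:
  assumes f: "continuous_on UNIV f" and k: "continuous_on UNIV k"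
  shows "continuous_on UNIV (kconv \<delta> k f)"
  unfolding kconv_def kbox_def
proof (rule integral_continuous_on_param)
  show "continuous_on (UNIV \<times> cbox (- (\<delta> *\<^sub>R One)) (\<delta> *\<^sub>R One)) (\<lambda>(x, y). f (x + y) *\<^sub>R k y)"
    unfolding split_beta
    by (intro continuous_intros continuous_on_compose2[OF f] continuous_on_compose2[OF k]) auto
qed

text \<open>
  All derivatives fall on the kernel. The kernel is allowed to be vector valued in order that
  the lemma applies a second time, to the gradient of the kernel.
\<close>
lemma kconv_has_derivative:
  fixes k :: "'a::euclidean_space \<Rightarrow> 'b::euclidean_space" and k' :: "'a \<Rightarrow> 'a \<Rightarrow>\<^sub>L 'b"
  assumes f: "continuous_on UNIV f"
    and k: "\<And>y. (k has_derivative blinfun_apply (k' y)) (at y)"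
    and k': "continuous_on UNIV k'"
    and k0: "\<And>y. norm y \<ge> \<delta> \<Longrightarrow> k y = 0"
    and k'0: "\<And>y. norm y \<ge> \<delta> \<Longrightarrow> k' y = 0"
  shows "(kconv \<delta> k f has_derivative (\<lambda>v. kconv \<delta> (\<lambda>y. - blinfun_apply (k' y) v) f x0)) (at x0)"
proof -
  let ?D = "cbox (x0 - (1 + \<delta>) *\<^sub>R One) (x0 + (1 + \<delta>) *\<^sub>R One)"
  have kc: "continuous_on UNIV k"
    by (rule has_derivative_imp_continuous[OF k])
  let ?g = "\<lambda>x w. f w *\<^sub>R k (w - x)"
  let ?g' = "\<lambda>x w. f w *\<^sub>R (- k' (w - x))"
  have d: "((\<lambda>x. integral ?D (?g x)) has_derivative blinfun_apply (integral ?D (?g' x0))) (at x0 within ball x0 1)"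
  proof (rule leibniz_rule)
    fix x t
    have "((\<lambda>x. t - x) has_derivative (\<lambda>v. - v)) (at x within ball x0 1)"
      by (auto intro!: derivative_eq_intros)
    from has_derivative_scaleR_right[OF has_derivative_compose[OF this k], of "f t"]
    show "((\<lambda>x. f t *\<^sub>R k (t - x)) has_derivative blinfun_apply (f t *\<^sub>R - k' (t - x))) (at x within ball x0 1)"
      by (rule has_derivative_eq_rhs) (simp add: blinfun.bilinear_simps fun_eq_iff)
  next
    fix x show "?g x integrable_on ?D"
      by (intro integrable_continuous continuous_intros continuous_on_compose2[OF f] continuous_on_compose2[OF kc]) auto
  next
    show "continuous_on (ball x0 1 \<times> ?D) (\<lambda>(x, t). f t *\<^sub>R - k' (t - x))"
      unfolding split_beta
      by (intro continuous_intros continuous_on_compose2[OF f] continuous_on_compose2[OF k']) auto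
  qed auto
  have g'int: "?g' x0 integrable_on ?D"
    by (intro integrable_continuous continuous_intros continuous_on_compose2[OF f] continuous_on_compose2[OF k']) auto
  have ap: "blinfun_apply (integral ?D (?g' x0)) v = kconv \<delta> (\<lambda>y. - blinfun_apply (k' y) v) f x0" for v
  proof -
    have "blinfun_apply (integral ?D (?g' x0)) v = integral ?D (\<lambda>w. f w *\<^sub>R (\<lambda>y. - blinfun_apply (k' y) v) (w - x0))"
      using blinfun_apply_integral[OF g'int, of v] by (simp add: blinfun.bilinear_simps)
    also have "\<dots> = kconv \<delta> (\<lambda>y. - blinfun_apply (k' y) v) f x0"
    proof (rule kconv_local[where k="\<lambda>y. - blinfun_apply (k' y) v", symmetric])
      show "continuous_on UNIV (\<lambda>y. - blinfun_apply (k' y) v)"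
        by (intro continuous_intros k')
    qed (simp_all add: k'0 f)
    finally show ?thesis .
  qed
  have "blinfun_apply (integral ?D (?g' x0)) = (\<lambda>v. kconv \<delta> (\<lambda>y. - blinfun_apply (k' y) v) f x0)"
    by (intro ext ap)
  moreover have "at x0 within ball x0 1 = at x0"
    by (rule at_within_open) auto
  ultimately have D: "((\<lambda>x. integral ?D (?g x)) has_derivative (\<lambda>v. kconv \<delta> (\<lambda>y. - blinfun_apply (k' y) v) f x0)) (at x0)"
    using d by (simp only:)
  show ?thesis
  proof (rule has_derivative_transform_within_open[OF D open_ball])
    show "x0 \<in> ball x0 1" by simp
    show "integral ?D (?g x) = kconv \<delta> k f x" if "x \<in> ball x0 1" for x
      by (rule kconv_local[OF k0 f kc that, symmetric])
  qed
qed

lemma pos_part_power_deriv: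
  assumes "n \<ge> 1"
  shows "((\<lambda>r::real. max 0 r ^ Suc n) has_real_derivative real (Suc n) * max 0 r ^ n) (at r)"
proof -
  consider "r > 0" | "r < 0" | "r = 0" by linarith
  then show ?thesis
  proof cases
    case 1
    have "((\<lambda>r::real. r ^ Suc n) has_real_derivative real (Suc n) * r ^ n) (at r)"
      using DERIV_pow[of "Suc n" r UNIV] by simp
    then have "((\<lambda>r::real. max 0 r ^ Suc n) has_real_derivative real (Suc n) * r ^ n) (at r)"
      by (rule has_field_derivative_transform_within_open[of _ _ _ "{0<..}"]) (use 1 in auto)
    with 1 show ?thesis by simp
  next
    case 2
    have "((\<lambda>r::real. 0) has_real_derivative 0) (at r)" by simp
    then have "((\<lambda>r::real. max 0 r ^ Suc n) has_real_derivative 0) (at r)"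
      by (rule has_field_derivative_transform_within_open[of _ _ _ "{..<0}"]) (use 2 in auto)
    with 2 assms show ?thesis by (simp add: power_0_left)
  next
    case 3
    have "((\<lambda>h::real. max 0 h ^ Suc n / h) \<longlongrightarrow> 0) (at 0)"
    proof (rule Lim_null_comparison)
      show "\<forall>\<^sub>F h in at 0. norm (max 0 h ^ Suc n / h) \<le> \<bar>h\<bar> ^ n"
      proof (intro always_eventually allI)
        fix h :: real show "norm (max 0 h ^ Suc n / h) \<le> \<bar>h\<bar> ^ n"
          by (cases "h > 0") (auto simp: max_def)
      qed
      have "((\<lambda>h::real. \<bar>h\<bar> ^ n) \<longlongrightarrow> \<bar>0\<bar> ^ n) (at 0)"
        by (intro tendsto_intros)
      then show "((\<lambda>h::real. \<bar>h\<bar> ^ n) \<longlongrightarrow> 0) (at 0)"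
        using assms by (simp add: power_0_left)
    qed
    then show ?thesis using 3 assms by (simp add: DERIV_def power_0_left)
  qed
qed

text \<open>
  Derivatives below are those of \<open>\<lambda>x. bump \<delta> (w - x)\<close>, so this is minus the gradient of
  \<open>bump\<close>.
\<close>
definition bump_grad :: "real \<Rightarrow> 'a::euclidean_space \<Rightarrow> 'a" where
  "bump_grad \<delta> y = (6 * (max 0 (\<delta>\<^sup>2 - y \<bullet> y))\<^sup>2) *\<^sub>R y"

definition bump_hess :: "real \<Rightarrow> 'a::euclidean_space \<Rightarrow> 'a \<Rightarrow> 'a" where
  "bump_hess \<delta> y v = (24 * max 0 (\<delta>\<^sup>2 - y \<bullet> y) * (y \<bullet> v)) *\<^sub>R y - (6 * (max 0 (\<delta>\<^sup>2 - y \<bullet> y))\<^sup>2) *\<^sub>R v"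

lemma bump_nonneg: "bump \<delta> y \<ge> 0"
  by (simp add: bump_def)

lemma bump_outside:
  assumes "\<delta> \<ge> 0" "norm y \<ge> \<delta>" shows "max 0 (\<delta>\<^sup>2 - y \<bullet> y) = 0"
  using assms power_mono[of \<delta> "norm y" 2] by (simp add: power2_norm_eq_inner)

lemma bump_continuous: "continuous_on S (bump \<delta>)"
  unfolding bump_def by (intro continuous_intros)

lemma bump_has_derivative:
  "(bump \<delta> has_derivative blinfun_apply (- blinfun_inner_left (bump_grad \<delta> y))) (at y)"
proof -
  have p: "((\<lambda>r::real. max 0 r ^ 3) has_derivative (\<lambda>h. 3 * (max 0 r)\<^sup>2 * h)) (at r)" for r
    using pos_part_power_deriv[of 2 r] by (simp add: has_field_derivative_def numeral_3_eq_3 numeral_2_eq_2)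
  have "((\<lambda>y. \<delta>\<^sup>2 - y \<bullet> y) has_derivative (\<lambda>v. - (2 * (y \<bullet> v)))) (at y)"
    by (auto intro!: derivative_eq_intros simp: inner_commute)
  from has_derivative_compose[OF this p]
  show ?thesis
    unfolding bump_def[abs_def]
    by (rule has_derivative_eq_rhs) (simp add: bump_grad_def fun_eq_iff blinfun.bilinear_simps inner_commute)
qed

lemma bump_grad_has_derivative:
  fixes y :: "'a::euclidean_space"
  shows "(bump_grad \<delta> has_derivative (\<lambda>v. - bump_hess \<delta> y v)) (at y)"
proof -
  have p: "((\<lambda>r::real. (max 0 r)\<^sup>2) has_derivative (\<lambda>h. 2 * max 0 r * h)) (at r)" for r
    using pos_part_power_deriv[of 1 r] by (simp add: has_field_derivative_def numeral_2_eq_2)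
  have "((\<lambda>y::'a. \<delta>\<^sup>2 - y \<bullet> y) has_derivative (\<lambda>v. - (2 * (y \<bullet> v)))) (at y)"
    by (auto intro!: derivative_eq_intros simp: inner_commute)
  note q = has_derivative_compose[OF this p]
  show ?thesis
    unfolding bump_grad_def[abs_def]
    by (rule has_derivative_eq_rhs[OF has_derivative_scaleR[OF has_derivative_mult_right[OF q, of 6] has_derivative_ident]])
      (simp add: bump_hess_def fun_eq_iff algebra_simps)
qed

definition bump_hess_blinfun :: "real \<Rightarrow> 'a::euclidean_space \<Rightarrow> 'a \<Rightarrow>\<^sub>L 'a" where
  "bump_hess_blinfun \<delta> y = (24 * max 0 (\<delta>\<^sup>2 - y \<bullet> y)) *\<^sub>R (blinfun_scaleR_left y o\<^sub>L blinfun_inner_left y)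
     - (6 * (max 0 (\<delta>\<^sup>2 - y \<bullet> y))\<^sup>2) *\<^sub>R id_blinfun"

lemma bump_hess_blinfun_apply: "blinfun_apply (bump_hess_blinfun \<delta> y) v = bump_hess \<delta> y v"
  by (simp add: bump_hess_blinfun_def bump_hess_def blinfun.bilinear_simps inner_commute)

lemma bump_hess_continuous: "continuous_on S (\<lambda>y. bump_hess \<delta> y v)"
  unfolding bump_hess_def by (intro continuous_intros)

lemma bump_grad_continuous: "continuous_on S (bump_grad \<delta>)"
  unfolding bump_grad_def by (intro continuous_intros)

lemma kbox_not_empty: "\<delta> > 0 \<Longrightarrow> box (- (\<delta> *\<^sub>R One)) (\<delta> *\<^sub>R One :: 'a::euclidean_space) \<noteq> {}"
  by (auto simp: box_ne_empty)

definition bump_mass :: "'a::euclidean_space itself \<Rightarrow> real \<Rightarrow> real" where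
  "bump_mass _ \<delta> = integral (kbox \<delta> :: 'a set) (bump \<delta>)"

lemma bump_mass_pos:
  assumes "\<delta> > 0" shows "bump_mass TYPE('a::euclidean_space) \<delta> > 0"
proof -
  have i: "(bump \<delta> :: 'a \<Rightarrow> real) integrable_on kbox \<delta>"
    unfolding kbox_def by (intro integrable_continuous bump_continuous)
  then have "bump_mass TYPE('a) \<delta> \<ge> 0"
    unfolding bump_mass_def by (intro Henstock_Kurzweil_Integration.integral_nonneg bump_nonneg)
  moreover have "bump_mass TYPE('a) \<delta> \<noteq> 0"
  proof
    assume z: "bump_mass TYPE('a) \<delta> = 0"
    have "bump \<delta> (0::'a) = 0"
    proof (rule has_integral_0_cbox_imp_0[where f="bump \<delta>" and a="- (\<delta> *\<^sub>R One)" and b="\<delta> *\<^sub>R One"])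
      show "(bump \<delta> has_integral 0) (cbox (- (\<delta> *\<^sub>R One)) (\<delta> *\<^sub>R One :: 'a))"
        using integrable_integral[OF i] z by (simp add: bump_mass_def kbox_def)
    qed (use assms kbox_not_empty[of \<delta>, where 'a='a] in \<open>simp_all add: bump_continuous bump_nonneg mem_box\<close>)
    then show False using assms by (simp add: bump_def)
  qed
  ultimately show ?thesis by linarith
qed

text \<open>
  The average against the normalised kernel. Keeping it separate from its use in convolutions
  makes every inequality between values of a function pass to its mollification, by linearity
  and monotonicity.
\<close>
definition wavg :: "real \<Rightarrow> ('a::euclidean_space \<Rightarrow> real) \<Rightarrow> real" where
  "wavg \<delta> f = integral (kbox \<delta>) (\<lambda>y. bump \<delta> y * f y) / bump_mass TYPE('a) \<delta>"

definition mollify :: "real \<Rightarrow> ('a::euclidean_space \<Rightarrow> real) \<Rightarrow> 'a \<Rightarrow> real" where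
  "mollify \<delta> f x = wavg \<delta> (\<lambda>y. f (x + y))"

lemma wavg_integrable:
  "continuous_on UNIV f \<Longrightarrow> (\<lambda>y. bump \<delta> y * f y) integrable_on kbox \<delta>"
  unfolding kbox_def by (intro integrable_continuous continuous_intros bump_continuous) (rule continuous_on_subset, auto)

lemma wavg_const: "\<delta> > 0 \<Longrightarrow> wavg \<delta> (\<lambda>y::'a::euclidean_space. c) = c"
  using bump_mass_pos[of \<delta>, where 'a='a] by (simp add: wavg_def bump_mass_def)

lemma wavg_add:
  assumes "continuous_on UNIV f" "continuous_on UNIV g"
  shows "wavg \<delta> (\<lambda>y. f y + g y) = wavg \<delta> f + wavg \<delta> g"
  unfolding wavg_def using wavg_integrable[OF assms(1), of \<delta>] wavg_integrable[OF assms(2), of \<delta>]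
  by (simp add: distrib_left Henstock_Kurzweil_Integration.integral_add add_divide_distrib)

lemma wavg_cmult: "wavg \<delta> (\<lambda>y. c * f y) = c * wavg \<delta> f"
proof -
  have "(\<lambda>y. bump \<delta> y * (c * f y)) = (\<lambda>y. c * (bump \<delta> y * f y))" by (auto simp: mult_ac)
  then show ?thesis by (simp add: wavg_def)
qed

lemma wavg_affine:
  fixes f g :: "'a::euclidean_space \<Rightarrow> real"
  assumes f: "continuous_on UNIV f" and g: "continuous_on UNIV g" and d: "\<delta> > 0"
  shows "wavg \<delta> (\<lambda>y. a * f y + b * g y + c) = a * wavg \<delta> f + b * wavg \<delta> g + c"
proof -
  have "wavg \<delta> (\<lambda>y. (a * f y + b * g y) + c) = wavg \<delta> (\<lambda>y. a * f y + b * g y) + wavg \<delta> (\<lambda>y::'a. c)"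
    by (intro wavg_add continuous_intros f g)
  also have "wavg \<delta> (\<lambda>y. a * f y + b * g y) = wavg \<delta> (\<lambda>y. a * f y) + wavg \<delta> (\<lambda>y. b * g y)"
    by (intro wavg_add continuous_intros f g)
  finally show ?thesis by (simp only: wavg_cmult wavg_const[OF d])
qed

lemma wavg_mono:
  assumes "continuous_on UNIV f" "continuous_on UNIV g" "\<delta> > 0" "\<And>y. norm y \<le> \<delta> \<Longrightarrow> f y \<le> g y"
  shows "wavg \<delta> f \<le> wavg \<delta> g"
  unfolding wavg_def
proof (intro divide_right_mono integral_le wavg_integrable assms less_imp_le[OF bump_mass_pos])
  fix y show "bump \<delta> y * f y \<le> bump \<delta> y * g y"
  proof (cases "norm y \<le> \<delta>")
    case True
    then show ?thesis by (simp add: assms mult_left_mono bump_nonneg)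
  next
    case False
    then show ?thesis using bump_outside[of \<delta> y] assms(3) by (simp add: bump_def)
  qed
qed

lemma mollify_eq_kconv: "mollify \<delta> f x = kconv \<delta> (bump \<delta>) f x / bump_mass TYPE('a) \<delta>"
  for x :: "'a::euclidean_space"
  by (simp add: mollify_def wavg_def kconv_def mult.commute)

text \<open>
  The Hessian \<open>M\<close> of a mollification is symmetric because that of the kernel is. The trace
  estimate for the divergence of the velocity field relies on this symmetry.
\<close>
lemma mollify_C2:
  fixes f :: "'a::euclidean_space \<Rightarrow> real"
  assumes f: "continuous_on UNIV f" and d: "\<delta> > 0"
  obtains G and M :: "'a \<Rightarrow> 'a \<Rightarrow> 'a" where
    "\<And>x. (mollify \<delta> f has_derivative (\<lambda>v. G x \<bullet> v)) (at x)"
    "continuous_on UNIV G"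
    "\<And>x. (G has_derivative M x) (at x)"
    "\<And>v. continuous_on UNIV (\<lambda>x. M x v)"
    "\<And>x v w. M x v \<bullet> w = M x w \<bullet> v"
proof -
  let ?Z = "bump_mass TYPE('a) \<delta>"
  have out: "max 0 (\<delta>\<^sup>2 - y \<bullet> y) = 0" if "\<delta> \<le> norm y" for y :: 'a
    using bump_outside[of \<delta> y] d that by simp
  have inner0: "blinfun_inner_left (0::'a) = 0"
    by (rule blinfun_eqI) simp
  define G where "G x = kconv \<delta> (bump_grad \<delta>) f x /\<^sub>R ?Z" for x
  define M where "M x v = kconv \<delta> (\<lambda>y. bump_hess \<delta> y v) f x /\<^sub>R ?Z" for x v
  have "(kconv \<delta> (bump \<delta>) f has_derivative
      (\<lambda>v. kconv \<delta> (\<lambda>y. - blinfun_apply (- blinfun_inner_left (bump_grad \<delta> y)) v) f x)) (at x)" for x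
  proof (rule kconv_has_derivative[OF f bump_has_derivative])
    show "continuous_on UNIV (\<lambda>y. - blinfun_inner_left (bump_grad \<delta> y))"
      unfolding bump_grad_def by (intro continuous_intros)
  qed (simp_all add: bump_def bump_grad_def out inner0)
  then have "((\<lambda>x. kconv \<delta> (bump \<delta>) f x / ?Z) has_derivative
      (\<lambda>v. kconv \<delta> (\<lambda>y. - blinfun_apply (- blinfun_inner_left (bump_grad \<delta> y)) v) f x / ?Z)) (at x)" for x
    by (rule bounded_linear.has_derivative[OF bounded_linear_divide])
  moreover have "kconv \<delta> (\<lambda>y. - blinfun_apply (- blinfun_inner_left (bump_grad \<delta> y)) v) f x / ?Z = G x \<bullet> v" for x v
  proof -
    have "(\<lambda>y. f (x + y) *\<^sub>R bump_grad \<delta> y) integrable_on kbox \<delta>"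
      unfolding kbox_def by (intro integrable_continuous continuous_intros bump_grad_continuous continuous_on_compose2[OF f]) auto
    then have "kconv \<delta> (bump_grad \<delta>) f x \<bullet> v = integral (kbox \<delta>) (\<lambda>y. (f (x + y) *\<^sub>R bump_grad \<delta> y) \<bullet> v)"
      using integral_linear[OF _ bounded_linear_inner_left[of v]] unfolding kconv_def o_def by metis
    then show ?thesis
      by (simp add: G_def kconv_def blinfun.bilinear_simps inner_commute divide_inverse mult.commute)
  qed
  ultimately have G: "(mollify \<delta> f has_derivative (\<lambda>v. G x \<bullet> v)) (at x)" for x
    by (simp add: mollify_eq_kconv[abs_def])
  have Gc: "continuous_on UNIV G"
    unfolding G_def by (intro continuous_intros kconv_continuous f bump_grad_continuous)
  have "(kconv \<delta> (bump_grad \<delta>) f has_derivative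
      (\<lambda>v. kconv \<delta> (\<lambda>y. - blinfun_apply (- bump_hess_blinfun \<delta> y) v) f x)) (at x)" for x
  proof (rule kconv_has_derivative[OF f])
    show "(bump_grad \<delta> has_derivative blinfun_apply (- bump_hess_blinfun \<delta> y)) (at y)" for y :: 'a
      using bump_grad_has_derivative[of \<delta> y]
      by (rule has_derivative_eq_rhs) (simp add: bump_hess_blinfun_apply blinfun.bilinear_simps fun_eq_iff)
    show "continuous_on UNIV (\<lambda>y::'a. - bump_hess_blinfun \<delta> y)"
      unfolding bump_hess_blinfun_def by (intro continuous_intros)
  qed (simp_all add: bump_hess_blinfun_def bump_grad_def out)
  then have "((\<lambda>x. kconv \<delta> (bump_grad \<delta>) f x /\<^sub>R ?Z) has_derivative
      (\<lambda>v. kconv \<delta> (\<lambda>y. - blinfun_apply (- bump_hess_blinfun \<delta> y) v) f x /\<^sub>R ?Z)) (at x)" for x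
    by (rule has_derivative_scaleR_right)
  then have M: "(G has_derivative M x) (at x)" for x
    by (simp add: G_def[abs_def] M_def[abs_def] bump_hess_blinfun_apply blinfun.bilinear_simps)
  have Mc: "continuous_on UNIV (\<lambda>x. M x v)" for v
    unfolding M_def by (intro continuous_intros kconv_continuous f bump_hess_continuous)
  have "M x v \<bullet> w = integral (kbox \<delta>) (\<lambda>y. (f (x + y) *\<^sub>R bump_hess \<delta> y v) \<bullet> w) / ?Z" for x v w
  proof -
    have "(\<lambda>y. f (x + y) *\<^sub>R bump_hess \<delta> y v) integrable_on kbox \<delta>"
      unfolding kbox_def by (intro integrable_continuous continuous_intros bump_hess_continuous continuous_on_compose2[OF f]) auto
    then have "kconv \<delta> (\<lambda>y. bump_hess \<delta> y v) f x \<bullet> w = integral (kbox \<delta>) (\<lambda>y. (f (x + y) *\<^sub>R bump_hess \<delta> y v) \<bullet> w)"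
      using integral_linear[OF _ bounded_linear_inner_left[of w]] unfolding kconv_def o_def by metis
    then show ?thesis by (simp add: M_def divide_inverse mult.commute)
  qed
  moreover have "bump_hess \<delta> y v \<bullet> w = bump_hess \<delta> y w \<bullet> v" for y v w :: 'a
    by (simp add: bump_hess_def inner_simps inner_commute)
  ultimately have sym: "M x v \<bullet> w = M x w \<bullet> v" for x v w
    by simp
  show ?thesis by (rule that[OF G Gc M Mc sym])
qed

section \<open>Convexity and positive semidefinite forms\<close>

lemma convex_on_tangent_le:
  fixes f :: "'a::real_normed_vector \<Rightarrow> real"
  assumes f: "convex_on UNIV f" and d: "(f has_derivative f') (at x)"
  shows "f x + f' (y - x) \<le> f y"
proof -
  let ?g = "\<lambda>t::real. f (x + t *\<^sub>R (y - x))"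
  have "convex_on UNIV ?g"
  proof (rule convex_onI)
    fix t a b :: real assume t: "0 < t" "t < 1"
    have "x + ((1 - t) *\<^sub>R a + t *\<^sub>R b) *\<^sub>R (y - x) = (1 - t) *\<^sub>R (x + a *\<^sub>R (y - x)) + t *\<^sub>R (x + b *\<^sub>R (y - x))"
      by (simp add: algebra_simps)
    then show "?g ((1 - t) *\<^sub>R a + t *\<^sub>R b) \<le> (1 - t) * ?g a + t * ?g b"
      using convex_onD[OF f, of t "x + a *\<^sub>R (y - x)" "x + b *\<^sub>R (y - x)"] t by simp
  qed auto
  moreover have "(?g has_field_derivative f' (y - x)) (at 0)"
  proof -
    have "((\<lambda>t::real. x + t *\<^sub>R (y - x)) has_derivative (\<lambda>t. t *\<^sub>R (y - x))) (at 0)"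
      by (auto intro!: derivative_eq_intros)
    from has_derivative_compose[OF this, of f f'] d
    have "(?g has_derivative (\<lambda>t. f' (t *\<^sub>R (y - x)))) (at 0)" by simp
    moreover have "f' (t *\<^sub>R (y - x)) = f' (y - x) * t" for t
      using linear_scale[OF has_derivative_linear[OF d]] by simp
    ultimately show ?thesis by (simp add: has_field_derivative_def)
  qed
  ultimately have "f' (y - x) * (1 - 0) \<le> ?g 1 - ?g 0"
    by (intro convex_on_imp_above_tangent[where A=UNIV]) auto
  then show ?thesis by simp
qed

text \<open>
  The trace of a product of two positive semidefinite forms is nonnegative. This is Cholesky
  elimination: if \<open>A k k > 0\<close>, then \<open>A\<close> is the sum of a rank-one form, on which the claim is
  positivity of \<open>M\<close>, and of a positive semidefinite form without row and column \<open>k\<close>; if \<open>A k k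
  = 0\<close>, that row and column vanish already.
\<close>
lemma psd_trace_product_nonneg:
  fixes A M :: "'i \<Rightarrow> 'i \<Rightarrow> real"
  assumes "finite J"
    and "\<And>i j. i \<in> J \<Longrightarrow> j \<in> J \<Longrightarrow> A i j = A j i"
    and "\<And>x. (\<Sum>i\<in>J. \<Sum>j\<in>J. x i * x j * A i j) \<ge> 0"
    and M: "\<And>x. (\<Sum>i\<in>J. \<Sum>j\<in>J. x i * x j * M i j) \<ge> 0"
  shows "(\<Sum>i\<in>J. \<Sum>j\<in>J. A i j * M i j) \<ge> 0"
  using assms
proof (induction J arbitrary: A rule: finite_induct)
  case empty
  then show ?case by simp
next
  case (insert k J)
  note sym = insert.prems(1) and psd = insert.prems(2) and Mpsd = insert.prems(3)
  have expand: "(\<Sum>i\<in>insert k J. \<Sum>j\<in>insert k J. x i * x j * B i j)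
      = x k * x k * B k k + x k * (\<Sum>j\<in>J. x j * (B k j + B j k)) + (\<Sum>i\<in>J. \<Sum>j\<in>J. x i * x j * B i j)"
    for x and B :: "'i \<Rightarrow> 'i \<Rightarrow> real"
    using insert.hyps by (simp add: sum.distrib sum_distrib_left algebra_simps)
  have MJ: "(\<Sum>i\<in>J. \<Sum>j\<in>J. x i * x j * M i j) \<ge> 0" for x
  proof -
    let ?y = "\<lambda>i. if i = k then 0 else x i"
    have "(\<Sum>i\<in>J. \<Sum>j\<in>J. ?y i * ?y j * M i j) = (\<Sum>i\<in>J. \<Sum>j\<in>J. x i * x j * M i j)"
      by (intro sum.cong refl) (use insert.hyps in auto)
    then show ?thesis using Mpsd[of ?y] unfolding expand by simp
  qed
  have q: "x k * x k * A k k + 2 * x k * (\<Sum>j\<in>J. x j * A k j) + (\<Sum>i\<in>J. \<Sum>j\<in>J. x i * x j * A i j) \<ge> 0" for x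
  proof -
    have "(\<Sum>j\<in>J. x j * (A k j + A j k)) = 2 * (\<Sum>j\<in>J. x j * A k j)"
      unfolding sum_distrib_left by (intro sum.cong refl) (use sym in auto)
    then show ?thesis using psd[of x] unfolding expand by (simp add: algebra_simps)
  qed
  have Akk: "A k k \<ge> 0"
  proof -
    let ?x = "\<lambda>i. if i = k then 1 else (0::real)"
    have "(\<Sum>j\<in>J. ?x j * A k j) = 0" "(\<Sum>i\<in>J. \<Sum>j\<in>J. ?x i * ?x j * A i j) = 0"
      by (intro sum.neutral ballI; use insert.hyps in auto)+
    then show ?thesis using q[of ?x] by simp
  qed
  define A' where "A' i j = A i j - A k i * A k j / A k k" for i j
  have sym': "A' i j = A' j i" if "i \<in> J" "j \<in> J" for i j
    using sym[of i j] that by (simp add: A'_def mult.commute)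
  show ?case
  proof (cases "A k k = 0")
    case True
    have z: "A k j = 0" if j: "j \<in> J" for j
    proof (rule ccontr)
      assume n: "A k j \<noteq> 0"
      have jk: "j \<noteq> k" using j insert.hyps by auto
      \<comment> \<open>the quadratic form at \<open>t e\<^sub>k + e\<^sub>j\<close> would be \<open>- 1\<close>\<close>
      define t where "t = - (A j j + 1) / (2 * A k j)"
      let ?x = "\<lambda>i. if i = k then t else if i = j then 1 else (0::real)"
      have "(\<Sum>i\<in>J. ?x i * A k i) = (\<Sum>i\<in>J. if i = j then A k j else 0)"
        by (intro sum.cong) (use insert.hyps in auto)
      then have 1: "(\<Sum>i\<in>J. ?x i * A k i) = A k j" using insert.hyps j by simp
      have "(\<Sum>i\<in>J. \<Sum>l\<in>J. ?x i * ?x l * A i l) = (\<Sum>i\<in>J. \<Sum>l\<in>J. if l = j then (if i = j then A j j else 0) else 0)"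
        by (intro sum.cong refl) (use insert.hyps in auto)
      then have 2: "(\<Sum>i\<in>J. \<Sum>l\<in>J. ?x i * ?x l * A i l) = A j j"
        using insert.hyps j by simp
      have "2 * t * A k j + A j j \<ge> 0"
        using q[of ?x] unfolding 1 2 True by simp
      moreover have "2 * t * A k j = - (A j j + 1)" using n by (simp add: t_def field_simps)
      ultimately show False by simp
    qed
    have P: "(\<Sum>i\<in>J. \<Sum>j\<in>J. x i * x j * A i j) \<ge> 0" for x
    proof -
      have "(\<Sum>j\<in>J. x j * A k j) = 0"
        by (intro sum.neutral ballI) (simp add: z)
      then show ?thesis using q[of x] True by simp
    qed
    have "(\<Sum>i\<in>J. \<Sum>j\<in>J. A i j * M i j) \<ge> 0"
      by (rule insert.IH; (rule P MJ sym; simp)?)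
    moreover have "A j k = 0" if "j \<in> J" for j using z[OF that] sym[of j k] that by simp
    moreover have "(\<Sum>j\<in>J. A k j * M k j) = 0" "(\<Sum>i\<in>J. A i k * M i k) = 0"
      using z calculation(2) by (auto intro!: sum.neutral)
    ultimately show ?thesis
      using True by (simp add: insert.hyps sum.distrib)
  next
    case False
    then have pos: "A k k > 0" using Akk by simp
    have P: "(\<Sum>i\<in>J. \<Sum>j\<in>J. x i * x j * A' i j) \<ge> 0" for x
    proof -
      let ?s = "\<Sum>j\<in>J. x j * A k j"
      let ?y = "\<lambda>i. if i = k then - ?s / A k k else x i"
      have 1: "(\<Sum>j\<in>J. ?y j * A k j) = ?s"
        by (intro sum.cong) (use insert.hyps in auto)
      have 2: "(\<Sum>i\<in>J. \<Sum>j\<in>J. ?y i * ?y j * A i j) = (\<Sum>i\<in>J. \<Sum>j\<in>J. x i * x j * A i j)"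
        by (intro sum.cong refl) (use insert.hyps in auto)
      have "(\<Sum>i\<in>J. \<Sum>j\<in>J. x i * x j * A' i j) = (\<Sum>i\<in>J. \<Sum>j\<in>J. x i * x j * A i j) - ?s * ?s / A k k"
        unfolding A'_def sum_product sum_divide_distrib sum_subtractf[symmetric]
        by (intro sum.cong refl) (simp add: algebra_simps)
      moreover have "?s * ?s / A k k - 2 * (?s * ?s / A k k) + (\<Sum>i\<in>J. \<Sum>j\<in>J. x i * x j * A i j) \<ge> 0"
        using q[of ?y] pos unfolding 1 2 by simp
      ultimately show ?thesis by simp
    qed
    have "(\<Sum>i\<in>J. \<Sum>j\<in>J. A' i j * M i j) \<ge> 0"
      by (rule insert.IH; (rule P MJ sym'; simp)?)
    moreover have "A' k j = 0" "A' j k = 0" if "j \<in> insert k J" for j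
      using sym[of j k] that False by (auto simp: A'_def)
    ultimately have "(\<Sum>i\<in>insert k J. \<Sum>j\<in>insert k J. A' i j * M i j) \<ge> 0"
      using insert.hyps by simp
    moreover have "(\<Sum>i\<in>insert k J. \<Sum>j\<in>insert k J. A i j * M i j) =
        (\<Sum>i\<in>insert k J. \<Sum>j\<in>insert k J. A' i j * M i j)
        + (\<Sum>i\<in>insert k J. \<Sum>j\<in>insert k J. A k i * A k j * M i j) / A k k"
      unfolding sum_divide_distrib sum.distrib[symmetric]
      by (intro sum.cong refl) (simp add: A'_def algebra_simps)
    ultimately show ?thesis
      using Mpsd[of "A k"] pos by simp
  qed
qed

section \<open>Integration of periodic functions\<close>

lemma axis_expansion: "y = (\<Sum>i\<in>UNIV. (y $ i) *\<^sub>R axis i 1)" for y :: "real ^ 'd::finite"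
  by (simp add: vec_eq_iff axis_def if_distrib cong: if_cong)

lemma inner_gradient:
  fixes A :: "(real ^ 'd::finite) \<Rightarrow>\<^sub>L real"
  shows "(\<Sum>i\<in>UNIV. blinfun_apply A (axis i 1) *\<^sub>R axis i 1) \<bullet> p = blinfun_apply A p"
proof -
  have "A p = A (\<Sum>i\<in>UNIV. (p $ i) *\<^sub>R axis i 1)" using axis_expansion[of p] by simp
  then show ?thesis
    by (simp add: blinfun.sum_right blinfun.scaleR_right inner_sum_left inner_axis' mult.commute)
qed

lemma torus_periodic_int_shift:
  assumes "torus_periodic f"
  shows "f (x + axis j (of_int k)) = f x"
proof -
  have n: "f (x + axis j (of_nat n)) = f x" for x n
  proof (induction n)
    case (Suc n)
    have "x + axis j (of_nat (Suc n)) = (x + axis j (of_nat n)) + axis j 1"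
      by (simp add: vec_eq_iff axis_def)
    then show ?case using assms Suc by (simp only: torus_periodic_def)
  qed (simp add: axis_def flip: zero_vec_def)
  show ?thesis
  proof (cases "k \<ge> 0")
    case True
    then show ?thesis using n[of x "nat k"] by simp
  next
    case False
    have "f ((x + axis j (of_int k)) + axis j (of_nat (nat (- k)))) = f (x + axis j (of_int k))"
      by (rule n)
    moreover have "(x + axis j (of_int k)) + axis j (of_nat (nat (- k))) = x"
      using False by (simp add: vec_eq_iff axis_def)
    ultimately show ?thesis by simp
  qed
qed

lemma torus_periodic_vec_shift:
  assumes "torus_periodic f"
  shows "f (x + (\<chi> j. of_int (k j))) = f x"
proof -
  have "f (x + (\<chi> j. if j \<in> S then of_int (k j) else 0)) = f x" for S
  proof (induction S rule: finite_induct[OF finite])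
    case (2 i S)
    have "x + (\<chi> j. if j \<in> insert i S then of_int (k j) else 0)
        = (x + (\<chi> j. if j \<in> S then of_int (k j) else 0)) + axis i (of_int (k i))"
      using 2 by (auto simp: vec_eq_iff axis_def)
    then show ?case using 2 by (simp only: torus_periodic_int_shift[OF assms])
  qed (simp flip: zero_vec_def)
  from this[of UNIV] show ?thesis by simp
qed

text \<open>
  One representative serves all periodic functions at once.
\<close>
lemma torus_representative:
  fixes x :: "real ^ 'd::finite"
  obtains y where "y \<in> cbox 0 1" "\<And>f :: real ^ 'd \<Rightarrow> 'b. torus_periodic f \<Longrightarrow> f x = f y"
proof
  let ?y = "\<chi> j. frac (x $ j)"
  show "?y \<in> cbox 0 1"
    by (auto simp: mem_box_cart less_imp_le[OF frac_lt_1])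
  have "x = ?y + (\<chi> j. of_int \<lfloor>x $ j\<rfloor>)"
    by (simp add: vec_eq_iff frac_def)
  then show "f x = f ?y" if "torus_periodic f" for f :: "real ^ 'd \<Rightarrow> 'b"
    using torus_periodic_vec_shift[OF that, of ?y "\<lambda>j. \<lfloor>x $ j\<rfloor>"] by simp
qed

abbreviation torus_integral :: "(real ^ 'd::finite \<Rightarrow> real) \<Rightarrow> real" where
  "torus_integral f \<equiv> integral (cbox 0 1) f"

text \<open>
  Cut the cube by a hyperplane and translate one of the two pieces by a period.
\<close>
lemma torus_integral_axis_shift:
  fixes f :: "real ^ 'd::finite \<Rightarrow> real"
  assumes f: "continuous_on UNIV f" and p: "torus_periodic f"
  shows "integral (cbox 0 1) (\<lambda>x. f (x + axis j t)) = integral (cbox 0 1) f"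
proof -
  define s where "s = frac t"
  have s: "0 \<le> s" "s \<le> 1" by (auto simp: s_def less_imp_le[OF frac_lt_1])
  have eq: "f (x + axis j t) = f (x + axis j s)" for x
  proof -
    have "x + axis j t = (x + axis j s) + axis j (of_int \<lfloor>t\<rfloor>)"
      by (simp add: vec_eq_iff axis_def s_def frac_def)
    then show ?thesis by (simp only: torus_periodic_int_shift[OF p])
  qed
  have int: "f integrable_on cbox a b" for a b
    by (intro integrable_continuous continuous_on_subset[OF f]) auto
  let ?b = "\<chi> i. if i = j then s else 1"
  have ax: "axis j r $ i = (if i = j then r else 0)" for r :: real and i
    by (simp add: axis_def)
  have mem: "x \<in> cbox a b \<longleftrightarrow> (a $ j \<le> x $ j \<and> x $ j \<le> b $ j) \<and> (\<forall>i. i \<noteq> j \<longrightarrow> a $ i \<le> x $ i \<and> x $ i \<le> b $ i)"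
    for x a b :: "real ^ 'd"
    unfolding mem_box_cart by metis
  have B: "axis j 1 \<in> (Basis :: (real ^ 'd) set)" by simp
  have "integral (cbox 0 1) f = integral (cbox 0 1 \<inter> {x. x \<bullet> axis j 1 \<le> s}) f
      + integral (cbox 0 1 \<inter> {x. x \<bullet> axis j 1 \<ge> s}) f"
    by (rule integral_split[OF int B])
  also have "cbox 0 1 \<inter> {x. x \<bullet> axis j 1 \<le> s} = cbox 0 ?b"
    using s by (auto simp: mem ax inner_axis)
  also have "cbox 0 1 \<inter> {x. x \<bullet> axis j 1 \<ge> s} = cbox (axis j s) 1"
    using s by (auto simp: mem ax inner_axis)
  finally have 1: "integral (cbox 0 1) f = integral (cbox 0 ?b) f + integral (cbox (axis j s) 1) f" .
  have "integral (cbox 0 1) (\<lambda>x. f (x + axis j s)) = integral (cbox (axis j s) (1 + axis j s)) f"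
    using integral_shift_cbox[of "axis j s" "axis j s" "1 + axis j s" f] by simp
  also have "\<dots> = integral (cbox (axis j s) (1 + axis j s) \<inter> {x. x \<bullet> axis j 1 \<le> 1}) f
      + integral (cbox (axis j s) (1 + axis j s) \<inter> {x. x \<bullet> axis j 1 \<ge> 1}) f"
    by (rule integral_split[OF int B])
  also have "cbox (axis j s) (1 + axis j s) \<inter> {x. x \<bullet> axis j 1 \<le> 1} = cbox (axis j s) 1"
    using s by (auto simp: mem ax inner_axis)
  also have "cbox (axis j s) (1 + axis j s) \<inter> {x. x \<bullet> axis j 1 \<ge> 1} = cbox (axis j 1) (?b + axis j 1)"
    using s by (auto simp: mem ax inner_axis)
  also have "integral (cbox (axis j 1) (?b + axis j 1)) f = integral (cbox 0 ?b) (\<lambda>x. f (x + axis j 1))"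
    using integral_shift_cbox[of "axis j 1" "axis j 1" "?b + axis j 1" f] by simp
  also have "\<dots> = integral (cbox 0 ?b) f"
    using p by (simp add: torus_periodic_def)
  finally show ?thesis using 1 by (simp add: eq)
qed

lemma torus_periodic_shift: "torus_periodic f \<Longrightarrow> torus_periodic (\<lambda>x. f (x + a))"
  unfolding torus_periodic_def by (metis (no_types) add.assoc add.commute)

lemma torus_integral_shift:
  fixes f :: "real ^ 'd::finite \<Rightarrow> real"
  assumes f: "continuous_on UNIV f" and p: "torus_periodic f"
  shows "integral (cbox 0 1) (\<lambda>x. f (x + a)) = integral (cbox 0 1) f"
proof -
  have "integral (cbox 0 1) (\<lambda>x. f (x + (\<chi> j. if j \<in> S then a $ j else 0))) = integral (cbox 0 1) f" for S
  proof (induction S rule: finite_induct[OF finite])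
    case (2 i S)
    let ?c = "\<chi> j. if j \<in> S then a $ j else 0"
    have "x + (\<chi> j. if j \<in> insert i S then a $ j else 0) = (x + axis i (a $ i)) + ?c" for x
      using 2 by (auto simp: vec_eq_iff axis_def)
    then have "integral (cbox 0 1) (\<lambda>x. f (x + (\<chi> j. if j \<in> insert i S then a $ j else 0)))
        = integral (cbox 0 1) (\<lambda>x. (\<lambda>x. f (x + ?c)) (x + axis i (a $ i)))"
      by (simp only:)
    also have "\<dots> = integral (cbox 0 1) (\<lambda>x. f (x + ?c))"
      by (intro torus_integral_axis_shift continuous_on_compose2[OF f] continuous_intros torus_periodic_shift p) auto
    finally show ?case using 2 by simp
  qed (simp flip: zero_vec_def)
  from this[of UNIV] show ?thesis by (simp add: vec_nth_inverse)
qed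

lemma torus_periodic_derivative:
  fixes f :: "real ^ 'd::finite \<Rightarrow> real"
  assumes p: "torus_periodic f" and d: "\<And>x. (f has_derivative D x) (at x)"
  shows "D (x + axis j 1) = D x"
proof -
  have "((\<lambda>x. x + axis j 1) has_derivative (\<lambda>v. v)) (at x)"
    by (auto intro!: derivative_eq_intros)
  from has_derivative_compose[OF this d]
  have "((\<lambda>x. f (x + axis j 1)) has_derivative D (x + axis j 1)) (at x)" by simp
  then have "(f has_derivative D (x + axis j 1)) (at x)"
    using p by (simp add: torus_periodic_def)
  from has_derivative_unique[OF this d] show ?thesis .
qed

text \<open>
  Integrate the derivative along \<open>v\<close> over unit time: this gives \<open>f (x + v) - f x\<close>, whose
  integral over the torus is zero, and after exchanging the integrals the inner one is
  independent of time.
\<close>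
lemma torus_integral_derivative:
  fixes f :: "real ^ 'd::finite \<Rightarrow> real"
  assumes p: "torus_periodic f"
    and d: "\<And>x. (f has_derivative D x) (at x)" and Dv: "continuous_on UNIV (\<lambda>x. D x v)"
  shows "integral (cbox 0 1) (\<lambda>x. D x v) = 0"
proof -
  have f: "continuous_on UNIV f"
    by (rule has_derivative_imp_continuous[OF d])
  have pD: "torus_periodic (\<lambda>x. D x v)"
    using torus_periodic_derivative[OF p d] by (simp add: torus_periodic_def)
  have ftc: "((\<lambda>s. D (x + s *\<^sub>R v) v) has_integral (f (x + v) - f x)) {0..1::real}" for x
  proof -
    have "((\<lambda>s. D (x + s *\<^sub>R v) v) has_integral (f (x + 1 *\<^sub>R v) - f (x + 0 *\<^sub>R v))) {0..1::real}"
    proof (rule fundamental_theorem_of_calculus)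
      fix s :: real
      have "((\<lambda>s. x + s *\<^sub>R v) has_derivative (\<lambda>t. t *\<^sub>R v)) (at s)"
        by (auto intro!: derivative_eq_intros)
      from has_derivative_compose[OF this d]
      have "((\<lambda>s. f (x + s *\<^sub>R v)) has_derivative (\<lambda>t. D (x + s *\<^sub>R v) (t *\<^sub>R v))) (at s within {0..1})"
        by (rule has_derivative_at_withinI)
      then show "((\<lambda>s. f (x + s *\<^sub>R v)) has_vector_derivative D (x + s *\<^sub>R v) v) (at s within {0..1})"
        by (simp add: has_vector_derivative_def linear_scale[OF has_derivative_linear[OF d]])
    qed simp
    then show ?thesis by simp
  qed
  have "0 = integral (cbox 0 1) (\<lambda>x. f (x + v) - f x)"
    using torus_integral_shift[OF f p, of v]
    by (subst Henstock_Kurzweil_Integration.integral_diff)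
      (auto intro!: integrable_continuous continuous_on_compose2[OF f] continuous_intros)
  also have "\<dots> = integral (cbox 0 1) (\<lambda>x. integral (cbox 0 1) (\<lambda>s. D (x + s *\<^sub>R v) v))"
    unfolding box_real using integral_unique[OF ftc] by simp
  also have "\<dots> = integral (cbox 0 1) (\<lambda>s. integral (cbox 0 1) (\<lambda>x. D (x + s *\<^sub>R v) v))"
    by (rule integral_swap_continuous)
      (auto simp: split_beta intro!: continuous_intros continuous_on_compose2[OF Dv])
  also have "\<dots> = integral (cbox 0 (1::real)) (\<lambda>s. integral (cbox 0 1) (\<lambda>x. D x v))"
    by (intro integral_cong torus_integral_shift[OF Dv pD])
  finally show ?thesis by simp
qed

section \<open>Viscosity solutions and smooth test functions\<close>

lemma has_derivative_le_of_increment: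
  fixes f :: "'a::real_normed_vector \<Rightarrow> real"
  assumes d: "(f has_derivative f') (at z)"
    and e: "e > 0" and le: "\<And>s. 0 < s \<Longrightarrow> s < e \<Longrightarrow> f (z + s *\<^sub>R v) \<le> f z + s * c"
  shows "f' v \<le> c"
proof -
  have "((\<lambda>s::real. z + s *\<^sub>R v) has_derivative (\<lambda>s. s *\<^sub>R v)) (at 0)"
    by (auto intro!: derivative_eq_intros)
  from has_derivative_compose[OF this, of f f'] d
  have "((\<lambda>s. f (z + s *\<^sub>R v)) has_derivative (\<lambda>s. f' (s *\<^sub>R v))) (at 0)" by simp
  moreover have "f' (s *\<^sub>R v) = f' v * s" for s
    using linear_scale[OF has_derivative_linear[OF d]] by simp
  ultimately have "((\<lambda>s. f (z + s *\<^sub>R v)) has_real_derivative f' v) (at 0)"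
    by (simp add: has_field_derivative_def)
  then have "((\<lambda>s. (f (z + s *\<^sub>R v) - f z) / s) \<longlongrightarrow> f' v) (at_right 0)"
    unfolding DERIV_def by (auto intro: filterlim_mono at_le)
  then show ?thesis
  proof (rule tendsto_upperbound)
    show "\<forall>\<^sub>F s in at_right 0. (f (z + s *\<^sub>R v) - f z) / s \<le> c"
    proof -
      have "\<forall>\<^sub>F s in at_right (0::real). s < e" using e by (rule order_tendstoD[OF tendsto_ident_at])
      then show ?thesis
        using eventually_at_right_less[of "0::real"]
        by eventually_elim (use le in \<open>auto simp: field_simps\<close>)
    qed
  qed simp
qed

lemma torus_periodic_uniform_modulus:
  fixes f :: "real ^ 'd::finite \<Rightarrow> real"
  assumes f: "continuous_on UNIV f" and p: "torus_periodic f" and e: "e > 0"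
  obtains d where "d > 0" "\<And>x y. norm y \<le> d \<Longrightarrow> \<bar>f (x + y) - f x\<bar> \<le> e"
proof -
  obtain B where B: "\<And>x. x \<in> cbox 0 (1 :: real ^ 'd) \<Longrightarrow> norm x \<le> B"
    using bounded_cbox[of 0 "1 :: real ^ 'd"] unfolding bounded_iff by blast
  have "uniformly_continuous_on (cball 0 (B + 1)) f"
    by (intro compact_uniformly_continuous continuous_on_subset[OF f]) auto
  then obtain d where d: "d > 0" "\<And>x y. x \<in> cball 0 (B + 1) \<Longrightarrow> y \<in> cball 0 (B + 1) \<Longrightarrow> dist y x < d \<Longrightarrow> dist (f y) (f x) < e"
    using e unfolding uniformly_continuous_on_def by metis
  show ?thesis
  proof (rule that[of "min 1 (d / 2)"])
    show "min 1 (d / 2) > 0" using d by simp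
    fix x y :: "real ^ 'd" assume y: "norm y \<le> min 1 (d / 2)"
    have per: "torus_periodic (\<lambda>x. f (x + y) - f x)"
      using torus_periodic_shift[OF p, of y] p by (auto simp: torus_periodic_def)
    obtain x' where x'1: "x' \<in> cbox 0 1" and r: "\<And>f :: real ^ 'd \<Rightarrow> real. torus_periodic f \<Longrightarrow> f x = f x'"
      by (rule torus_representative[of x]) (rule that)
    have x': "x' \<in> cbox 0 1" "f (x + y) - f x = f (x' + y) - f x'"
      using x'1 r[OF per] by simp_all
    have "dist (f (x' + y)) (f x') < e"
    proof (rule d(2)[of x' "x' + y"])
      show "dist (x' + y) x' < d" using y d(1) by (simp add: dist_norm)
      show "x' \<in> cball 0 (B + 1)" using B[OF x'(1)] by simp
      show "x' + y \<in> cball 0 (B + 1)" using B[OF x'(1)] y norm_triangle_ineq[of x' y] by simp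
    qed
    then show "\<bar>f (x + y) - f x\<bar> \<le> e" using x' by (simp add: dist_real_def)
  qed
qed

lemma mollify_periodic: "torus_periodic f \<Longrightarrow> torus_periodic (mollify \<delta> f)"
proof -
  assume "torus_periodic f"
  then have "f (x + axis j 1 + y) = f (x + y)" for x y j
    using torus_periodic_shift[of f y] by (simp add: torus_periodic_def)
  then show ?thesis by (simp add: torus_periodic_def mollify_def)
qed

lemma continuous_translate:
  fixes f :: "'a::real_normed_vector \<Rightarrow> 'b::topological_space"
  assumes "continuous_on UNIV f" shows "continuous_on S (\<lambda>y. f (x + y))"
  by (rule continuous_on_compose2[OF assms]) (auto intro!: continuous_intros)

lemma mollify_close:
  fixes f :: "'a::euclidean_space \<Rightarrow> real"
  assumes f: "continuous_on UNIV f" and d: "\<delta> > 0"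
    and e: "\<And>y. norm y \<le> \<delta> \<Longrightarrow> \<bar>f (x + y) - f x\<bar> \<le> e"
  shows "\<bar>mollify \<delta> f x - f x\<bar> \<le> e"
proof -
  have e': "f (x + y) \<le> f x + e" "f x - e \<le> f (x + y)" if "norm y \<le> \<delta>" for y
    using e[OF that] by linarith+
  have "mollify \<delta> f x \<le> wavg \<delta> (\<lambda>y::'a. f x + e)"
    unfolding mollify_def by (rule wavg_mono[OF continuous_translate[OF f] continuous_on_const d e'(1)])
  moreover have "wavg \<delta> (\<lambda>y::'a. f x - e) \<le> mollify \<delta> f x"
    unfolding mollify_def by (rule wavg_mono[OF continuous_on_const continuous_translate[OF f] d e'(2)])
  ultimately show ?thesis by (simp add: wavg_const d abs_le_iff)
qed

text \<open>
  A smooth subsolution \<open>\<phi>\<close> stays below a viscosity supersolution. If not, then \<open>u - \<phi> + \<eta> / (T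
  - t)\<close> has a negative minimum; by periodicity it is attained, the initial condition excludes
  time \<open>t0\<close> and the penalty excludes times near \<open>T\<close>. There \<open>\<phi> - \<eta> / (T - t)\<close> touches \<open>u\<close> from
  below although it is a strict subsolution.
\<close>
lemma supersolution_comparison:
  fixes u :: "real ^ 'd::finite \<Rightarrow> real \<Rightarrow> real"
  assumes per: "\<And>t. t \<in> {0..T} \<Longrightarrow> torus_periodic (\<lambda>x. u x t)"
    and cont: "continuous_on (UNIV \<times> {0..T}) (\<lambda>(x, t). u x t)"
    and super: "viscosity_supersolution H T u"
    and test: "C1_test T \<phi> a q" and t0: "0 \<le> t0"
    and cphi: "continuous_on (UNIV \<times> {t0..T}) \<phi>"
    and pphi: "\<And>t. t \<in> {t0..T} \<Longrightarrow> torus_periodic (\<lambda>x. \<phi> (x, t))"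
    and sub: "\<And>x t. t \<in> {t0<..<T} \<Longrightarrow> a (x, t) + H (q (x, t)) \<le> 0"
    and init: "\<And>x. \<phi> (x, t0) \<le> u x t0"
    and t: "t \<in> {t0..T}"
  shows "\<phi> (x, t) \<le> u x t"
proof -
  have main: "\<phi> (x1, t1) \<le> u x1 t1" if t1: "t1 \<in> {t0..<T}" for x1 t1
  proof (rule ccontr)
    assume neg: "\<not> \<phi> (x1, t1) \<le> u x1 t1"
    define \<eta> where "\<eta> = (T - t1) * (\<phi> (x1, t1) - u x1 t1) / 2"
    have eta: "\<eta> > 0" and eta1: "\<eta> / (T - t1) < \<phi> (x1, t1) - u x1 t1"
    proof -
      have D: "\<phi> (x1, t1) - u x1 t1 > 0" "T - t1 > 0" using neg t1 by auto
      then show "\<eta> > 0" by (simp add: \<eta>_def)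
      have "\<eta> / (T - t1) = (\<phi> (x1, t1) - u x1 t1) / 2"
        using D(2) unfolding \<eta>_def by (metis less_irrefl nonzero_mult_div_cancel_left times_divide_eq_right)
      then show "\<eta> / (T - t1) < \<phi> (x1, t1) - u x1 t1" using D(1) by simp
    qed
    define \<psi> where "\<psi> z = u (fst z) (snd z) - \<phi> z + \<eta> / (T - snd z)" for z
    have cu: "continuous_on (UNIV \<times> {0..T}) (\<lambda>z. u (fst z) (snd z))"
      using cont by (simp add: split_beta)
    have "continuous_on (cbox 0 1 \<times> {t0..T}) (\<lambda>z. u (fst z) (snd z) - \<phi> z)"
      by (intro continuous_intros continuous_on_subset[OF cu] continuous_on_subset[OF cphi]) (use t0 in auto)
    then have "bounded ((\<lambda>z. u (fst z) (snd z) - \<phi> z) ` (cbox 0 1 \<times> {t0..T}))"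
      by (intro compact_imp_bounded compact_continuous_image compact_Times) auto
    then obtain B where B: "\<And>z. z \<in> cbox 0 1 \<times> {t0..T} \<Longrightarrow> \<bar>u (fst z) (snd z) - \<phi> z\<bar> \<le> B"
    proof -
      obtain B where *: "\<forall>v\<in>(\<lambda>z. u (fst z) (snd z) - \<phi> z) ` (cbox 0 1 \<times> {t0..T}). norm v \<le> B"
        using \<open>bounded _\<close> unfolding bounded_iff by blast
      have "\<bar>u (fst z) (snd z) - \<phi> z\<bar> \<le> B" if "z \<in> cbox 0 1 \<times> {t0..T}" for z
        using *[rule_format, OF imageI[OF that]] by simp
      then show thesis by (rule that)
    qed
    have B0: "B \<ge> 0" using B[of "(0, t0)"] t1 by (force simp: mem_box_cart)
    \<comment> \<open>after this time the penalty exceeds every negative value of the difference\<close>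
    define s1 where "s1 = max t1 (T - \<eta> / (B + 1))"
    have s1: "t0 \<le> s1" "t1 \<le> s1" "s1 < T" using t1 eta B0 by (auto simp: s1_def)
    let ?K = "cbox 0 (1 :: real ^ 'd) \<times> {t0..s1}"
    have "continuous_on ?K \<psi>"
      unfolding \<psi>_def
      by (intro continuous_intros continuous_on_subset[OF cu] continuous_on_subset[OF cphi]) (use t0 s1 in auto)
    moreover have "(0, t0) \<in> ?K" using s1 by (auto simp: mem_box_cart)
    moreover have "compact ?K" by (intro compact_Times) auto
    ultimately have "\<exists>z0\<in>?K. \<forall>z\<in>?K. \<psi> z0 \<le> \<psi> z"
      by (intro continuous_attains_inf) blast+
    then obtain z0 where z0: "z0 \<in> ?K" "\<And>z. z \<in> ?K \<Longrightarrow> \<psi> z0 \<le> \<psi> z"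
      by blast
    obtain x0 t0' where z0e: "z0 = (x0, t0')" by (cases z0)
    have red: "\<exists>x'\<in>cbox 0 1. \<psi> (x, t) = \<psi> (x', t)" if "t \<in> {t0..T}" for x t
    proof -
      have per': "torus_periodic (\<lambda>x. \<psi> (x, t))"
        using per[of t] pphi[of t] that t0 by (auto simp: torus_periodic_def \<psi>_def)
      obtain x' where "x' \<in> cbox 0 1" and r: "\<And>f :: real ^ 'd \<Rightarrow> real. torus_periodic f \<Longrightarrow> f x = f x'"
        by (rule torus_representative[of x]) (rule that)
      then show ?thesis using r[OF per'] by blast
    qed
    have "\<psi> (x1, t1) < 0" using eta1 by (simp add: \<psi>_def)
    moreover obtain x1' where "x1' \<in> cbox 0 1" "\<psi> (x1, t1) = \<psi> (x1', t1)"
      using red[of t1 x1] t1 by auto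
    ultimately have neg0: "\<psi> z0 < 0" using z0(2)[of "(x1', t1)"] t1 s1 by auto
    have glob: "\<psi> z0 \<le> \<psi> (x, t)" if tt: "t \<in> {t0..<T}" for x t
    proof -
      obtain x' where x': "x' \<in> cbox 0 1" "\<psi> (x, t) = \<psi> (x', t)" using red[of t x] tt by auto
      show ?thesis
      proof (cases "t \<le> s1")
        case True
        then show ?thesis using z0(2)[of "(x', t)"] x' tt by auto
      next
        case False
        then have "T - t \<le> \<eta> / (B + 1)" by (auto simp: s1_def)
        then have "B + 1 \<le> \<eta> / (T - t)" using tt B0 by (simp add: field_simps)
        moreover have "\<bar>u x' t - \<phi> (x', t)\<bar> \<le> B" using B[of "(x', t)"] x' tt by auto
        ultimately have "\<psi> (x', t) \<ge> 0" by (simp add: \<psi>_def)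
        then show ?thesis using neg0 x' by simp
      qed
    qed
    have t0': "t0' \<in> {t0<..<T}"
    proof -
      have "t0' \<noteq> t0"
      proof
        assume "t0' = t0"
        then have "\<psi> z0 \<ge> \<eta> / (T - t0)" using init[of x0] by (simp add: \<psi>_def z0e)
        moreover have "\<eta> / (T - t0) > 0" using eta t1 by simp
        ultimately show False using neg0 by simp
      qed
      then show ?thesis using z0 z0e s1 by auto
    qed
    define \<phi>' where "\<phi>' z = \<phi> z - \<eta> / (T - snd z)" for z
    define a' where "a' z = a z - \<eta> / (T - snd z)\<^sup>2" for z
    have "C1_test T \<phi>' a' q"
      unfolding C1_test_def
    proof (intro conjI ballI)
      fix z :: "(real ^ 'd) \<times> real" assume z: "z \<in> UNIV \<times> {0<..<T}"
      have 1: "(\<phi> has_derivative (\<lambda>(y, s). a z * s + q z \<bullet> y)) (at z)"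
        using test z unfolding C1_test_def by blast
      have "((\<lambda>z. \<eta> / (T - snd z)) has_derivative (\<lambda>v. \<eta> / (T - snd z)\<^sup>2 * snd v)) (at z)"
        by (rule derivative_eq_intros refl | use z in \<open>force simp: field_simps power2_eq_square\<close>)+
      from has_derivative_diff[OF 1 this]
      show "(\<phi>' has_derivative (\<lambda>(y, s). a' z * s + q z \<bullet> y)) (at z)"
        unfolding \<phi>'_def[abs_def] by (rule has_derivative_eq_rhs) (auto simp: a'_def algebra_simps)
    next
      have "continuous_on (UNIV \<times> {0<..<T}) a" using test by (simp add: C1_test_def)
      then show "continuous_on (UNIV \<times> {0<..<T}) a'"
        unfolding a'_def by (intro continuous_intros) auto
      show "continuous_on (UNIV \<times> {0<..<T}) q" using test by (simp add: C1_test_def)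
    qed
    moreover have "\<forall>\<^sub>F (y, s) in nhds (x0, t0'). u y s - \<phi>' (y, s) \<ge> u x0 t0' - \<phi>' (x0, t0')"
    proof -
      have "\<forall>\<^sub>F z in nhds (x0, t0'). z \<in> UNIV \<times> {t0<..<T}"
        by (rule eventually_nhds_in_open) (use t0' in \<open>auto intro: open_Times\<close>)
      then show ?thesis
      proof eventually_elim
        case (elim z)
        then show ?case using glob[of "snd z" "fst z"] z0e by (auto simp: \<psi>_def \<phi>'_def split_beta)
      qed
    qed
    moreover have "t0' \<in> {0<..<T}" using t0' t0 by auto
    ultimately have "a' (x0, t0') + H (q (x0, t0')) \<ge> 0"
      using super unfolding viscosity_supersolution_def by blast
    moreover have "\<eta> / (T - t0')\<^sup>2 > 0" using eta t0' by auto
    ultimately show False using sub[OF t0', of x0] by (simp add: a'_def)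
  qed
  show ?thesis
  proof (cases "t < T")
    case True
    then show ?thesis using main t by auto
  next
    case False
    then have tT: "t = T" using t by auto
    show ?thesis
    proof (cases "t0 = T")
      case True
      then show ?thesis using init tT by simp
    next
      case False
      then have lt: "t0 < T" using t by auto
      have cu: "continuous_on {t0..T} (\<lambda>s. u x s)" for x
      proof -
        have "continuous_on {t0..T} (\<lambda>s. (\<lambda>(x, t). u x t) (x, s))"
          by (rule continuous_on_compose2[OF cont]) (use t0 in \<open>auto intro!: continuous_intros\<close>)
        then show ?thesis by simp
      qed
      have c: "continuous_on {t0..T} (\<lambda>s. \<phi> (x, s) - u x s)"
        using t0 cu[of x] by (intro continuous_intros continuous_on_compose2[OF cphi]) auto
      have "\<phi> (x, T) - u x T \<le> 0"
        by (rule continuous_le_on_closure[of "{t0..<T}" "\<lambda>s. \<phi> (x, s) - u x s"])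
          (use c main lt in \<open>auto simp: closure_atLeastLessThan\<close>)
      then show ?thesis by (simp add: tT)
    qed
  qed
qed

lemma subsolution_comparison:
  fixes u :: "real ^ 'd::finite \<Rightarrow> real \<Rightarrow> real"
  assumes per: "\<And>t. t \<in> {0..T} \<Longrightarrow> torus_periodic (\<lambda>x. u x t)"
    and cont: "continuous_on (UNIV \<times> {0..T}) (\<lambda>(x, t). u x t)"
    and sub: "viscosity_subsolution H T u"
    and test: "C1_test T \<phi> a q" and t0: "0 \<le> t0"
    and cphi: "continuous_on (UNIV \<times> {t0..T}) \<phi>"
    and pphi: "\<And>t. t \<in> {t0..T} \<Longrightarrow> torus_periodic (\<lambda>x. \<phi> (x, t))"
    and super: "\<And>x t. t \<in> {t0<..<T} \<Longrightarrow> 0 \<le> a (x, t) + H (q (x, t))"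
    and init: "\<And>x. u x t0 \<le> \<phi> (x, t0)"
    and t: "t \<in> {t0..T}"
  shows "u x t \<le> \<phi> (x, t)"
proof -
  have neg: "C1_test T (\<lambda>z. - \<phi> z) (\<lambda>z. - a z) (\<lambda>z. - q z)" if "C1_test T \<phi> a q"
    for \<phi> :: "(real ^ 'd) \<times> real \<Rightarrow> real" and a q
    unfolding C1_test_def
  proof (intro conjI ballI)
    fix z :: "(real ^ 'd) \<times> real" assume z: "z \<in> UNIV \<times> {0<..<T}"
    then have "(\<phi> has_derivative (\<lambda>(y, s). a z * s + q z \<bullet> y)) (at z)"
      using that unfolding C1_test_def by blast
    from has_derivative_minus[OF this]
    show "((\<lambda>z. - \<phi> z) has_derivative (\<lambda>(y, s). - a z * s + - q z \<bullet> y)) (at z)"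
      by (rule has_derivative_eq_rhs) auto
  qed (use that in \<open>auto simp: C1_test_def intro!: continuous_intros\<close>)
  have "- \<phi> (x, t) \<le> - u x t"
  proof (rule supersolution_comparison[where H="\<lambda>p. - H (- p)" and u="\<lambda>x t. - u x t", OF _ _ _ neg[OF test] t0 _ _ _ _ t])
    show "torus_periodic (\<lambda>x. - u x t)" if "t \<in> {0..T}" for t
      using per[OF that] by (simp add: torus_periodic_def)
    show "continuous_on (UNIV \<times> {0..T}) (\<lambda>(x, t). - u x t)"
      using continuous_on_minus[OF cont] by (simp add: split_beta)
    show "viscosity_supersolution (\<lambda>p. - H (- p)) T (\<lambda>x t. - u x t)"
      unfolding viscosity_supersolution_def
    proof (intro allI impI ballI)
      fix \<phi> :: "(real ^ 'd) \<times> real \<Rightarrow> real" and a q x t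
      assume c: "C1_test T \<phi> a q" and t: "t \<in> {0<..<T}"
        and ev: "\<forall>\<^sub>F (y, s) in nhds (x, t). - u y s - \<phi> (y, s) \<ge> - u x t - \<phi> (x, t)"
      have "\<forall>\<^sub>F (y, s) in nhds (x, t). u y s - - \<phi> (y, s) \<le> u x t - - \<phi> (x, t)"
        using ev by eventually_elim auto
      with sub neg[OF c] t have "- a (x, t) + H (- q (x, t)) \<le> 0"
        unfolding viscosity_subsolution_def by blast
      then show "0 \<le> a (x, t) + - H (- q (x, t))" by simp
    qed
    show "continuous_on (UNIV \<times> {t0..T}) (\<lambda>z. - \<phi> z)" by (intro continuous_intros cphi)
    show "torus_periodic (\<lambda>x. - \<phi> (x, t))" if "t \<in> {t0..T}" for t
      using pphi[OF that] by (simp add: torus_periodic_def)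
    show "- a (x, t) + - H (- (- q (x, t))) \<le> 0" if "t \<in> {t0<..<T}" for x t
      using super[OF that, of x] by simp
    show "- \<phi> (x, t0) \<le> - u x t0" for x using init[of x] by simp
  qed
  then show ?thesis by simp
qed

lemma viscosity_solution_slice_continuous:
  assumes "continuous_on (UNIV \<times> {0..T}) (\<lambda>(x, t). u x t)" "t \<in> {0..T}"
  shows "continuous_on S (\<lambda>x. u x t)"
proof -
  have "continuous_on S (\<lambda>x. (\<lambda>(x, t). u x t) (x, t))"
    by (rule continuous_on_compose2[OF assms(1)]) (use assms(2) in \<open>auto intro!: continuous_intros\<close>)
  then show ?thesis by simp
qed

text \<open>
  Since \<open>v \<bullet> p - l \<le> H p\<close>, a subsolution of the equation is a subsolution of the transport
  equation with velocity \<open>v\<close> and source \<open>l\<close>. It is compared with the travelling wave whose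
  initial profile is a mollification of \<open>u\<close>. The error analysis uses subsolutions through this
  inequality.
\<close>
lemma subsolution_transport:
  fixes u :: "real ^ 'd::finite \<Rightarrow> real \<Rightarrow> real"
  assumes per: "\<And>t. t \<in> {0..T} \<Longrightarrow> torus_periodic (\<lambda>x. u x t)"
    and cont: "continuous_on (UNIV \<times> {0..T}) (\<lambda>(x, t). u x t)"
    and sub: "viscosity_subsolution H T u"
    and H: "\<And>p. v \<bullet> p - l \<le> H p"
    and t: "0 \<le> t" "0 \<le> s" "t + s \<le> T"
  shows "u x (t + s) \<le> u (x - s *\<^sub>R v) t + s * l"
proof (rule field_le_epsilon)
  fix e' :: real assume e': "e' > 0"
  define e where "e = e' / 2"
  have e: "e > 0" using e' by (simp add: e_def)
  have c: "continuous_on UNIV (\<lambda>x. u x t)" and p: "torus_periodic (\<lambda>x. u x t)"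
    using viscosity_solution_slice_continuous[OF cont] per t by auto
  obtain d where d: "d > 0" "\<And>x y. norm y \<le> d \<Longrightarrow> \<bar>u (x + y) t - u x t\<bar> \<le> e"
    using torus_periodic_uniform_modulus[OF c p e] by blast
  let ?m = "mollify d (\<lambda>x. u x t)"
  have close: "\<bar>?m x - u x t\<bar> \<le> e" for x by (rule mollify_close[OF c d(1)]) (rule d(2))
  obtain G and M :: "real ^ 'd \<Rightarrow> real ^ 'd \<Rightarrow> real ^ 'd" where
    G: "\<And>x. (?m has_derivative (\<lambda>v. G x \<bullet> v)) (at x)" and Gc: "continuous_on UNIV G"
    by (rule mollify_C2[OF c d(1)]) blast
  have mc: "continuous_on UNIV ?m"
    by (rule has_derivative_imp_continuous[OF G])
  define Y where "Y z = fst z - (snd z - t) *\<^sub>R v" for z :: "(real ^ 'd) \<times> real"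
  define \<phi> where "\<phi> z = ?m (Y z) + (snd z - t) * l + e" for z
  have test: "C1_test T \<phi> (\<lambda>z. l - G (Y z) \<bullet> v) (\<lambda>z. G (Y z))"
    unfolding C1_test_def
  proof (intro conjI ballI)
    fix z :: "(real ^ 'd) \<times> real"
    have "(Y has_derivative (\<lambda>w. fst w - snd w *\<^sub>R v)) (at z)"
      unfolding Y_def[abs_def] by (auto intro!: derivative_eq_intros)
    note 1 = has_derivative_compose[OF this G]
    have "((\<lambda>z. (snd z - t) * l + e) has_derivative (\<lambda>w. snd w * l)) (at z)"
      by (auto intro!: derivative_eq_intros)
    from has_derivative_add[OF 1 this]
    show "(\<phi> has_derivative (\<lambda>(y, s). (l - G (Y z) \<bullet> v) * s + G (Y z) \<bullet> y)) (at z)"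
      unfolding \<phi>_def[abs_def] add.assoc
      by (rule has_derivative_eq_rhs) (auto simp: inner_simps algebra_simps)
  qed (auto simp: Y_def intro!: continuous_intros continuous_on_compose2[OF Gc])
  have "u x (t + s) \<le> \<phi> (x, t + s)"
  proof (rule subsolution_comparison[OF per cont sub test t(1)])
    show "continuous_on (UNIV \<times> {t..T}) \<phi>"
      unfolding \<phi>_def Y_def by (intro continuous_intros continuous_on_compose2[OF mc]) auto
    fix r
    have "torus_periodic ?m" by (rule mollify_periodic[OF p])
    from torus_periodic_shift[OF this, of "- ((r - t) *\<^sub>R v)"]
    show "torus_periodic (\<lambda>x. \<phi> (x, r))" by (simp add: \<phi>_def Y_def torus_periodic_def)
  next
    show "0 \<le> l - G (Y (x, r)) \<bullet> v + H (G (Y (x, r)))" for x r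
      using H[of "G (Y (x, r))"] by (simp add: inner_commute)
    show "u x t \<le> \<phi> (x, t)" for x
      using close[of x] by (simp add: \<phi>_def Y_def abs_le_iff)
  qed (use t in auto)
  also have "\<dots> \<le> u (x - s *\<^sub>R v) t + s * l + e'"
    using abs_le_D1[OF close[of "x - s *\<^sub>R v"]] unfolding e_def by (simp add: \<phi>_def Y_def e_def)
  finally show "u x (t + s) \<le> u (x - s *\<^sub>R v) t + s * l + e'" .
qed

text \<open>
  The hypothesis on \<open>w\<close> says that it obeys the dynamic programming inequality for a set of
  velocities and costs that realises \<open>H\<close> on all gradients which \<open>w\<close> can have. The inequality
  survives mollification in space and time, and for a smooth function it is the partial
  differential inequality of a classical subsolution. The mollification is evaluated at a time
  later by its radius so as to involve no negative times.
\<close>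
lemma supersolution_dominates:
  fixes u w :: "real ^ 'd::finite \<Rightarrow> real \<Rightarrow> real"
  assumes per: "\<And>t. t \<in> {0..T} \<Longrightarrow> torus_periodic (\<lambda>x. u x t)"
    and cont: "continuous_on (UNIV \<times> {0..T}) (\<lambda>(x, t). u x t)"
    and super: "viscosity_supersolution H T u"
    and wper: "\<And>t. 0 \<le> t \<Longrightarrow> torus_periodic (\<lambda>x. w x t)"
    and wx: "\<And>x y t. 0 \<le> t \<Longrightarrow> w x t \<le> w y t + L * norm (x - y)"
    and wt: "\<And>x t s. 0 \<le> t \<Longrightarrow> 0 \<le> s \<Longrightarrow> \<bar>w x t - w x s\<bar> \<le> B * \<bar>t - s\<bar>"
    and init: "\<And>x. w x 0 \<le> u x 0"
    and ctrl: "\<And>p. norm p \<le> L \<Longrightarrow> \<exists>v l. H p \<le> v \<bullet> p - l \<and>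
      (\<forall>x t s. 0 \<le> t \<longrightarrow> 0 \<le> s \<longrightarrow> w x (t + s) \<le> w (x - s *\<^sub>R v) t + s * l)"
    and t: "t \<in> {0..T}"
  shows "w x t \<le> u x t"
proof (rule field_le_epsilon)
  fix e' :: real assume e': "e' > 0"
  define e where "e = e' / 2"
  have e: "e > 0" using e' by (simp add: e_def)
  have L: "L \<ge> 0" using wx[of 0 "axis undefined 1" 0] wx[of 0 0 "axis undefined 1"] by (auto simp: norm_axis_1)
  have B: "B \<ge> 0" using wt[of 0 1 0] by auto
  define W where "W z = w (fst z) (max 0 (snd z))" for z
  have Wlip: "\<bar>W z - W y\<bar> \<le> (L + B) * norm (z - y)" for z y
  proof -
    have "norm (fst z - fst y) \<le> norm (z - y)" by (metis norm_fst_le prod.collapse fst_diff)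
    then have "L * norm (fst z - fst y) \<le> L * norm (z - y)" using L by (rule mult_left_mono)
    then have 1: "\<bar>w (fst z) (max 0 (snd z)) - w (fst y) (max 0 (snd z))\<bar> \<le> L * norm (z - y)"
      using wx[of "max 0 (snd z)" "fst z" "fst y"] wx[of "max 0 (snd z)" "fst y" "fst z"]
      by (simp add: abs_le_iff norm_minus_commute)
    have "\<bar>snd z - snd y\<bar> \<le> norm (z - y)" by (metis norm_snd_le prod.collapse real_norm_def snd_diff)
    then have "\<bar>max 0 (snd z) - max 0 (snd y)\<bar> \<le> norm (z - y)" by linarith
    then have "B * \<bar>max 0 (snd z) - max 0 (snd y)\<bar> \<le> B * norm (z - y)" using B by (rule mult_left_mono)
    then have 2: "\<bar>w (fst y) (max 0 (snd z)) - w (fst y) (max 0 (snd y))\<bar> \<le> B * norm (z - y)"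
      using wt[of "max 0 (snd z)" "max 0 (snd y)" "fst y"] by simp
    show ?thesis using 1 2 unfolding W_def distrib_right by linarith
  qed
  have Wc: "continuous_on UNIV W"
  proof (rule lipschitz_on_continuous_on)
    show "(L + B)-lipschitz_on UNIV W"
      using Wlip L B by (auto simp: lipschitz_on_def dist_norm)
  qed
  \<comment> \<open>a value changes at most at the rate \<open>L + B\<close>, over the distance \<open>d\<close> by mollification and \<open>d\<close> by the time shift\<close>
  define d where "d = e / (3 * (L + B + 1))"
  have d: "d > 0" using e L B by (simp add: d_def)
  have small: "(L + B) * (2 * d) \<le> e"
    using e L B by (simp add: d_def field_simps)
  let ?m = "mollify d W"
  define Y where "Y z = z + (0, d)" for z :: "(real ^ 'd) \<times> real"
  have close: "\<bar>?m (Y z) - W z\<bar> \<le> e" for z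
  proof -
    have "\<bar>?m (Y z) - W (Y z)\<bar> \<le> (L + B) * d"
      by (rule mollify_close[OF Wc d]) (rule order_trans[OF Wlip], use L B in \<open>auto intro: mult_left_mono\<close>)
    moreover have "\<bar>W (Y z) - W z\<bar> \<le> (L + B) * d"
      using Wlip[of "Y z" z] d by (simp add: Y_def norm_Pair)
    ultimately show ?thesis using small by linarith
  qed
  obtain G and M :: "(real ^ 'd) \<times> real \<Rightarrow> (real ^ 'd) \<times> real \<Rightarrow> (real ^ 'd) \<times> real" where
    G: "\<And>x. (?m has_derivative (\<lambda>v. G x \<bullet> v)) (at x)" and Gc: "continuous_on UNIV G"
    by (rule mollify_C2[OF Wc d]) blast
  have mc: "continuous_on UNIV ?m"
    by (rule has_derivative_imp_continuous[OF G])
  define \<phi> where "\<phi> z = ?m (Y z) - e" for z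
  have test: "C1_test T \<phi> (\<lambda>z. snd (G (Y z))) (\<lambda>z. fst (G (Y z)))"
    unfolding C1_test_def
  proof (intro conjI ballI)
    fix z :: "(real ^ 'd) \<times> real"
    have "(Y has_derivative (\<lambda>w. w)) (at z)"
      unfolding Y_def[abs_def] by (auto intro!: derivative_eq_intros)
    note 1 = has_derivative_compose[OF this G]
    have "((\<lambda>z. - e) has_derivative (\<lambda>w::(real ^ 'd) \<times> real. 0)) (at z)"
      by (auto intro!: derivative_eq_intros)
    from has_derivative_add[OF 1 this]
    show "(\<phi> has_derivative (\<lambda>(y, s). snd (G (Y z)) * s + fst (G (Y z)) \<bullet> y)) (at z)"
      unfolding \<phi>_def[abs_def]
      by (simp add: case_prod_unfold inner_prod_def add.commute)
  next
    have "continuous_on S (\<lambda>z. G (Y z))" for S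
      unfolding Y_def by (rule continuous_on_compose2[OF Gc]) (auto intro!: continuous_intros)
    then show "continuous_on (UNIV \<times> {0<..<T}) (\<lambda>z. snd (G (Y z)))"
      "continuous_on (UNIV \<times> {0<..<T}) (\<lambda>z. fst (G (Y z)))"
      by (intro continuous_on_snd continuous_on_fst; simp)+
  qed
  have incr: "?m (Y z + s *\<^sub>R (b, r)) \<le> ?m (Y z) + s * c"
    if "\<And>y t. 0 \<le> t \<Longrightarrow> w (y + s *\<^sub>R b) (t + s * r) \<le> w y t + s * c" "0 < s" "0 \<le> r" "0 \<le> snd z" for z s b r c
  proof -
    have "?m (Y z + s *\<^sub>R (b, r)) \<le> wavg d (\<lambda>y. W (Y z + y) + s * c)"
      unfolding mollify_def
    proof (rule wavg_mono[OF continuous_translate[OF Wc] _ d])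
      show "continuous_on UNIV (\<lambda>y. W (Y z + y) + s * c)"
        by (intro continuous_on_add continuous_translate[OF Wc] continuous_on_const)
      fix y :: "(real ^ 'd) \<times> real" assume "norm y \<le> d"
      then have "\<bar>snd y\<bar> \<le> d" using norm_snd_le[of "snd y" "fst y"] by (simp only: prod.collapse real_norm_def)
      then have "0 \<le> snd (Y z + y)" using that(4) by (auto simp: Y_def)
      moreover have "0 \<le> s * r" using that(2,3) by simp
      ultimately have "max 0 (snd (Y z + s *\<^sub>R (b, r) + y)) = snd (Y z + y) + s * r"
        and "max 0 (snd (Y z + y)) = snd (Y z + y)" by auto
      moreover have "fst (Y z + s *\<^sub>R (b, r) + y) = fst (Y z + y) + s *\<^sub>R b" by simp
      ultimately show "W (Y z + s *\<^sub>R (b, r) + y) \<le> W (Y z + y) + s * c"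
        using that(1)[OF \<open>0 \<le> snd (Y z + y)\<close>, of "fst (Y z + y)"] by (simp only: W_def)
    qed
    also have "\<dots> = ?m (Y z) + s * c"
      unfolding mollify_def by (subst wavg_add) (auto simp: wavg_const d intro: continuous_translate Wc)
    finally show ?thesis .
  qed
  have "\<phi> (x, t) \<le> u x t"
  proof (rule supersolution_comparison[OF per cont super test order_refl])
    show "continuous_on (UNIV \<times> {0..T}) \<phi>"
      unfolding \<phi>_def Y_def by (intro continuous_intros continuous_on_compose2[OF mc]) auto
    show "torus_periodic (\<lambda>x. \<phi> (x, t))" for t
    proof -
      have "W (Y (x + axis j 1, t) + y) = W (Y (x, t) + y)" for x j y
        using torus_periodic_shift[OF wper[of "max 0 (t + (d + snd y))"], of "fst y"]
        by (simp add: torus_periodic_def W_def Y_def add_ac)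
      then show ?thesis by (simp add: torus_periodic_def \<phi>_def mollify_def)
    qed
    show "\<phi> (x, 0) \<le> u x 0" for x
      using close[of "(x, 0)"] init[of x] by (simp add: \<phi>_def W_def abs_le_iff)
    fix x :: "real ^ 'd" and t assume t: "t \<in> {0<..<T}"
    let ?z = "(x, t)"
    let ?p = "fst (G (Y ?z))"
    \<comment> \<open>the gradient of the mollification obeys the Lipschitz bound, so a control exists for it\<close>
    have "G (Y ?z) \<bullet> (?p, 0) \<le> L * norm ?p"
    proof (rule has_derivative_le_of_increment[OF G zero_less_one])
      fix s :: real assume s: "0 < s"
      show "?m (Y ?z + s *\<^sub>R (?p, 0)) \<le> ?m (Y ?z) + s * (L * norm ?p)"
      proof (rule incr)
        show "w (y + s *\<^sub>R ?p) (t + s * 0) \<le> w y t + s * (L * norm ?p)" if "0 \<le> t" for y t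
          using wx[OF that, of "y + s *\<^sub>R ?p" y] s by (simp add: mult_ac)
      qed (use s t in auto)
    qed
    then have "norm ?p * norm ?p \<le> L * norm ?p"
      by (simp add: inner_prod_def flip: power2_norm_eq_inner power2_eq_square)
    then have "norm ?p \<le> L" using L by (cases "norm ?p = 0") (auto simp: mult_le_cancel_right)
    then obtain v l where v: "H ?p \<le> v \<bullet> ?p - l"
      and vl: "\<And>x t s. 0 \<le> t \<Longrightarrow> 0 \<le> s \<Longrightarrow> w x (t + s) \<le> w (x - s *\<^sub>R v) t + s * l"
      using ctrl by blast
    have "G (Y ?z) \<bullet> (v, 1) \<le> l"
    proof (rule has_derivative_le_of_increment[OF G zero_less_one])
      fix s :: real assume s: "0 < s"
      show "?m (Y ?z + s *\<^sub>R (v, 1)) \<le> ?m (Y ?z) + s * l"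
      proof (rule incr)
        show "w (y + s *\<^sub>R v) (t + s * 1) \<le> w y t + s * l" if "0 \<le> t" for y t
          using vl[OF that, of s "y + s *\<^sub>R v"] s by simp
      qed (use s t in auto)
    qed
    then show "snd (G (Y ?z)) + H ?p \<le> 0"
      using v by (simp add: inner_prod_def inner_commute)
  qed (use t in auto)
  moreover have "W (x, t) - e - e \<le> \<phi> (x, t)"
    using close[of "(x, t)"] by (simp add: \<phi>_def abs_le_iff)
  ultimately show "w x t \<le> u x t + e'" using t by (simp add: W_def e_def)
qed

section \<open>The monotone scheme as a Bellman operator\<close>

text \<open>
  The \<open>2d\<close> neighbours of a grid point, and the \<open>2d\<close> arguments of the numerical Hamiltonian,
  are indexed by one type: \<open>Inl i\<close> belongs to the neighbour in direction \<open>e\<^sub>i\<close> and to the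
  argument \<open>- \<delta>\<^sub>h\<close>, \<open>Inr i\<close> to the opposite neighbour and to \<open>\<delta>\<^sub>-\<^sub>h\<close>. The arguments have then
  the uniform shape of \<open>slopes_inner\<close>.
\<close>
definition sdir :: "'d::finite + 'd \<Rightarrow> real ^ 'd" where
  "sdir k = (case k of Inl i \<Rightarrow> axis i 1 | Inr i \<Rightarrow> - axis i 1)"

definition sbasis :: "'d::finite + 'd \<Rightarrow> (real ^ 'd) \<times> (real ^ 'd)" where
  "sbasis k = (case k of Inl i \<Rightarrow> (axis i 1, 0) | Inr i \<Rightarrow> (0, axis i 1))"

definition slopes :: "real \<Rightarrow> (real ^ 'd::finite \<Rightarrow> real) \<Rightarrow> real ^ 'd \<Rightarrow> (real ^ 'd) \<times> (real ^ 'd)" where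
  "slopes h v x = (- diff_fwd h v x, diff_bwd h v x)"

definition rbox :: "real \<Rightarrow> ((real ^ 'd::finite) \<times> (real ^ 'd)) set" where
  "rbox R = {z. \<forall>k. \<bar>z \<bullet> sbasis k\<bar> \<le> R}"

text \<open>
  One-sided form of a Lipschitz bound; being an inequality between values it is preserved by
  averages.
\<close>
definition lip_le :: "real \<Rightarrow> ('a::real_normed_vector \<Rightarrow> real) \<Rightarrow> bool" where
  "lip_le L f \<longleftrightarrow> (\<forall>x y. f x \<le> f y + L * norm (x - y))"

definition semiconcave_const :: "real \<Rightarrow> ('a::real_normed_vector \<Rightarrow> real) \<Rightarrow> bool" where
  "semiconcave_const C f \<longleftrightarrow> (\<forall>x1 x2. \<forall>l\<in>{0<..<1}.
     l * f x1 + (1 - l) * f x2 - l * (1 - l) * C * (norm (x1 - x2))\<^sup>2 \<le> f (l *\<^sub>R x1 + (1 - l) *\<^sub>R x2))"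

lemma norm_sdir [simp]: "norm (sdir k) = 1"
  by (cases k) (auto simp: sdir_def)

lemma inner_sbasis: "z \<bullet> sbasis k = (case k of Inl i \<Rightarrow> fst z $ i | Inr i \<Rightarrow> snd z $ i)"
  by (cases k) (auto simp: sbasis_def inner_prod_def inner_axis)

lemma sum_UNIV_Plus:
  fixes f :: "'a::finite + 'b::finite \<Rightarrow> 'c::comm_monoid_add"
  shows "(\<Sum>k\<in>UNIV. f k) = (\<Sum>i\<in>UNIV. f (Inl i)) + (\<Sum>i\<in>UNIV. f (Inr i))"
  unfolding UNIV_Plus_UNIV[symmetric] by (subst sum.Plus) auto

lemma sum_sbasis: "(\<Sum>k\<in>UNIV. (z \<bullet> sbasis k) *\<^sub>R sbasis k) = z"
proof -
  have b: "(\<Sum>i\<in>UNIV. (a $ i) *\<^sub>R axis i (1::real)) = a" for a :: "real ^ 'd::finite"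
    by (simp add: vec_eq_iff axis_def if_distrib cong: if_cong)
  have "(\<Sum>k\<in>UNIV. (z \<bullet> sbasis k) *\<^sub>R sbasis k) =
      (\<Sum>i\<in>UNIV. (fst z $ i) *\<^sub>R (axis i 1, 0)) + (\<Sum>i\<in>UNIV. (snd z $ i) *\<^sub>R (0, axis i 1))"
    by (simp add: sum_UNIV_Plus inner_sbasis) (simp add: sbasis_def)
  also have "\<dots> = ((\<Sum>i\<in>UNIV. (fst z $ i) *\<^sub>R axis i 1), 0) + (0, (\<Sum>i\<in>UNIV. (snd z $ i) *\<^sub>R axis i 1))"
    by (simp add: prod_eq_iff fst_sum snd_sum)
  finally show ?thesis unfolding b by (simp add: prod_eq_iff)
qed

lemma linear_sbasis:
  assumes "linear f" shows "f z = (\<Sum>k\<in>UNIV. (z \<bullet> sbasis k) * f (sbasis k) :: real)"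
proof -
  have "f z = f (\<Sum>k\<in>UNIV. (z \<bullet> sbasis k) *\<^sub>R sbasis k)" by (simp only: sum_sbasis)
  also have "\<dots> = (\<Sum>k\<in>UNIV. (z \<bullet> sbasis k) * f (sbasis k))"
    by (simp add: linear_sum[OF assms] linear_scale[OF assms])
  finally show ?thesis .
qed

lemma slopes_inner: "slopes h v x \<bullet> sbasis k = (v x - v (x + h *\<^sub>R sdir k)) / h"
  by (cases k) (auto simp: slopes_def inner_sbasis sdir_def diff_fwd_def diff_bwd_def minus_divide_left)

lemma antidiag_inner: "(- p, p) \<bullet> sbasis k = - (p \<bullet> sdir k)"
  by (cases k) (auto simp: inner_sbasis sdir_def inner_axis)

lemma lip_le_continuous: "lip_le L f \<Longrightarrow> continuous_on S f"
proof -
  assume f: "lip_le L f"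
  have "\<bar>L\<bar>-lipschitz_on S f"
  proof (rule lipschitz_onI)
    fix x y
    have "f x \<le> f y + \<bar>L\<bar> * norm (x - y)" for x y
      using f mult_right_mono[OF abs_ge_self[of L], of "norm (x - y)"] unfolding lip_le_def by (smt (verit) norm_ge_zero)
    from this[of x y] this[of y x] show "dist (f x) (f y) \<le> \<bar>L\<bar> * dist x y"
      by (simp add: dist_real_def dist_norm norm_minus_commute abs_le_iff)
  qed simp
  then show ?thesis by (rule lipschitz_on_continuous_on)
qed

lemma lip_le_slopes:
  assumes "lip_le L f" "L \<le> R" "h > 0" shows "slopes h f x \<in> rbox R"
proof -
  have "\<bar>f x - f (x + h *\<^sub>R sdir k)\<bar> \<le> L * h" for k
    using assms(1)[unfolded lip_le_def, rule_format, of x "x + h *\<^sub>R sdir k"]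
      assms(1)[unfolded lip_le_def, rule_format, of "x + h *\<^sub>R sdir k" x] assms(3)
    by (simp add: abs_le_iff)
  then have "\<bar>(f x - f (x + h *\<^sub>R sdir k)) / h\<bar> \<le> L" for k
    using assms(3) by (simp add: abs_divide divide_le_eq)
  then show ?thesis using assms(2) by (auto simp: rbox_def slopes_inner intro: order_trans)
qed

lemma lip_le_norm_rbox:
  assumes "norm p \<le> R" shows "(- p, p) \<in> rbox R"
proof -
  have "\<bar>p \<bullet> sdir k\<bar> \<le> norm p" for k
    using Cauchy_Schwarz_ineq2[of p "sdir k"] by simp
  then show ?thesis using assms by (auto simp: rbox_def antidiag_inner intro: order_trans)
qed

text \<open>
  Semiconcavity is concavity up to a quadratic function, which may be centred anywhere because
  the defect of the squared norm in the convexity inequality is the same for all centres.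
\<close>
lemma semiconcave_const_convex:
  fixes f :: "'a::real_inner \<Rightarrow> real"
  assumes "semiconcave_const C f"
  shows "convex_on UNIV (\<lambda>y. C * (norm (X - y))\<^sup>2 - f y)"
proof (rule convex_onI)
  fix t :: real and x y :: 'a assume t: "0 < t" "t < 1"
  have Q: "(1 - t) * f x + t * f y - (1 - t) * t * C * (norm (x - y))\<^sup>2 \<le> f ((1 - t) *\<^sub>R x + t *\<^sub>R y)"
    using assms[unfolded semiconcave_const_def, rule_format, of "1 - t" x y] t by simp
  have E: "(norm (X - ((1 - t) *\<^sub>R x + t *\<^sub>R y)))\<^sup>2 =
      (1 - t) * (norm (X - x))\<^sup>2 + t * (norm (X - y))\<^sup>2 - (1 - t) * t * (norm (x - y))\<^sup>2"
    unfolding power2_norm_eq_inner by (simp add: inner_simps inner_commute algebra_simps)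
  have E2: "C * (norm (X - ((1 - t) *\<^sub>R x + t *\<^sub>R y)))\<^sup>2 = (1 - t) * (C * (norm (X - x))\<^sup>2)
      + t * (C * (norm (X - y))\<^sup>2) - (1 - t) * t * C * (norm (x - y))\<^sup>2"
    unfolding E by (simp add: algebra_simps)
  from Q E2 show "C * (norm (X - ((1 - t) *\<^sub>R x + t *\<^sub>R y)))\<^sup>2 - f ((1 - t) *\<^sub>R x + t *\<^sub>R y)
      \<le> (1 - t) * (C * (norm (X - x))\<^sup>2 - f x) + t * (C * (norm (X - y))\<^sup>2 - f y)"
    unfolding right_diff_distrib by linarith
qed simp

text \<open>
  What the monotonicity condition means for a convex differentiable numerical Hamiltonian: at
  all admissible slopes the partial derivatives are nonnegative and satisfy a CFL condition.
  The locale concerns the update of functions on the whole space, not only on the grid.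
\<close>
locale monotone_scheme =
  fixes F :: "(real ^ 'd::finite) \<times> (real ^ 'd) \<Rightarrow> real"
    and DF :: "(real ^ 'd) \<times> (real ^ 'd) \<Rightarrow> (real ^ 'd) \<times> (real ^ 'd) \<Rightarrow> real"
    and h \<tau> R K :: real
  assumes convex_F: "convex_on UNIV F"
    and DF: "\<And>z. (F has_derivative DF z) (at z)"
    and h: "h > 0" and tau: "\<tau> > 0"
    and DF_nonneg: "\<And>z k. z \<in> rbox R \<Longrightarrow> DF z (sbasis k) \<ge> 0"
    and DF_cfl: "\<And>z. z \<in> rbox R \<Longrightarrow> \<tau> * (\<Sum>k\<in>UNIV. DF z (sbasis k)) \<le> h"
    and DF_bound: "\<And>z. z \<in> rbox R \<Longrightarrow> (\<Sum>k\<in>UNIV. DF z (sbasis k)) \<le> K"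
begin

abbreviation S :: "(real ^ 'd \<Rightarrow> real) \<Rightarrow> real ^ 'd \<Rightarrow> real" where
  "S \<equiv> update_op F h \<tau>"

definition lin :: "(real ^ 'd) \<times> (real ^ 'd) \<Rightarrow> (real ^ 'd \<Rightarrow> real) \<Rightarrow> real ^ 'd \<Rightarrow> real" where
  "lin z f x = f x + \<tau> / h * (\<Sum>k\<in>UNIV. DF z (sbasis k) * (f (x + h *\<^sub>R sdir k) - f x))"

definition cost :: "(real ^ 'd) \<times> (real ^ 'd) \<Rightarrow> real" where
  "cost z = DF z z - F z"

definition vel :: "(real ^ 'd) \<times> (real ^ 'd) \<Rightarrow> real ^ 'd" where
  "vel z = - (\<Sum>k\<in>UNIV. DF z (sbasis k) *\<^sub>R sdir k)"

lemma DF_linear: "linear (DF z)"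
  by (rule has_derivative_linear[OF DF])

lemma lin_eq_slopes: "lin z f x = f x - \<tau> * DF z (slopes h f x)"
proof -
  have "DF z (slopes h f x) = - (\<Sum>k\<in>UNIV. DF z (sbasis k) * (f (x + h *\<^sub>R sdir k) - f x)) / h"
    unfolding linear_sbasis[OF DF_linear, of z "slopes h f x"] slopes_inner sum_negf[symmetric] sum_divide_distrib
    by (intro sum.cong refl) (simp add: field_simps)
  then show ?thesis by (simp add: lin_def)
qed

text \<open>
  Each linearisation of \<open>F\<close> gives an upper bound of the convex scheme, and the linearisation
  at the actual slopes is exact. So \<open>S f x\<close> is the minimum over \<open>z\<close> of an average of \<open>f\<close> plus
  a cost: a Bellman equation, from which order, Lipschitz and semiconcavity properties of \<open>S\<close>
  follow by inserting the control of one side into the other.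
\<close>
lemma S_le_lin: "S f x \<le> lin z f x + \<tau> * cost z"
proof -
  have "F z + DF z (slopes h f x - z) \<le> F (slopes h f x)"
    by (rule convex_on_tangent_le[OF convex_F DF])
  then have "\<tau> * (F z + DF z (slopes h f x - z)) \<le> \<tau> * F (slopes h f x)"
    using tau by simp
  then show ?thesis
    unfolding lin_eq_slopes cost_def update_op_def slopes_def[symmetric] linear_diff[OF DF_linear]
    by (simp add: algebra_simps)
qed

lemma S_eq_lin: "S f x = lin (slopes h f x) f x + \<tau> * cost (slopes h f x)"
  unfolding lin_eq_slopes cost_def update_op_def slopes_def[symmetric]
  by (simp add: algebra_simps)

lemma lin_weights: "lin z f x = (1 - \<tau> / h * (\<Sum>k\<in>UNIV. DF z (sbasis k))) * f x
    + (\<Sum>k\<in>UNIV. (\<tau> / h * DF z (sbasis k)) * f (x + h *\<^sub>R sdir k))"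
  unfolding lin_def by (simp add: sum_distrib_left sum_distrib_right sum_subtractf algebra_simps)

lemma weights_nonneg:
  assumes "z \<in> rbox R"
  shows "0 \<le> 1 - \<tau> / h * (\<Sum>k\<in>UNIV. DF z (sbasis k))" "0 \<le> \<tau> / h * DF z (sbasis k)"
  using DF_nonneg[OF assms] DF_cfl[OF assms] h tau by (auto simp: field_simps)

lemma lin_mono:
  assumes "z \<in> rbox R" "\<And>y. f y \<le> g y"
  shows "lin z f x \<le> lin z g x"
  unfolding lin_weights
  by (intro add_mono sum_mono mult_left_mono weights_nonneg assms)

lemma lin_affine: "lin z (\<lambda>y. a * f y + b * g y + c) x = a * lin z f x + b * lin z g x + c"
  unfolding lin_def by (simp add: sum.distrib sum_distrib_left algebra_simps sum_subtractf)

lemma lin_translate: "lin z (\<lambda>y. f (a + y)) x = lin z f (a + x)"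
  by (simp add: lin_def add.assoc)

lemma S_translate: "S (\<lambda>y. f (a + y)) x = S f (a + x)"
  by (simp add: update_op_def diff_fwd_def diff_bwd_def add.assoc add_diff_eq)

lemma lin_const_diff: "lin z (\<lambda>y. c + a * f y) x = c + a * lin z f x"
  using lin_affine[of z a f 0 f c x] by (simp add: add.commute)

text \<open>
  The average of \<open>lin z\<close> has mean \<open>x - \<tau> *\<^sub>R vel z\<close> and second moment of order \<open>\<tau> * h\<close>.
\<close>
lemma lin_square: "lin z (\<lambda>y. (norm (X - y))\<^sup>2) x
    = (norm (X - x))\<^sup>2 + 2 * \<tau> * ((X - x) \<bullet> vel z) + \<tau> * h * (\<Sum>k\<in>UNIV. DF z (sbasis k))"
proof -
  have "(norm (X - (x + h *\<^sub>R sdir k)))\<^sup>2 - (norm (X - x))\<^sup>2 = h\<^sup>2 - 2 * h * ((X - x) \<bullet> sdir k)" for k :: "'d + 'd"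
  proof -
    have "sdir k \<bullet> sdir k = 1" by (simp add: dot_square_norm)
    then show ?thesis
      unfolding power2_norm_eq_inner
      by (simp add: inner_simps inner_commute algebra_simps power2_eq_square)
  qed
  then have "lin z (\<lambda>y. (norm (X - y))\<^sup>2) x = (norm (X - x))\<^sup>2
      + \<tau> / h * (\<Sum>k\<in>UNIV. DF z (sbasis k) * (h\<^sup>2 - 2 * h * ((X - x) \<bullet> sdir k)))"
    by (simp add: lin_def)
  also have "(\<Sum>k\<in>UNIV. DF z (sbasis k) * (h\<^sup>2 - 2 * h * ((X - x) \<bullet> sdir k)))
      = h\<^sup>2 * (\<Sum>k\<in>UNIV. DF z (sbasis k)) + 2 * h * ((X - x) \<bullet> vel z)"
    by (simp add: vel_def inner_sum_right sum_distrib_left algebra_simps sum_subtractf sum.distrib)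
  also have "\<tau> / h * \<dots> = 2 * \<tau> * ((X - x) \<bullet> vel z) + \<tau> * h * (\<Sum>k\<in>UNIV. DF z (sbasis k))"
    using h by (simp add: field_simps power2_eq_square)
  finally show ?thesis by simp
qed

lemma lin_jensen:
  assumes z: "z \<in> rbox R" and g: "convex_on UNIV g"
  shows "g (x - \<tau> *\<^sub>R vel z) \<le> lin z g x"
proof -
  define a where "a m = (case m of None \<Rightarrow> 1 - \<tau> / h * (\<Sum>k\<in>UNIV. DF z (sbasis k)) | Some k \<Rightarrow> \<tau> / h * DF z (sbasis k))" for m
  define y where "y m = (case m of None \<Rightarrow> x | Some k \<Rightarrow> x + h *\<^sub>R sdir k)" for m
  have split: "(\<Sum>m\<in>UNIV. G m) = G None + (\<Sum>k\<in>UNIV. G (Some k))" for G :: "('d + 'd) option \<Rightarrow> 'b::comm_monoid_add"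
    unfolding UNIV_option_conv by (simp add: sum.reindex)
  have sa: "sum a UNIV = 1" by (simp add: split a_def sum_distrib_left)
  have "a m \<ge> 0" for m using weights_nonneg[OF z] by (auto simp: a_def split: option.split)
  then have "g (\<Sum>m\<in>UNIV. a m *\<^sub>R y m) \<le> (\<Sum>m\<in>UNIV. a m * g (y m))"
    by (intro convex_on_sum[OF _ _ g sa]) auto
  also have "\<dots> = lin z g x" by (simp add: split a_def y_def lin_weights)
  also have "(\<Sum>m\<in>UNIV. a m *\<^sub>R y m) = x - \<tau> *\<^sub>R vel z"
  proof -
    have "(\<Sum>m\<in>UNIV. a m *\<^sub>R y m) = (1 - \<tau> / h * (\<Sum>k\<in>UNIV. DF z (sbasis k))) *\<^sub>R x
        + (\<Sum>k\<in>UNIV. (\<tau> / h * DF z (sbasis k)) *\<^sub>R x + (\<tau> * DF z (sbasis k)) *\<^sub>R sdir k)"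
      using h by (simp add: split a_def y_def scaleR_add_right)
    also have "\<dots> = x - \<tau> *\<^sub>R vel z"
      by (simp add: sum.distrib vel_def scaleR_sum_right scaleR_sum_left[symmetric] sum_distrib_left algebra_simps)
    finally show ?thesis .
  qed
  finally show ?thesis .
qed

text \<open>
  Jensen's inequality for the convex function \<open>C * (norm (x - y))\<^sup>2 - f y\<close>: averaging over the
  stencil instead of moving with the mean velocity costs at most the variance.
\<close>
lemma lin_semiconcave_le:
  assumes z: "z \<in> rbox R" and f: "semiconcave_const C f" and C: "C \<ge> 0"
  shows "lin z f x \<le> f (x - \<tau> *\<^sub>R vel z) + C * \<tau> * h * K"
proof -
  have "C * (norm (x - (x - \<tau> *\<^sub>R vel z)))\<^sup>2 - f (x - \<tau> *\<^sub>R vel z) \<le> lin z (\<lambda>y. C * (norm (x - y))\<^sup>2 - f y) x"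
    by (rule lin_jensen[OF z semiconcave_const_convex[OF f]])
  also have "\<dots> = C * lin z (\<lambda>y. (norm (x - y))\<^sup>2) x - lin z f x"
    using lin_affine[of z C "\<lambda>y. (norm (x - y))\<^sup>2" "-1" f 0 x] by simp
  also have "lin z (\<lambda>y. (norm (x - y))\<^sup>2) x = \<tau> * h * (\<Sum>k\<in>UNIV. DF z (sbasis k))"
    by (simp add: lin_square)
  also have "C * (\<tau> * h * (\<Sum>k\<in>UNIV. DF z (sbasis k))) \<le> C * (\<tau> * h * K)"
    using C tau h DF_bound[OF z] by (intro mult_left_mono) auto
  finally have "C * (norm (x - (x - \<tau> *\<^sub>R vel z)))\<^sup>2 - f (x - \<tau> *\<^sub>R vel z) \<le> C * (\<tau> * h * K) - lin z f x"
    by simp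
  moreover have "0 \<le> C * (norm (x - (x - \<tau> *\<^sub>R vel z)))\<^sup>2" using C by simp
  ultimately show ?thesis by (simp add: mult.assoc)
qed

lemma S_mono_shift:
  assumes "slopes h g x \<in> rbox R" "\<And>y. f y \<le> g y + c"
  shows "S f x \<le> S g x + c"
proof -
  have "S f x \<le> lin (slopes h g x) f x + \<tau> * cost (slopes h g x)" by (rule S_le_lin)
  also have "lin (slopes h g x) f x \<le> lin (slopes h g x) (\<lambda>y. c + 1 * g y) x"
    by (rule lin_mono[OF assms(1)]) (use assms(2) in \<open>simp add: add.commute\<close>)
  also have "\<dots> = c + lin (slopes h g x) g x" by (simp only: lin_const_diff)
  finally show ?thesis using S_eq_lin[of g x] by simp
qed

lemma S_lip:
  assumes f: "lip_le L f" "L \<le> R" shows "lip_le L (S f)"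
  unfolding lip_le_def
proof (intro allI)
  fix x y
  have "S f x = S (\<lambda>w. f ((x - y) + w)) y" by (simp add: S_translate)
  also have "\<dots> \<le> S f y + L * norm (x - y)"
    by (rule S_mono_shift[OF lip_le_slopes[OF f h]])
      (use f(1)[unfolded lip_le_def] in \<open>metis add_diff_cancel\<close>)
  finally show "S f x \<le> S f y + L * norm (x - y)" .
qed

text \<open>
  The control that is optimal at the intermediate point is used at both end points.
\<close>
lemma S_semiconcave:
  assumes f: "lip_le L f" "L \<le> R" and C: "semiconcave_const C f"
  shows "semiconcave_const C (S f)"
  unfolding semiconcave_const_def
proof (intro allI ballI)
  fix x1 x2 :: "real ^ 'd" and l :: real assume l: "l \<in> {0<..<1}"
  define x where "x = l *\<^sub>R x1 + (1 - l) *\<^sub>R x2"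
  let ?z = "slopes h f x"
  let ?c = "l * (1 - l) * C * (norm (x1 - x2))\<^sup>2"
  have z: "?z \<in> rbox R" by (rule lip_le_slopes[OF f h])
  have "lin ?z (\<lambda>y. l * f (x1 + y) + (1 - l) * f (x2 + y) + - ?c) 0 \<le> lin ?z (\<lambda>y. f (x + y)) 0"
  proof (rule lin_mono[OF z])
    fix y
    have "l *\<^sub>R (x1 + y) + (1 - l) *\<^sub>R (x2 + y) = x + y" by (simp add: x_def algebra_simps)
    then show "l * f (x1 + y) + (1 - l) * f (x2 + y) + - ?c \<le> f (x + y)"
      using C[unfolded semiconcave_const_def, rule_format, OF l, of "x1 + y" "x2 + y"] by simp
  qed
  then have "l * lin ?z f x1 + (1 - l) * lin ?z f x2 - ?c \<le> lin ?z f x"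
    unfolding lin_affine lin_translate by simp
  moreover have "l * S f x1 \<le> l * (lin ?z f x1 + \<tau> * cost ?z)" "(1 - l) * S f x2 \<le> (1 - l) * (lin ?z f x2 + \<tau> * cost ?z)"
    using l by (auto intro!: mult_left_mono S_le_lin)
  ultimately have "l * S f x1 + (1 - l) * S f x2 - ?c \<le> lin ?z f x + \<tau> * cost ?z"
    by (simp add: algebra_simps)
  then show "l * S f x1 + (1 - l) * S f x2 - l * (1 - l) * C * (norm (x1 - x2))\<^sup>2
      \<le> S f (l *\<^sub>R x1 + (1 - l) *\<^sub>R x2)"
    unfolding S_eq_lin[of f x, unfolded x_def] x_def .
qed

lemma S_periodic:
  assumes "torus_periodic f" shows "torus_periodic (S f)"
proof -
  have "S f (x + axis j 1) = S f x" for x j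
  proof -
    have "(\<lambda>y. f (axis j 1 + y)) = f"
      using assms by (auto simp: torus_periodic_def add.commute)
    then show ?thesis using S_translate[of f "axis j 1" x] by (simp add: add.commute)
  qed
  then show ?thesis by (simp add: torus_periodic_def)
qed

lemma DF_antidiag: "DF z (- p, p) = vel z \<bullet> p"
proof -
  have "DF z (- p, p) = (\<Sum>k\<in>UNIV. ((- p, p) \<bullet> sbasis k) * DF z (sbasis k))"
    by (rule linear_sbasis[OF DF_linear])
  then show ?thesis
    unfolding antidiag_inner vel_def
    by (simp add: inner_sum_left sum_negf inner_commute[of p] mult.commute)
qed

lemma cost_antidiag: "cost (- p, p) = vel (- p, p) \<bullet> p - F (- p, p)"
  by (simp add: cost_def DF_antidiag)

text \<open>
  Every control of the scheme is admissible for the equation with Hamiltonian \<open>F (- p, p)\<close>.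
\<close>
lemma cost_transport: "vel z \<bullet> p - cost z \<le> F (- p, p)"
  using convex_on_tangent_le[OF convex_F DF, of z "(- p, p)"]
  by (simp add: cost_def linear_diff[OF DF_linear] DF_antidiag)

lemma norm_vel_le: "z \<in> rbox R \<Longrightarrow> norm (vel z) \<le> K"
proof -
  assume z: "z \<in> rbox R"
  have "norm (vel z) \<le> (\<Sum>k\<in>UNIV. norm (DF z (sbasis k) *\<^sub>R sdir k))"
    unfolding vel_def norm_minus_cancel by (rule norm_sum)
  also have "\<dots> = (\<Sum>k\<in>UNIV. DF z (sbasis k))" using DF_nonneg[OF z] by simp
  also have "\<dots> \<le> K" by (rule DF_bound[OF z])
  finally show ?thesis .
qed

lemma iterate_lip: "lip_le L g \<Longrightarrow> L \<le> R \<Longrightarrow> lip_le L ((S ^^ n) g)"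
  by (induction n) (auto intro: S_lip)

lemma iterate_semiconcave:
  "lip_le L g \<Longrightarrow> L \<le> R \<Longrightarrow> semiconcave_const C g \<Longrightarrow> semiconcave_const C ((S ^^ n) g)"
  by (induction n) (auto intro!: S_semiconcave[of L] iterate_lip)

lemma iterate_periodic: "torus_periodic g \<Longrightarrow> torus_periodic ((S ^^ n) g)"
  by (induction n) (auto intro: S_periodic)

text \<open>
  Discrete doubling of variables. The controls optimal for the scheme at \<open>y\<close> are used for the
  value \<open>v n\<close> at \<open>x\<close>: the two points are then displaced by the same mean velocity, and the
  squared distance increases only by the variance of a stencil step, which is at most \<open>\<tau> * h *
  K\<close>.
\<close>
lemma doubling_estimate:
  assumes g: "lip_le L g" "L \<le> R" and kap: "\<kappa> > 0"
    and init: "\<And>x. v 0 x \<le> g x"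
    and transport: "\<And>n x z. n < N \<Longrightarrow> z \<in> rbox R \<Longrightarrow> v (Suc n) x \<le> v n (x - \<tau> *\<^sub>R vel z) + \<tau> * cost z"
    and n: "n \<le> N"
  shows "v n x - (S ^^ n) g y \<le> (norm (x - y))\<^sup>2 / (2 * \<kappa>) + \<kappa> * L\<^sup>2 / 2 + real n * (\<tau> * h * K) / (2 * \<kappa>)"
  using n
proof (induction n arbitrary: x y)
  case 0
  \<comment> \<open>completing the square absorbs the Lipschitz bound at the initial time\<close>
  have "0 \<le> (norm (x - y) - \<kappa> * L)\<^sup>2 / (2 * \<kappa>)" using kap by simp
  then have "L * norm (x - y) \<le> (norm (x - y))\<^sup>2 / (2 * \<kappa>) + \<kappa> * L\<^sup>2 / 2"
    using kap by (simp add: power2_diff field_simps power2_eq_square)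
  moreover have "v 0 x - g y \<le> L * norm (x - y)"
    using init[of x] g(1)[unfolded lip_le_def, rule_format, of x y] by simp
  ultimately show ?case by simp
next
  case (Suc n)
  define V where "V = (S ^^ n) g"
  let ?z = "slopes h V y"
  let ?c = "\<kappa> * L\<^sup>2 / 2 + real n * (\<tau> * h * K) / (2 * \<kappa>)"
  define X where "X = x - \<tau> *\<^sub>R vel ?z"
  have z: "?z \<in> rbox R"
    unfolding V_def by (rule lip_le_slopes[OF iterate_lip[OF g] g(2) h])
  have "lin ?z (\<lambda>w. v n X + -1 * V w) y \<le> lin ?z (\<lambda>w. ?c + (1 / (2 * \<kappa>)) * (norm (X - w))\<^sup>2) y"
    by (rule lin_mono[OF z]) (use Suc.IH[of X] Suc.prems in \<open>simp add: V_def add_ac\<close>)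
  then have "v n X - lin ?z V y \<le> ?c + (1 / (2 * \<kappa>)) * lin ?z (\<lambda>w. (norm (X - w))\<^sup>2) y"
    unfolding lin_const_diff by simp
  moreover have "lin ?z (\<lambda>w. (norm (X - w))\<^sup>2) y \<le> (norm (x - y))\<^sup>2 + \<tau> * h * K"
  proof -
    have "(norm (X - y))\<^sup>2 + 2 * \<tau> * ((X - y) \<bullet> vel ?z) = (norm (x - y))\<^sup>2 - \<tau>\<^sup>2 * (norm (vel ?z))\<^sup>2"
      unfolding power2_norm_eq_inner X_def
      by (simp add: inner_simps inner_commute algebra_simps power2_eq_square)
    moreover have "\<tau> * h * (\<Sum>k\<in>UNIV. DF ?z (sbasis k)) \<le> \<tau> * h * K"
      using tau h DF_bound[OF z] by (intro mult_left_mono) auto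
    moreover have "0 \<le> \<tau>\<^sup>2 * (norm (vel ?z))\<^sup>2" by simp
    ultimately show ?thesis unfolding lin_square by linarith
  qed
  then have "(1 / (2 * \<kappa>)) * lin ?z (\<lambda>w. (norm (X - w))\<^sup>2) y \<le> (1 / (2 * \<kappa>)) * ((norm (x - y))\<^sup>2 + \<tau> * h * K)"
    using kap by (intro mult_left_mono) auto
  moreover have "v (Suc n) x \<le> v n X + \<tau> * cost ?z"
    unfolding X_def using transport[OF _ z] Suc.prems by simp
  moreover have "(S ^^ Suc n) g y = lin ?z V y + \<tau> * cost ?z"
    by (simp add: V_def[symmetric] S_eq_lin)
  ultimately have "v (Suc n) x - (S ^^ Suc n) g y \<le> ?c + (1 / (2 * \<kappa>)) * ((norm (x - y))\<^sup>2 + \<tau> * h * K)"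
    by linarith
  also have "\<dots> = (norm (x - y))\<^sup>2 / (2 * \<kappa>) + \<kappa> * L\<^sup>2 / 2 + real (Suc n) * (\<tau> * h * K) / (2 * \<kappa>)"
    using kap by (simp add: field_simps)
  finally show ?case .
qed

end

section \<open>A Hopf-Lax function above the scheme and below the solution\<close>

context monotone_scheme
begin

text \<open>
  Velocities and running costs of the linear equations tangent to \<open>H\<close>. The convex hull is
  taken in order that two consecutive controls can be replaced by their time average, which
  gives the semigroup inequality below.
\<close>
definition controls :: "real \<Rightarrow> ((real ^ 'd) \<times> real) set" where
  "controls L = convex hull ((\<lambda>p. (vel (- p, p), cost (- p, p))) ` cball 0 L)"

definition hopf_lax :: "real \<Rightarrow> (real ^ 'd \<Rightarrow> real) \<Rightarrow> real ^ 'd \<Rightarrow> real \<Rightarrow> real" where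
  "hopf_lax L g x t = (INF c\<in>controls L. g (x - t *\<^sub>R fst c) + t * snd c)"

lemma controls_gen: "norm p \<le> L \<Longrightarrow> (vel (- p, p), cost (- p, p)) \<in> controls L"
  unfolding controls_def by (rule hull_inc) auto

lemma controls_bound:
  assumes L: "L \<le> R" and K2: "\<And>p. norm p \<le> L \<Longrightarrow> \<bar>cost (- p, p)\<bar> \<le> K2" and c: "c \<in> controls L"
  shows "norm (fst c) \<le> K" "\<bar>snd c\<bar> \<le> K2"
proof -
  have "controls L \<subseteq> cball 0 K \<times> cball 0 K2"
    unfolding controls_def
  proof (rule hull_minimal)
    show "convex (cball (0::real ^ 'd) K \<times> cball (0::real) K2)" by (intro convex_Times convex_cball)
    show "(\<lambda>p. (vel (- p, p), cost (- p, p))) ` cball 0 L \<subseteq> cball 0 K \<times> cball 0 K2"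
      using norm_vel_le[OF lip_le_norm_rbox] K2 L by (auto intro: order_trans)
  qed
  then show "norm (fst c) \<le> K" "\<bar>snd c\<bar> \<le> K2" using c by auto
qed

end

locale hopf_lax_scheme = monotone_scheme F DF h \<tau> R K
  for F :: "(real ^ 'd::finite) \<times> (real ^ 'd) \<Rightarrow> real" and DF h \<tau> R K +
  fixes L K2 :: real and g :: "real ^ 'd \<Rightarrow> real"
  assumes L: "0 \<le> L" "L \<le> R" and lip_g: "lip_le L g"
    and cost_bound: "\<And>p. norm p \<le> L \<Longrightarrow> \<bar>cost (- p, p)\<bar> \<le> K2"
begin

abbreviation w where "w \<equiv> hopf_lax L g"

lemma controls_nonempty: "controls L \<noteq> {}"
  using controls_gen[of 0 L] L by auto

text \<open>
  Lipschitz dependence of the candidates in the infimum on space and time; it yields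
  boundedness from below as well as the modulus of continuity of \<open>hopf_lax\<close>.
\<close>
lemma candidate_change:
  assumes c: "c \<in> controls L"
  shows "g (x - t *\<^sub>R fst c) + t * snd c \<le> g (y - s *\<^sub>R fst c) + s * snd c + L * norm (x - y) + (L * K + K2) * \<bar>t - s\<bar>"
proof -
  note b = controls_bound[OF L(2) cost_bound c]
  have "g (x - t *\<^sub>R fst c) \<le> g (y - s *\<^sub>R fst c) + L * norm ((x - t *\<^sub>R fst c) - (y - s *\<^sub>R fst c))"
    using lip_g by (simp add: lip_le_def)
  moreover have "norm ((x - t *\<^sub>R fst c) - (y - s *\<^sub>R fst c)) \<le> norm (x - y) + K * \<bar>t - s\<bar>"
  proof -
    have e: "(x - t *\<^sub>R fst c) - (y - s *\<^sub>R fst c) = (x - y) - (t - s) *\<^sub>R fst c" by (simp add: algebra_simps)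
    have "norm ((x - t *\<^sub>R fst c) - (y - s *\<^sub>R fst c)) \<le> norm (x - y) + \<bar>t - s\<bar> * norm (fst c)"
      unfolding e using norm_triangle_ineq4[of "x - y" "(t - s) *\<^sub>R fst c"] by (simp only: norm_scaleR)
    also have "\<bar>t - s\<bar> * norm (fst c) \<le> \<bar>t - s\<bar> * K" using b(1) by (intro mult_left_mono) auto
    finally show ?thesis by (simp add: mult.commute)
  qed
  then have "L * norm ((x - t *\<^sub>R fst c) - (y - s *\<^sub>R fst c)) \<le> L * (norm (x - y) + K * \<bar>t - s\<bar>)"
    using L(1) by (rule mult_left_mono)
  moreover have "(t - s) * snd c \<le> K2 * \<bar>t - s\<bar>"
  proof -
    have "(t - s) * snd c \<le> \<bar>t - s\<bar> * \<bar>snd c\<bar>" by (metis abs_ge_self abs_mult)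
    also have "\<dots> \<le> \<bar>t - s\<bar> * K2" using b(2) by (intro mult_left_mono) auto
    finally show ?thesis by (simp add: mult.commute)
  qed
  ultimately show ?thesis by (simp add: algebra_simps)
qed

lemma candidates_bdd_below: "bdd_below ((\<lambda>c. g (x - t *\<^sub>R fst c) + t * snd c) ` controls L)"
proof (rule bdd_belowI2)
  fix c assume "c \<in> controls L"
  from candidate_change[OF this, of x 0 x t]
  show "g x - (L * K + K2) * \<bar>t\<bar> \<le> g (x - t *\<^sub>R fst c) + t * snd c" by simp
qed

lemma hopf_lax_le: "c \<in> controls L \<Longrightarrow> w x t \<le> g (x - t *\<^sub>R fst c) + t * snd c"
  unfolding hopf_lax_def by (rule cINF_lower[OF candidates_bdd_below])

lemma hopf_lax_ge: "(\<And>c. c \<in> controls L \<Longrightarrow> a \<le> g (x - t *\<^sub>R fst c) + t * snd c) \<Longrightarrow> a \<le> w x t"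
  unfolding hopf_lax_def by (rule cINF_greatest[OF controls_nonempty])

lemma hopf_lax_0: "w x 0 = g x"
  unfolding hopf_lax_def using controls_nonempty by simp

lemma hopf_lax_change: "w x t \<le> w y s + L * norm (x - y) + (L * K + K2) * \<bar>t - s\<bar>"
proof -
  have "w x t - L * norm (x - y) - (L * K + K2) * \<bar>t - s\<bar> \<le> w y s"
  proof (rule hopf_lax_ge)
    fix c assume c: "c \<in> controls L"
    show "w x t - L * norm (x - y) - (L * K + K2) * \<bar>t - s\<bar> \<le> g (y - s *\<^sub>R fst c) + s * snd c"
      using hopf_lax_le[OF c, of x t] candidate_change[OF c, of x t y s] by linarith
  qed
  then show ?thesis by linarith
qed

text \<open>
  Following \<open>c1\<close> for time \<open>t\<close> and then \<open>c\<close> for time \<open>s\<close> has the same effect as following for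
  time \<open>t + s\<close> their time average, which belongs to the convex set of controls.
\<close>
lemma hopf_lax_semigroup_le:
  assumes c: "c \<in> controls L" and t: "0 \<le> t" "0 \<le> s"
  shows "w x (t + s) \<le> w (x - s *\<^sub>R fst c) t + s * snd c"
proof -
  have "w x (t + s) - s * snd c \<le> w (x - s *\<^sub>R fst c) t"
  proof (rule hopf_lax_ge)
    fix c1 assume c1: "c1 \<in> controls L"
    show "w x (t + s) - s * snd c \<le> g (x - s *\<^sub>R fst c - t *\<^sub>R fst c1) + t * snd c1"
    proof (cases "t + s = 0")
      case True
      then have "t = 0" "s = 0" using t by auto
      then show ?thesis by (simp add: hopf_lax_0)
    next
      case False
      then have p: "t + s > 0" using t by auto
      define c2 where "c2 = (t / (t + s)) *\<^sub>R c1 + (s / (t + s)) *\<^sub>R c"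
      have "convex (controls L)" unfolding controls_def by (rule convex_convex_hull)
      then have "c2 \<in> controls L"
        unfolding c2_def using c c1 t p
        by (intro convexD) (auto simp: add_divide_distrib[symmetric])
      note b = hopf_lax_le[OF this, of x "t + s"]
      have c2: "(t + s) *\<^sub>R c2 = t *\<^sub>R c1 + s *\<^sub>R c" using p by (simp add: c2_def scaleR_add_right)
      have "(t + s) *\<^sub>R fst c2 = t *\<^sub>R fst c1 + s *\<^sub>R fst c" "(t + s) * snd c2 = t * snd c1 + s * snd c"
        using arg_cong[OF c2, of fst] arg_cong[OF c2, of snd] by simp_all
      with b show ?thesis by (simp add: algebra_simps)
    qed
  qed
  then show ?thesis by linarith
qed

lemma hopf_lax_periodic:
  assumes "torus_periodic g" shows "torus_periodic (\<lambda>x. w x t)"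
proof -
  have "g (x + axis j 1 - a) = g (x - a)" for x j a
    using torus_periodic_shift[OF assms, of "- a"] by (simp add: torus_periodic_def)
  then show ?thesis by (simp add: torus_periodic_def hopf_lax_def)
qed

text \<open>
  The bound holds for the generating controls by Jensen's inequality. The set of controls for
  which it holds after subtracting a quadratic term in the velocity is convex because \<open>f\<close> is
  semiconcave, hence it contains the convex hull. The quadratic term accounts for \<open>\<tau> * K\<^sup>2\<close>.
\<close>
lemma step_le_control:
  assumes f: "lip_le L f" "semiconcave_const C f" and C: "0 \<le> C" and c: "c \<in> controls L"
  shows "S f x \<le> f (x - \<tau> *\<^sub>R fst c) + \<tau> * snd c + C * \<tau> * (h * K + \<tau> * K\<^sup>2)"
proof -
  define \<phi> where "\<phi> y = C * (norm (x - y))\<^sup>2 - f y" for y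
  have conv: "convex_on UNIV \<phi>"
    unfolding \<phi>_def by (rule semiconcave_const_convex[OF f(2)])
  define m where "m = C * \<tau> * (h * K + \<tau> * K\<^sup>2) - S f x"
  have "controls L \<subseteq> {c. \<phi> (x - \<tau> *\<^sub>R fst c) - \<tau> * snd c \<le> m}"
    unfolding controls_def
  proof (rule hull_minimal)
    show "convex {c. \<phi> (x - \<tau> *\<^sub>R fst c) - \<tau> * snd c \<le> m}"
    proof (rule convexI, clarsimp)
      fix q1 q2 :: "real ^ 'd" and l1 l2 u v :: real
      assume a: "\<phi> (x - \<tau> *\<^sub>R q1) - \<tau> * l1 \<le> m" "\<phi> (x - \<tau> *\<^sub>R q2) - \<tau> * l2 \<le> m"
        and uv: "0 \<le> u" "0 \<le> v" "u + v = 1"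
      have u: "u = 1 - v" using uv by simp
      have "x - \<tau> *\<^sub>R (u *\<^sub>R q1 + v *\<^sub>R q2) = (1 - v) *\<^sub>R (x - \<tau> *\<^sub>R q1) + v *\<^sub>R (x - \<tau> *\<^sub>R q2)"
        unfolding u by (simp add: algebra_simps)
      then have "\<phi> (x - \<tau> *\<^sub>R (u *\<^sub>R q1 + v *\<^sub>R q2)) \<le> u * \<phi> (x - \<tau> *\<^sub>R q1) + v * \<phi> (x - \<tau> *\<^sub>R q2)"
        using convex_onD[OF conv, of v "x - \<tau> *\<^sub>R q1" "x - \<tau> *\<^sub>R q2"] uv u by simp
      moreover have "u * (\<phi> (x - \<tau> *\<^sub>R q1) - \<tau> * l1) + v * (\<phi> (x - \<tau> *\<^sub>R q2) - \<tau> * l2) \<le> m"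
        by (rule convex_bound_le[OF a uv])
      ultimately show "\<phi> (x - \<tau> *\<^sub>R (u *\<^sub>R q1 + v *\<^sub>R q2)) - \<tau> * (u * l1 + v * l2) \<le> m"
        by (simp add: algebra_simps)
    qed
    show "(\<lambda>p. (vel (- p, p), cost (- p, p))) ` cball 0 L \<subseteq> {c. \<phi> (x - \<tau> *\<^sub>R fst c) - \<tau> * snd c \<le> m}"
    proof clarsimp
      fix p :: "real ^ 'd" assume p: "norm p \<le> L"
      have z: "(- p, p) \<in> rbox R" using p L by (intro lip_le_norm_rbox) simp
      have "S f x \<le> lin (- p, p) f x + \<tau> * cost (- p, p)" by (rule S_le_lin)
      moreover have "lin (- p, p) f x \<le> f (x - \<tau> *\<^sub>R vel (- p, p)) + C * \<tau> * h * K"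
        by (rule lin_semiconcave_le[OF z f(2) C])
      moreover have "C * (norm (\<tau> *\<^sub>R vel (- p, p)))\<^sup>2 \<le> C * (\<tau> * K)\<^sup>2"
        using norm_vel_le[OF z] tau C by (intro mult_left_mono power_mono) auto
      ultimately show "\<phi> (x - \<tau> *\<^sub>R vel (- p, p)) - \<tau> * cost (- p, p) \<le> m"
        by (simp add: \<phi>_def m_def algebra_simps power2_eq_square)
    qed
  qed
  then have "\<phi> (x - \<tau> *\<^sub>R fst c) - \<tau> * snd c \<le> m" using c by auto
  moreover have "0 \<le> C * (norm (x - (x - \<tau> *\<^sub>R fst c)))\<^sup>2" using C by simp
  ultimately show ?thesis unfolding \<phi>_def m_def by linarith
qed

text \<open>
  A single straight line with constant control is followed through all time steps: the errors
  of the steps add up, and the candidates for the infimum at consecutive times match.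
\<close>
lemma iterate_le_hopf_lax:
  assumes sc: "semiconcave_const C g" and C: "0 \<le> C"
  shows "(S ^^ n) g x \<le> w x (real n * \<tau>) + real n * (C * \<tau> * (h * K + \<tau> * K\<^sup>2))"
proof (induction n arbitrary: x)
  case 0
  then show ?case by (simp add: hopf_lax_0)
next
  case (Suc n)
  let ?e = "C * \<tau> * (h * K + \<tau> * K\<^sup>2)"
  have "(S ^^ Suc n) g x - real (Suc n) * ?e \<le> w x (real (Suc n) * \<tau>)"
  proof (rule hopf_lax_ge)
    fix c assume c: "c \<in> controls L"
    let ?X = "x - \<tau> *\<^sub>R fst c"
    have "(S ^^ Suc n) g x \<le> (S ^^ n) g ?X + \<tau> * snd c + ?e"
      using step_le_control[OF iterate_lip[OF lip_g L(2)] iterate_semiconcave[OF lip_g L(2) sc] C c, of n x] by simp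
    also have "(S ^^ n) g ?X \<le> w ?X (real n * \<tau>) + real n * ?e" by (rule Suc.IH)
    also have "w ?X (real n * \<tau>) \<le> g (?X - (real n * \<tau>) *\<^sub>R fst c) + (real n * \<tau>) * snd c"
      by (rule hopf_lax_le[OF c])
    also have "?X - (real n * \<tau>) *\<^sub>R fst c = x - (real (Suc n) * \<tau>) *\<^sub>R fst c"
      by (simp add: algebra_simps)
    finally show "(S ^^ Suc n) g x - real (Suc n) * ?e \<le> g (x - (real (Suc n) * \<tau>) *\<^sub>R fst c) + real (Suc n) * \<tau> * snd c"
      by (simp add: algebra_simps)
  qed
  then show ?case by linarith
qed

text \<open>
  The control tangent to \<open>H\<close> at \<open>p\<close> realises the value \<open>H p\<close> at the gradient \<open>p\<close>.
\<close>
lemma hopf_lax_le_supersolution: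
  assumes per: "\<And>t. t \<in> {0..T} \<Longrightarrow> torus_periodic (\<lambda>x. u x t)"
    and cont: "continuous_on (UNIV \<times> {0..T}) (\<lambda>(x, t). u x t)"
    and super: "viscosity_supersolution H T u"
    and H: "\<And>p. F (- p, p) = H p"
    and init: "\<And>x. g x \<le> u x 0" and pg: "torus_periodic g"
    and t: "t \<in> {0..T}"
  shows "w x t \<le> u x t"
proof (rule supersolution_dominates[OF per cont super, where L=L and B="L * K + K2"])
  show "torus_periodic (\<lambda>x. w x t)" for t by (rule hopf_lax_periodic[OF pg])
  show "w x t \<le> w y t + L * norm (x - y)" for x y t using hopf_lax_change[of x t y t] by simp
  show "\<bar>w x t - w x s\<bar> \<le> (L * K + K2) * \<bar>t - s\<bar>" for x t s
    using hopf_lax_change[of x t x s] hopf_lax_change[of x s x t] by (simp add: abs_le_iff abs_minus_commute)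
  show "w x 0 \<le> u x 0" for x using init by (simp add: hopf_lax_0)
  fix p :: "real ^ 'd" assume p: "norm p \<le> L"
  show "\<exists>v l. H p \<le> v \<bullet> p - l \<and> (\<forall>x t s. 0 \<le> t \<longrightarrow> 0 \<le> s \<longrightarrow> w x (t + s) \<le> w (x - s *\<^sub>R v) t + s * l)"
    using hopf_lax_semigroup_le[OF controls_gen[OF p]] H[of p] cost_antidiag[of p]
    by (intro exI[of _ "vel (- p, p)"] exI[of _ "cost (- p, p)"]) auto
qed (use t in auto)

end

section \<open>From the monotonicity condition to derivatives of the numerical Hamiltonian\<close>

lemma sdir_inj: "sdir k = sdir k' \<longleftrightarrow> k = (k' :: 'd::finite + 'd)"
proof
  assume "sdir k = sdir k'"
  then have "sdir k \<bullet> sdir k' = 1" by (simp add: dot_square_norm)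
  then show "k = k'"
    by (cases k; cases k') (auto simp: sdir_def inner_axis_axis split: if_splits)
qed simp

lemma eq_if_sbasis: "(\<And>k. a \<bullet> sbasis k = b \<bullet> sbasis k) \<Longrightarrow> a = b"
  by (metis (no_types, lifting) sum_sbasis sum.cong)

lemma inner_sbasis_sbasis: "sbasis k \<bullet> sbasis k' = (if k = k' then 1 else 0)"
  by (cases k; cases k') (auto simp: sbasis_def inner_axis_axis)

lemma slopes_bounded_iff: "slopes_bounded R h v x \<longleftrightarrow> slopes h v x \<in> rbox R"
proof -
  have "(\<forall>k. \<bar>slopes h v x \<bullet> sbasis k\<bar> \<le> R) \<longleftrightarrow> (\<forall>i. \<bar>diff_fwd h v x $ i\<bar> \<le> R) \<and> (\<forall>i. \<bar>diff_bwd h v x $ i\<bar> \<le> R)"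
    unfolding split_sum_all by (simp add: inner_sbasis slopes_def)
  then show ?thesis by (auto simp: slopes_bounded_def rbox_def)
qed

text \<open>
  Every vector of slopes occurs: the values at the neighbours of a point are independent of
  each other.
\<close>
lemma slopes_surj:
  assumes h: "h > 0"
  obtains v :: "real ^ 'd::finite \<Rightarrow> real" where "v 0 = 0" "\<And>k. v (h *\<^sub>R sdir k) = - h * (z \<bullet> sbasis k)"
proof
  let ?v = "\<lambda>y :: real ^ 'd. \<Sum>i\<in>UNIV. if y $ i > 0 then - (fst z $ i * y $ i) else snd z $ i * y $ i"
  show "?v 0 = 0" by simp
  show "?v (h *\<^sub>R sdir k) = - h * (z \<bullet> sbasis k)" for k
  proof (cases k)
    case (Inl i)
    have "?v (h *\<^sub>R sdir k) = (\<Sum>l\<in>UNIV. if l = i then - (fst z $ i * h) else 0)"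
      by (intro sum.cong refl) (use h in \<open>auto simp: sdir_def axis_def Inl\<close>)
    then show ?thesis by (simp add: inner_sbasis Inl)
  next
    case (Inr i)
    have "?v (h *\<^sub>R sdir k) = (\<Sum>l\<in>UNIV. if l = i then - (snd z $ i * h) else 0)"
      by (intro sum.cong refl) (use h in \<open>auto simp: sdir_def axis_def Inr\<close>)
    then show ?thesis by (simp add: inner_sbasis Inr)
  qed
qed

text \<open>
  Raising a neighbouring value lowers one slope, so \<open>F\<close> is nondecreasing in each argument;
  raising the central value raises all slopes at once, which bounds the sum of the partial
  derivatives. In the interior of the box of admissible slopes small changes of one value keep
  the slopes admissible.
\<close>
lemma monotonicity_condition_interior:
  fixes F :: "(real ^ 'd::finite) \<times> (real ^ 'd) \<Rightarrow> real"
  assumes mc: "monotonicity_condition F R h \<tau>" and h: "h > 0" and tau: "\<tau> > 0"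
    and DF: "(F has_derivative DF) (at z)"
    and z: "\<And>k. \<bar>z \<bullet> sbasis k\<bar> < R"
  shows "DF (sbasis k) \<ge> 0" "\<tau> * (\<Sum>k\<in>UNIV. DF (sbasis k)) \<le> h"
proof -
  obtain v :: "real ^ 'd \<Rightarrow> real" where v: "v 0 = 0" "\<And>k. v (h *\<^sub>R sdir k) = - h * (z \<bullet> sbasis k)"
    using slopes_surj[OF h] by blast
  have sv: "slopes h v 0 = z"
    by (rule eq_if_sbasis) (use v h in \<open>simp add: slopes_inner\<close>)
  define e where "e = Min (range (\<lambda>k. R - \<bar>z \<bullet> sbasis k\<bar>))"
  have e: "e > 0" unfolding e_def using z by (subst Min_gr_iff) auto
  have ek: "\<bar>z \<bullet> sbasis k\<bar> + e \<le> R" for k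
  proof -
    have "e \<le> R - \<bar>z \<bullet> sbasis k\<bar>" unfolding e_def by (rule Min_le) auto
    then show ?thesis by linarith
  qed
  have zb: "z \<in> rbox R" using z by (auto simp: rbox_def intro: less_imp_le)
  have upd: "update_op F h \<tau> v 0 \<le> update_op F h \<tau> (v(y := b)) 0"
    if "y \<in> stencil h 0" "v y \<le> b" "slopes h (v(y := b)) 0 \<in> rbox R" for y b
    using mc that zb sv unfolding monotonicity_condition_def slopes_bounded_iff by metis
  have update: "update_op F h \<tau> f 0 = f 0 - \<tau> * F (slopes h f 0)" for f
    by (simp add: update_op_def slopes_def)
  have nz: "h *\<^sub>R sdir k \<noteq> 0" for k :: "'d + 'd"
    using h norm_sdir[of k] by (metis norm_zero scaleR_eq_0_iff zero_neq_one less_irrefl)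
  have "DF (- sbasis k) \<le> 0"
  proof (rule has_derivative_le_of_increment[OF DF e])
    fix s :: real assume s: "0 < s" "s < e"
    let ?y = "h *\<^sub>R sdir k"
    let ?v = "v(?y := v ?y + s * h)"
    have sl: "slopes h ?v 0 = z - s *\<^sub>R sbasis k"
    proof (rule eq_if_sbasis)
      fix k'
      have "?v 0 = 0" using nz[of k] v(1) by auto
      moreover have "?v (h *\<^sub>R sdir k') = - h * (z \<bullet> sbasis k') + (if k = k' then s * h else 0)"
        using v(2) sdir_inj[of k' k] h by auto
      ultimately show "slopes h ?v 0 \<bullet> sbasis k' = (z - s *\<^sub>R sbasis k) \<bullet> sbasis k'"
        using h by (simp add: slopes_inner inner_simps inner_sbasis_sbasis field_simps)
    qed
    have "z - s *\<^sub>R sbasis k \<in> rbox R"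
    proof -
      have "\<bar>(z - s *\<^sub>R sbasis k) \<bullet> sbasis k'\<bar> \<le> R" for k'
        using ek[of k'] s by (auto simp: abs_le_iff inner_diff_left inner_sbasis_sbasis)
      then show ?thesis by (simp add: rbox_def)
    qed
    moreover have "?y \<in> stencil h 0"
      by (cases k) (auto simp: stencil_def sdir_def)
    ultimately have "update_op F h \<tau> v 0 \<le> update_op F h \<tau> ?v 0"
      using s h by (intro upd) (auto simp: sl)
    then have "\<tau> * F (z - s *\<^sub>R sbasis k) \<le> \<tau> * F z"
      using v(1) nz[of k] unfolding update sv sl by auto
    then show "F (z + s *\<^sub>R - sbasis k) \<le> F z + s * 0" using tau by simp
  qed
  then show "DF (sbasis k) \<ge> 0"
    using linear_neg[OF has_derivative_linear[OF DF]] by simp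
  let ?o = "\<Sum>k\<in>UNIV. sbasis k :: (real ^ 'd) \<times> (real ^ 'd)"
  have o: "?o \<bullet> sbasis k = 1" for k
    by (simp add: inner_sum_left inner_sbasis_sbasis)
  have "DF ?o \<le> h / \<tau>"
  proof (rule has_derivative_le_of_increment[OF DF e])
    fix s :: real assume s: "0 < s" "s < e"
    let ?v = "v(0 := v 0 + s * h)"
    have sl: "slopes h ?v 0 = z + s *\<^sub>R ?o"
    proof (rule eq_if_sbasis)
      fix k'
      have "?v (h *\<^sub>R sdir k') = - h * (z \<bullet> sbasis k')" using v(2) nz[of k'] by auto
      then show "slopes h ?v 0 \<bullet> sbasis k' = (z + s *\<^sub>R ?o) \<bullet> sbasis k'"
        using h v(1) by (simp add: slopes_inner inner_add_left o field_simps)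
    qed
    have "z + s *\<^sub>R ?o \<in> rbox R"
    proof -
      have "\<bar>(z + s *\<^sub>R ?o) \<bullet> sbasis k'\<bar> \<le> R" for k'
        using ek[of k'] s by (auto simp: abs_le_iff inner_add_left o)
      then show ?thesis by (simp add: rbox_def)
    qed
    then have "update_op F h \<tau> v 0 \<le> update_op F h \<tau> ?v 0"
      using s h by (intro upd) (auto simp: sl stencil_def)
    then have "\<tau> * F (z + s *\<^sub>R ?o) \<le> \<tau> * F z + s * h"
      using v(1) unfolding update sv sl by auto
    then show "F (z + s *\<^sub>R ?o) \<le> F z + s * (h / \<tau>)" using tau by (simp add: field_simps)
  qed
  then show "\<tau> * (\<Sum>k\<in>UNIV. DF (sbasis k)) \<le> h"
    using tau by (simp add: linear_sum[OF has_derivative_linear[OF DF]] field_simps)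
qed

lemma monotonicity_condition_rbox:
  fixes F :: "(real ^ 'd::finite) \<times> (real ^ 'd) \<Rightarrow> real"
  assumes mc: "monotonicity_condition F R h \<tau>" and h: "h > 0" and tau: "\<tau> > 0" and R: "R > 0"
    and DF: "\<And>z. (F has_derivative blinfun_apply (F' z)) (at z)" and F': "continuous_on UNIV F'"
    and z: "z \<in> rbox R"
  shows "F' z (sbasis k) \<ge> 0" "\<tau> * (\<Sum>k\<in>UNIV. F' z (sbasis k)) \<le> h"
proof -
  \<comment> \<open>boundary points of the box are limits of interior ones along rays, and the derivative is continuous\<close>
  have int: "\<bar>(t *\<^sub>R z) \<bullet> sbasis k\<bar> < R" if "t \<in> {0<..<1}" for t k
  proof -
    have "\<bar>(t *\<^sub>R z) \<bullet> sbasis k\<bar> \<le> t * R"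
      using z that by (auto simp: rbox_def abs_mult intro: mult_left_mono)
    also have "t * R < R" using that R by simp
    finally show ?thesis .
  qed
  note I = monotonicity_condition_interior[OF mc h tau DF int]
  have ev: "\<forall>\<^sub>F t in at_left (1::real). t \<in> {0<..<1}"
    using eventually_at_left_field[of _ "1::real"] by (auto intro: exI[of _ 0])
  have "((\<lambda>t. t *\<^sub>R z) \<longlongrightarrow> 1 *\<^sub>R z) (at_left (1::real))" by (intro tendsto_intros)
  then have lim: "((\<lambda>t. F' (t *\<^sub>R z)) \<longlongrightarrow> F' z) (at_left 1)"
    using F' by (intro isCont_tendsto_compose[of z F']) (simp_all add: continuous_on_eq_continuous_at del: split_paired_All)
  have limk: "((\<lambda>t. F' (t *\<^sub>R z) (sbasis k)) \<longlongrightarrow> F' z (sbasis k)) (at_left 1)" for k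
    by (intro tendsto_intros lim)
  show "F' z (sbasis k) \<ge> 0"
    by (rule tendsto_lowerbound[OF limk]) (use ev I(1) in \<open>auto elim: eventually_mono\<close>)
  have "((\<lambda>t. \<tau> * (\<Sum>k\<in>UNIV. F' (t *\<^sub>R z) (sbasis k))) \<longlongrightarrow> \<tau> * (\<Sum>k\<in>UNIV. F' z (sbasis k))) (at_left 1)"
    by (intro tendsto_intros limk)
  then show "\<tau> * (\<Sum>k\<in>UNIV. F' z (sbasis k)) \<le> h"
    by (rule tendsto_upperbound) (use ev I(2) in \<open>auto elim: eventually_mono\<close>)
qed

lemma rbox_bounded: "rbox R \<subseteq> (cball 0 (\<Sum>k\<in>(UNIV :: ('d::finite + 'd) set). R) :: ((real ^ 'd) \<times> (real ^ 'd)) set)"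
proof
  fix z :: "(real ^ 'd) \<times> (real ^ 'd)" assume z: "z \<in> rbox R"
  have "norm z = norm (\<Sum>k\<in>UNIV. (z \<bullet> sbasis k) *\<^sub>R sbasis k)" by (simp only: sum_sbasis)
  also have "\<dots> \<le> (\<Sum>k\<in>UNIV. norm ((z \<bullet> sbasis k) *\<^sub>R sbasis k))" by (rule norm_sum)
  also have "\<dots> \<le> (\<Sum>k\<in>(UNIV :: ('d + 'd) set). R)"
  proof (rule sum_mono)
    fix k :: "'d + 'd"
    have "norm (sbasis k) = 1" by (simp add: norm_eq_sqrt_inner inner_sbasis_sbasis)
    then show "norm ((z \<bullet> sbasis k) *\<^sub>R sbasis k) \<le> R" using z by (simp add: rbox_def)
  qed
  finally show "z \<in> cball 0 (\<Sum>k\<in>(UNIV :: ('d + 'd) set). R)" by simp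
qed

lemma continuous_bounded_on_rbox:
  fixes f :: "(real ^ 'd::finite) \<times> (real ^ 'd) \<Rightarrow> real"
  assumes "continuous_on UNIV f"
  obtains B where "B > 0" "\<And>z. z \<in> rbox R \<Longrightarrow> \<bar>f z\<bar> \<le> B"
proof -
  let ?C = "cball 0 (\<Sum>k\<in>(UNIV :: ('d + 'd) set). R) :: ((real ^ 'd) \<times> (real ^ 'd)) set"
  have "bounded (f ` ?C)"
    by (intro compact_imp_bounded compact_continuous_image continuous_on_subset[OF assms]) auto
  then obtain B where B: "B > 0" "\<forall>y\<in>f ` ?C. norm y \<le> B"
    unfolding bounded_pos by blast
  show ?thesis
  proof (rule that[OF B(1)])
    fix z :: "(real ^ 'd) \<times> (real ^ 'd)" assume "z \<in> rbox R"
    then have "f z \<in> f ` ?C" using rbox_bounded by blast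
    then show "\<bar>f z\<bar> \<le> B" using B(2) by fastforce
  qed
qed

section \<open>First differences of semiconcave functions in the integral norm\<close>

lemma torus_integrable: "continuous_on UNIV f \<Longrightarrow> f integrable_on cbox (0 :: real ^ 'd::finite) 1"
  for f :: "real ^ 'd \<Rightarrow> real"
  by (intro integrable_continuous) (rule continuous_on_subset, auto)

lemma torus_content [simp]: "measure lborel (cbox 0 (1 :: real ^ 'd::finite)) = 1"
  by (subst content_cbox_cart) (auto simp: interval_eq_empty_cart)

lemma torus_integral_const: "torus_integral (\<lambda>x. c) = c"
  by simp

lemma torus_integral_mono:
  "continuous_on UNIV f \<Longrightarrow> continuous_on UNIV g \<Longrightarrow> (\<And>x. f x \<le> g x) \<Longrightarrow> torus_integral f \<le> torus_integral g"
  by (intro integral_le torus_integrable)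

lemma torus_integral_add:
  "continuous_on UNIV f \<Longrightarrow> continuous_on UNIV g \<Longrightarrow>
    torus_integral (\<lambda>x. f x + g x) = torus_integral f + torus_integral g"
  by (intro Henstock_Kurzweil_Integration.integral_add torus_integrable)

lemma torus_integral_diff:
  "continuous_on UNIV f \<Longrightarrow> continuous_on UNIV g \<Longrightarrow>
    torus_integral (\<lambda>x. f x - g x) = torus_integral f - torus_integral g"
  by (intro Henstock_Kurzweil_Integration.integral_diff torus_integrable)

lemma torus_integral_sum:
  "finite A \<Longrightarrow> (\<And>k. k \<in> A \<Longrightarrow> continuous_on UNIV (f k)) \<Longrightarrow>
    torus_integral (\<lambda>x. \<Sum>k\<in>A. f k x) = (\<Sum>k\<in>A. torus_integral (f k))"
  by (intro Henstock_Kurzweil_Integration.integral_sum torus_integrable)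

lemma torus_integral_wavg:
  fixes f :: "real ^ 'd::finite \<Rightarrow> 'a::euclidean_space \<Rightarrow> real"
  assumes f: "continuous_on UNIV (\<lambda>(x, y). f x y)"
  shows "torus_integral (\<lambda>x. wavg \<delta> (f x)) = wavg \<delta> (\<lambda>y. torus_integral (\<lambda>x. f x y))"
proof -
  let ?Z = "bump_mass TYPE('a) \<delta>"
  have "torus_integral (\<lambda>x. integral (kbox \<delta>) (\<lambda>y. bump \<delta> y * f x y))
      = integral (kbox \<delta>) (\<lambda>y. torus_integral (\<lambda>x. bump \<delta> y * f x y))"
    unfolding kbox_def
  proof (rule integral_swap_continuous)
    have "continuous_on S (\<lambda>z. f (fst z) (snd z))" for S
      using continuous_on_subset[OF f] by (simp add: split_beta)
    then show "continuous_on (cbox (0, - (\<delta> *\<^sub>R One)) (1, \<delta> *\<^sub>R One)) (\<lambda>(x, y). bump \<delta> y * f x y)"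
      unfolding split_beta
      by (intro continuous_intros continuous_on_compose2[OF bump_continuous[of UNIV]]) auto
  qed
  then show ?thesis
    by (simp add: wavg_def divide_inverse)
qed

lemma torus_integral_mollify:
  fixes f :: "real ^ 'd::finite \<Rightarrow> real"
  assumes f: "continuous_on UNIV f" and p: "torus_periodic f" and d: "\<delta> > 0"
  shows "torus_integral (mollify \<delta> f) = torus_integral f"
proof -
  have "torus_integral (\<lambda>x. wavg \<delta> (\<lambda>y. f (x + y))) = wavg \<delta> (\<lambda>y. torus_integral (\<lambda>x. f (x + y)))"
    by (rule torus_integral_wavg) (auto simp: split_beta intro!: continuous_on_compose2[OF f] continuous_intros)
  then show ?thesis
    by (simp add: mollify_def[abs_def] torus_integral_shift[OF f p] wavg_const[OF d])
qed

text \<open>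
  A function with mean zero has an \<open>L\<^sup>1\<close> norm of at most twice its one-sided bound. This turns
  one-sided bounds on second differences into \<open>L\<^sup>1\<close> bounds on all differences of the gradient.
\<close>
lemma torus_L1_of_one_sided:
  fixes f :: "real ^ 'd::finite \<Rightarrow> real"
  assumes f: "continuous_on UNIV f" and int: "torus_integral f = 0" and a: "\<And>x. - a \<le> f x"
  shows "torus_integral (\<lambda>x. \<bar>f x\<bar>) \<le> 2 * a"
proof (cases "0 \<le> a")
  case True
  have "torus_integral (\<lambda>x. \<bar>f x\<bar>) \<le> torus_integral (\<lambda>x. f x + 2 * a)"
  proof (intro torus_integral_mono continuous_intros f)
    fix x show "\<bar>f x\<bar> \<le> f x + 2 * a" using a[of x] True by linarith
  qed
  also have "\<dots> = 2 * a"
    by (subst torus_integral_add[OF f]) (auto simp: int torus_integral_const)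
  finally show ?thesis .
next
  case False
  have "torus_integral (\<lambda>x :: real ^ 'd. - a) \<le> torus_integral f"
    by (intro torus_integral_mono continuous_intros f a)
  then show ?thesis using False int by (simp add: torus_integral_const)
qed

lemma semiconcave_second_difference:
  assumes "semiconcave_const C f"
  shows "f (x + y) + f (x - y) - 2 * f x \<le> 2 * C * (norm y)\<^sup>2"
proof -
  have "(1/2) *\<^sub>R (x + y) + (1 - 1/2) *\<^sub>R (x - y) = x"
  proof -
    have "(1/2) *\<^sub>R (x + y) + (1 - 1/2) *\<^sub>R (x - y) = (1/2) *\<^sub>R x + (1/2) *\<^sub>R x"
      by (simp add: scaleR_add_right scaleR_diff_right)
    also have "\<dots> = (1/2 + 1/2) *\<^sub>R x" by (rule scaleR_add_left[symmetric])
    finally show ?thesis by simp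
  qed
  moreover have "norm ((x + y) - (x - y)) = 2 * norm y"
  proof -
    have e: "(x + y) - (x - y) = 2 *\<^sub>R y" by (simp add: scaleR_2)
    show ?thesis unfolding e by simp
  qed
  ultimately show ?thesis
    using assms[unfolded semiconcave_const_def, rule_format, of "1/2" "x + y" "x - y"]
    by (simp add: power_mult_distrib field_simps)
qed

context
  fixes V :: "real ^ 'd::finite \<Rightarrow> real" and C :: real
  assumes Vc: "continuous_on UNIV V" and Vp: "torus_periodic V"
    and Vsc: "semiconcave_const C V" and C: "0 \<le> C"
begin

lemma V_translates_continuous: "continuous_on UNIV (\<lambda>x. V (x + a))" "continuous_on UNIV (\<lambda>x. V (x - a))"
  by (auto intro!: continuous_on_compose2[OF Vc] continuous_intros)

lemma second_difference_L1:
  "torus_integral (\<lambda>x. \<bar>V (x + y) + V (x - y) - 2 * V x\<bar>) \<le> 4 * C * (norm y)\<^sup>2"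
proof -
  let ?f = "\<lambda>x. 2 * V x - (V (x + y) + V (x - y))"
  have c: "continuous_on UNIV ?f" by (intro continuous_intros V_translates_continuous Vc)
  have "torus_integral ?f = 2 * torus_integral V - (torus_integral V + torus_integral V)"
    using torus_integral_shift[OF Vc Vp, of y] torus_integral_shift[OF Vc Vp, of "- y"]
    by (subst torus_integral_diff) (auto simp: torus_integral_add V_translates_continuous intro!: continuous_intros Vc V_translates_continuous)
  then have "torus_integral (\<lambda>x. \<bar>?f x\<bar>) \<le> 2 * (2 * C * (norm y)\<^sup>2)"
    using semiconcave_second_difference[OF Vsc, of _ y]
    by (intro torus_L1_of_one_sided[OF c]) (auto simp: algebra_simps)
  moreover have "\<bar>?f x\<bar> = \<bar>V (x + y) + V (x - y) - 2 * V x\<bar>" for x by linarith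
  ultimately show ?thesis by simp
qed

text \<open>
  Polarisation: a mixed second difference is a difference of two pure ones around the midpoint
  \<open>x + c\<close>.
\<close>
lemma mixed_difference_L1:
  "torus_integral (\<lambda>x. \<bar>V x - V (x + a) - V (x + b) + V (x + a + b)\<bar>) \<le> 2 * C * ((norm a)\<^sup>2 + (norm b)\<^sup>2)"
proof -
  define c where "c = (1/2) *\<^sub>R (a + b)"
  define e where "e = (1/2) *\<^sub>R (a - b)"
  let ?D = "\<lambda>y x. \<bar>V (x + y) + V (x - y) - 2 * V x\<bar>"
  have Dc: "continuous_on UNIV (?D y)" for y by (intro continuous_intros V_translates_continuous Vc)
  have Dp: "torus_periodic (?D y)" for y
    using Vp torus_periodic_shift[OF Vp, of y] torus_periodic_shift[OF Vp, of "- y"]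
    by (simp add: torus_periodic_def)
  have h: "(1/2) *\<^sub>R w + (1/2) *\<^sub>R w = w" for w :: "real ^ 'd"
    using scaleR_add_left[of "1/2" "1/2" w] by simp
  have ce: "c + c = a + b" "c + e = a" "c - e = b"
    using h[of a] h[of b] by (simp_all add: c_def e_def algebra_simps)
  have pw: "\<bar>V x - V (x + a) - V (x + b) + V (x + a + b)\<bar> \<le> ?D c (x + c) + ?D e (x + c)" for x
  proof -
    have "x + c + c = x + a + b" "x + c - c = x" "x + c + e = x + a" "x + c - e = x + b"
      using ce by (simp_all add: add.assoc add_diff_eq[symmetric])
    then show ?thesis by (simp only:)
  qed
  have "torus_integral (\<lambda>x. \<bar>V x - V (x + a) - V (x + b) + V (x + a + b)\<bar>)
      \<le> torus_integral (\<lambda>x. ?D c (x + c) + ?D e (x + c))"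
    by (intro torus_integral_mono pw continuous_on_add continuous_on_compose2[OF Dc])
      (auto simp: add.assoc intro!: continuous_intros Vc V_translates_continuous)
  also have "\<dots> = torus_integral (\<lambda>x. ?D c (x + c)) + torus_integral (\<lambda>x. ?D e (x + c))"
    by (intro torus_integral_add continuous_on_compose2[OF Dc]) (auto intro!: continuous_intros)
  also have "\<dots> = torus_integral (?D c) + torus_integral (?D e)"
    by (simp only: torus_integral_shift[OF Dc Dp])
  also have "\<dots> \<le> 4 * C * (norm c)\<^sup>2 + 4 * C * (norm e)\<^sup>2"
    by (intro add_mono second_difference_L1)
  also have "\<dots> = 2 * C * ((norm a)\<^sup>2 + (norm b)\<^sup>2)"
    unfolding c_def e_def power2_norm_eq_inner
    by (simp add: inner_simps inner_commute algebra_simps)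
  finally show ?thesis .
qed

text \<open>
  The factor \<open>1 / h\<close> in the slope is compensated because the mixed differences of step \<open>h\<close> in
  one direction and at most \<open>h\<close> in the other are of order \<open>h\<^sup>2\<close> in \<open>L\<^sup>1\<close>. This is why the
  mollification has radius \<open>h\<close>.
\<close>
lemma mollify_slope_L1:
  assumes h: "h > 0"
  shows "torus_integral (\<lambda>x. \<bar>slopes h V x \<bullet> sbasis k - slopes h (mollify h V) x \<bullet> sbasis k\<bar>) \<le> 4 * C * h"
proof -
  let ?b = "h *\<^sub>R sdir k"
  let ?E = "\<lambda>x z. V x - V (x + z) - V (x + ?b) + V (x + z + ?b)"
  have Ec: "continuous_on UNIV (\<lambda>(x, z). ?E x z)" "continuous_on UNIV (\<lambda>z. ?E x z)" "continuous_on UNIV (\<lambda>x. ?E x z)" for x z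
    unfolding split_beta by (auto intro!: continuous_intros continuous_on_compose2[OF Vc])
  have mc: "continuous_on UNIV (mollify h V)"
    unfolding mollify_eq_kconv[abs_def] by (intro continuous_intros kconv_continuous Vc bump_continuous) (use h in \<open>auto simp: less_imp_neq[OF bump_mass_pos, symmetric]\<close>)
  have eq: "slopes h V x \<bullet> sbasis k - slopes h (mollify h V) x \<bullet> sbasis k = wavg h (?E x) / h" for x
  proof -
    have "wavg h (?E x) = wavg h (\<lambda>z. - 1 * V (x + z) + 1 * V (x + ?b + z) + (V x - V (x + ?b)))"
      by (simp add: algebra_simps)
    also have "\<dots> = - 1 * mollify h V x + 1 * mollify h V (x + ?b) + (V x - V (x + ?b))"
      unfolding mollify_def by (intro wavg_affine continuous_translate[OF Vc] h)
    finally show ?thesis by (simp add: slopes_inner diff_divide_distrib add_divide_distrib)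
  qed
  have abs_le: "\<bar>wavg h (?E x)\<bar> \<le> wavg h (\<lambda>z. \<bar>?E x z\<bar>)" for x
  proof -
    have "wavg h (?E x) \<le> wavg h (\<lambda>z. \<bar>?E x z\<bar>)"
      by (rule wavg_mono[OF Ec(2) continuous_on_rabs[OF Ec(2)] h]) linarith
    moreover have "wavg h (\<lambda>z. -1 * ?E x z) \<le> wavg h (\<lambda>z. \<bar>?E x z\<bar>)"
      by (rule wavg_mono[OF continuous_on_mult_left[OF Ec(2)] continuous_on_rabs[OF Ec(2)] h]) (simp only: mult_minus1 abs_ge_minus_self)
    ultimately show ?thesis unfolding wavg_cmult by linarith
  qed
  have c1: "continuous_on UNIV (\<lambda>x. slopes h V x \<bullet> sbasis k - slopes h (mollify h V) x \<bullet> sbasis k)"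
    unfolding slopes_inner by (intro continuous_intros Vc mc V_translates_continuous continuous_on_compose2[OF mc]) (use h in auto)
  have c2: "continuous_on UNIV (\<lambda>x. wavg h (\<lambda>z. \<bar>?E x z\<bar>))"
    unfolding wavg_def kbox_def
    by (intro continuous_on_divide integral_continuous_on_param continuous_on_const)
      (use h in \<open>auto simp: split_beta less_imp_neq[OF bump_mass_pos, symmetric] intro!: continuous_intros continuous_on_compose2[OF Vc] continuous_on_compose2[OF bump_continuous[of UNIV]]\<close>)
  have "torus_integral (\<lambda>x. \<bar>slopes h V x \<bullet> sbasis k - slopes h (mollify h V) x \<bullet> sbasis k\<bar>)
      \<le> torus_integral (\<lambda>x. (1 / h) * wavg h (\<lambda>z. \<bar>?E x z\<bar>))"
    by (intro torus_integral_mono continuous_on_rabs c1 continuous_on_mult_left c2)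
      (use h abs_le in \<open>auto simp: eq abs_divide divide_right_mono\<close>)
  also have "\<dots> = (1 / h) * torus_integral (\<lambda>x. wavg h (\<lambda>z. \<bar>?E x z\<bar>))" by simp
  also have "torus_integral (\<lambda>x. wavg h (\<lambda>z. \<bar>?E x z\<bar>)) = wavg h (\<lambda>z. torus_integral (\<lambda>x. \<bar>?E x z\<bar>))"
    by (rule torus_integral_wavg) (use continuous_on_rabs[OF Ec(1)] in \<open>simp add: split_beta\<close>)
  also have "(1 / h) * \<dots> \<le> (1 / h) * wavg h (\<lambda>z :: real ^ 'd. 4 * C * h\<^sup>2)"
  proof (rule mult_left_mono)
    show "wavg h (\<lambda>z. torus_integral (\<lambda>x. \<bar>?E x z\<bar>)) \<le> wavg h (\<lambda>z :: real ^ 'd. 4 * C * h\<^sup>2)"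
    proof (rule wavg_mono[OF _ continuous_on_const h])
      show "continuous_on UNIV (\<lambda>z. torus_integral (\<lambda>x. \<bar>?E x z\<bar>))"
        by (intro integral_continuous_on_param) (auto simp: split_beta intro!: continuous_intros continuous_on_compose2[OF Vc])
      fix z :: "real ^ 'd" assume "norm z \<le> h"
      then have "(norm z)\<^sup>2 \<le> h\<^sup>2" by (intro power_mono) auto
      then have "2 * C * ((norm z)\<^sup>2 + (norm ?b)\<^sup>2) \<le> 2 * C * (h\<^sup>2 + h\<^sup>2)"
        using C h by (intro mult_left_mono add_mono) auto
      then show "torus_integral (\<lambda>x. \<bar>?E x z\<bar>) \<le> 4 * C * h\<^sup>2"
        using mixed_difference_L1[of z ?b] by simp
    qed
  qed (use h in simp)
  also have "(1 / h) * wavg h (\<lambda>z :: real ^ 'd. 4 * C * h\<^sup>2) = 4 * C * h"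
    using h by (simp add: wavg_const power2_eq_square)
  finally show ?thesis .
qed

lemma mollify_semiconcave:
  assumes h: "h > 0" shows "semiconcave_const C (mollify h V)"
  unfolding semiconcave_const_def
proof (intro allI ballI)
  fix x1 x2 :: "real ^ 'd" and l :: real assume l: "l \<in> {0<..<1}"
  let ?c = "l * (1 - l) * C * (norm (x1 - x2))\<^sup>2"
  let ?x = "l *\<^sub>R x1 + (1 - l) *\<^sub>R x2"
  have "wavg h (\<lambda>y. (l * V (x1 + y) + (1 - l) * V (x2 + y)) + - ?c) \<le> wavg h (\<lambda>y. V (?x + y))"
  proof (rule wavg_mono[OF _ _ h])
    fix y
    have "l *\<^sub>R (x1 + y) + (1 - l) *\<^sub>R (x2 + y) = ?x + y" by (simp add: algebra_simps)
    then show "(l * V (x1 + y) + (1 - l) * V (x2 + y)) + - ?c \<le> V (?x + y)"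
      using Vsc[unfolded semiconcave_const_def, rule_format, OF l, of "x1 + y" "x2 + y"] by simp
  qed (auto intro!: continuous_intros continuous_translate[OF Vc])
  also have "wavg h (\<lambda>y. (l * V (x1 + y) + (1 - l) * V (x2 + y)) + - ?c)
      = l * mollify h V x1 + (1 - l) * mollify h V x2 + - ?c"
    unfolding mollify_def by (intro wavg_affine continuous_translate[OF Vc] h)
  finally show "l * mollify h V x1 + (1 - l) * mollify h V x2 - ?c \<le> mollify h V ?x"
    by (simp add: mollify_def)
qed

end

lemma semiconcave_tangent:
  fixes v :: "'a::real_inner \<Rightarrow> real"
  assumes "semiconcave_const C v" and G: "\<And>x. (v has_derivative (\<lambda>y. G x \<bullet> y)) (at x)"
  shows "v y \<le> v x + G x \<bullet> (y - x) + C * (norm (y - x))\<^sup>2"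
proof -
  have "((\<lambda>y. (norm (x - y))\<^sup>2) has_derivative (\<lambda>w. 0)) (at x)"
    unfolding power2_norm_eq_inner by (auto intro!: derivative_eq_intros)
  from has_derivative_diff[OF has_derivative_mult_right[OF this, of C] G]
  have "((\<lambda>y. C * (norm (x - y))\<^sup>2 - v y) has_derivative (\<lambda>w. - (G x \<bullet> w))) (at x)" by simp
  from convex_on_tangent_le[OF semiconcave_const_convex[OF assms(1)] this, of y]
  show ?thesis by (simp add: norm_minus_commute)
qed

text \<open>
  By semiconcavity the slope in one direction and the derivative differ by at most \<open>C * h\<close> on
  one side, and both have mean zero.
\<close>
lemma slope_gradient_L1:
  fixes v :: "real ^ 'd::finite \<Rightarrow> real"
  assumes p: "torus_periodic v" and sc: "semiconcave_const C v"
    and G: "\<And>x. (v has_derivative (\<lambda>y. G x \<bullet> y)) (at x)" and Gc: "continuous_on UNIV G" and h: "h > 0"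
  shows "torus_integral (\<lambda>x. \<bar>slopes h v x \<bullet> sbasis k + G x \<bullet> sdir k\<bar>) \<le> 2 * (C * h)"
proof (rule torus_L1_of_one_sided)
  have vc: "continuous_on UNIV v"
    by (rule has_derivative_imp_continuous[OF G])
  have sc': "continuous_on UNIV (\<lambda>x. slopes h v x \<bullet> sbasis k)"
    unfolding slopes_inner by (intro continuous_intros vc continuous_on_compose2[OF vc]) (use h in auto)
  have gc: "continuous_on UNIV (\<lambda>x. G x \<bullet> sdir k)" by (intro continuous_intros Gc)
  show "continuous_on UNIV (\<lambda>x. slopes h v x \<bullet> sbasis k + G x \<bullet> sdir k)"
    by (intro continuous_on_add sc' gc)
  have "torus_integral (\<lambda>x. slopes h v x \<bullet> sbasis k) = 0"
  proof -
    have c: "continuous_on UNIV (\<lambda>x. v (x + h *\<^sub>R sdir k))"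
      by (intro continuous_on_compose2[OF vc] continuous_intros) auto
    have "torus_integral (\<lambda>x. (1 / h) * (v x - v (x + h *\<^sub>R sdir k))) = (1 / h) * torus_integral (\<lambda>x. v x - v (x + h *\<^sub>R sdir k))"
      by simp
    also have "torus_integral (\<lambda>x. v x - v (x + h *\<^sub>R sdir k)) = 0"
      by (simp add: torus_integral_diff[OF vc c] torus_integral_shift[OF vc p])
    finally show ?thesis by (simp add: slopes_inner)
  qed
  moreover have "torus_integral (\<lambda>x. G x \<bullet> sdir k) = 0"
    by (rule torus_integral_derivative[OF p G gc])
  ultimately show "torus_integral (\<lambda>x. slopes h v x \<bullet> sbasis k + G x \<bullet> sdir k) = 0"
    by (simp add: torus_integral_add[OF sc' gc])
  fix x
  have "v (x + h *\<^sub>R sdir k) \<le> v x + h * (G x \<bullet> sdir k) + C * h\<^sup>2"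
    using semiconcave_tangent[OF sc G, of "x + h *\<^sub>R sdir k" x] h by (simp add: power_mult_distrib)
  then have "h * (- (G x \<bullet> sdir k) - C * h) \<le> v x - v (x + h *\<^sub>R sdir k)"
    by (simp add: algebra_simps power2_eq_square)
  then have "- (G x \<bullet> sdir k) - C * h \<le> (v x - v (x + h *\<^sub>R sdir k)) / h"
    using h by (simp add: field_simps)
  then show "- (C * h) \<le> slopes h v x \<bullet> sbasis k + G x \<bullet> sdir k"
    by (simp add: slopes_inner)
qed

text \<open>
  By convexity the numerical flux exceeds \<open>H\<close> at the mollified gradient by at most the
  derivative of \<open>F\<close>, which is bounded by \<open>K\<close> in each direction, applied to the difference of
  the arguments. In each direction that difference is small in the mean: \<open>4 * C * h\<close> is the
  cost of mollifying and \<open>2 * C * h\<close> that of replacing slopes by derivatives.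
\<close>
lemma (in monotone_scheme) numerical_flux_integral:
  fixes V :: "real ^ 'd \<Rightarrow> real"
  assumes V: "lip_le L V" "L \<le> R" "torus_periodic V" "semiconcave_const C V" "0 \<le> C"
    and G: "\<And>x. (mollify h V has_derivative (\<lambda>y. G x \<bullet> y)) (at x)" and Gc: "continuous_on UNIV G"
  shows "torus_integral (\<lambda>x. F (slopes h V x)) \<le> torus_integral (\<lambda>x. F (- G x, G x)) + K * real CARD('d + 'd) * (6 * C * h)"
proof -
  have Vc: "continuous_on UNIV V" by (rule lip_le_continuous[OF V(1)])
  have Fc: "continuous_on UNIV F"
    by (rule has_derivative_imp_continuous[OF DF])
  have mc: "continuous_on UNIV (mollify h V)"
    by (rule has_derivative_imp_continuous[OF G])
  let ?a = "\<lambda>k x. \<bar>slopes h V x \<bullet> sbasis k - slopes h (mollify h V) x \<bullet> sbasis k\<bar>"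
  let ?b = "\<lambda>k x. \<bar>slopes h (mollify h V) x \<bullet> sbasis k + G x \<bullet> sdir k\<bar>"
  have slc: "continuous_on UNIV (\<lambda>x. slopes h f x)" if "continuous_on UNIV f" for f :: "real ^ 'd \<Rightarrow> real"
    unfolding slopes_def diff_fwd_def diff_bwd_def
    by (intro continuous_intros that continuous_on_compose2[OF that]) (use h in auto)
  have ac: "continuous_on UNIV (?a k)" for k by (intro continuous_intros slc Vc mc)
  have bc: "continuous_on UNIV (?b k)" for k by (intro continuous_intros slc mc Gc)
  have K: "0 \<le> K"
  proof -
    have z: "slopes h V 0 \<in> rbox R" by (rule lip_le_slopes[OF V(1,2) h])
    show ?thesis using sum_nonneg[of UNIV "\<lambda>k. DF (slopes h V 0) (sbasis k)"] DF_nonneg[OF z] DF_bound[OF z] by force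
  qed
  have pw: "F (slopes h V x) \<le> F (- G x, G x) + (\<Sum>k\<in>UNIV. K * (?a k x + ?b k x))" for x
  proof -
    let ?z = "slopes h V x"
    have z: "?z \<in> rbox R" by (rule lip_le_slopes[OF V(1,2) h])
    have "F ?z \<le> F (- G x, G x) - DF ?z ((- G x, G x) - ?z)"
      using convex_on_tangent_le[OF convex_F DF, of ?z "(- G x, G x)"] by linarith
    also have "- DF ?z ((- G x, G x) - ?z) = (\<Sum>k\<in>UNIV. DF ?z (sbasis k) * (?z \<bullet> sbasis k + G x \<bullet> sdir k))"
      unfolding linear_sbasis[OF DF_linear, of ?z "(- G x, G x) - ?z"] inner_diff_left antidiag_inner
        sum_negf[symmetric] by (intro sum.cong refl) (simp add: algebra_simps)
    then have "F (- G x, G x) - DF ?z ((- G x, G x) - ?z) = F (- G x, G x) + (\<Sum>k\<in>UNIV. DF ?z (sbasis k) * (?z \<bullet> sbasis k + G x \<bullet> sdir k))"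
      by simp
    also have "(\<Sum>k\<in>UNIV. DF ?z (sbasis k) * (?z \<bullet> sbasis k + G x \<bullet> sdir k)) \<le> (\<Sum>k\<in>UNIV. K * (?a k x + ?b k x))"
    proof (rule sum_mono)
      fix k :: "'d + 'd"
      have "DF ?z (sbasis k) \<le> (\<Sum>k\<in>UNIV. DF ?z (sbasis k))"
        by (rule member_le_sum) (use DF_nonneg[OF z] in auto)
      then have le: "DF ?z (sbasis k) \<le> K" using DF_bound[OF z] by linarith
      have "DF ?z (sbasis k) * (?z \<bullet> sbasis k + G x \<bullet> sdir k) \<le> DF ?z (sbasis k) * (?a k x + ?b k x)"
        by (intro mult_left_mono DF_nonneg[OF z]) linarith
      also have "\<dots> \<le> K * (?a k x + ?b k x)" using le by (intro mult_right_mono) auto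
      finally show "DF ?z (sbasis k) * (?z \<bullet> sbasis k + G x \<bullet> sdir k) \<le> K * (?a k x + ?b k x)" .
    qed
    finally show ?thesis by simp
  qed
  have Hc: "continuous_on UNIV (\<lambda>x. F (- G x, G x))"
    by (intro continuous_on_compose2[OF Fc] continuous_intros Gc) auto
  have sumc: "continuous_on UNIV (\<lambda>x. \<Sum>k\<in>UNIV. K * (?a k x + ?b k x))"
    by (intro continuous_on_sum continuous_on_mult_left continuous_on_add ac bc)
  have "torus_integral (\<lambda>x. F (slopes h V x)) \<le> torus_integral (\<lambda>x. F (- G x, G x) + (\<Sum>k\<in>UNIV. K * (?a k x + ?b k x)))"
    by (intro torus_integral_mono pw continuous_on_compose2[OF Fc] slc Vc continuous_on_add Hc sumc) auto
  also have "\<dots> = torus_integral (\<lambda>x. F (- G x, G x)) + (\<Sum>k\<in>UNIV. K * (torus_integral (?a k) + torus_integral (?b k)))"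
    by (subst torus_integral_add[OF Hc sumc], subst torus_integral_sum)
      (auto simp: torus_integral_add[OF ac bc] intro!: continuous_on_mult_left continuous_on_add ac bc)
  also have "(\<Sum>k\<in>UNIV. K * (torus_integral (?a k) + torus_integral (?b k))) \<le> (\<Sum>k\<in>(UNIV :: ('d + 'd) set). K * (6 * C * h))"
  proof (intro sum_mono mult_left_mono K)
    fix k :: "'d + 'd"
    have "torus_integral (?a k) \<le> 4 * C * h"
      by (rule mollify_slope_L1[OF Vc V(3-5) h])
    moreover have "torus_integral (?b k) \<le> 2 * (C * h)"
      by (rule slope_gradient_L1[OF mollify_periodic[OF V(3)] mollify_semiconcave[OF Vc V(3-5) h] G Gc h])
    ultimately show "torus_integral (?a k) + torus_integral (?b k) \<le> 6 * C * h" by simp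
  qed
  finally show ?thesis by (simp add: mult_ac)
qed

section \<open>Divergence of the characteristic velocity field\<close>

lemma convex_hessian_psd:
  fixes H :: "'a::real_normed_vector \<Rightarrow> real"
  assumes H: "convex_on UNIV H" and d: "\<And>p. (H has_derivative blinfun_apply (H' p)) (at p)"
    and dd: "\<And>p. (H' has_derivative blinfun_apply (H'' p)) (at p)"
  shows "0 \<le> blinfun_apply (blinfun_apply (H'' p) y) y"
proof -
  have "((\<lambda>q. - blinfun_apply (H' q) y) has_derivative (\<lambda>v. - blinfun_apply (blinfun_apply (H'' p) v) y)) (at p)"
    by (rule has_derivative_minus[OF bounded_linear.has_derivative[OF blinfun.bounded_linear_left dd]])
  then have "- blinfun_apply (blinfun_apply (H'' p) y) y \<le> 0"
  proof (rule has_derivative_le_of_increment[OF _ zero_less_one])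
    fix s :: real assume s: "0 < s"
    have "H p + H' p (s *\<^sub>R y) \<le> H (p + s *\<^sub>R y)"
      using convex_on_tangent_le[OF H d, of p "p + s *\<^sub>R y"] by simp
    moreover have "H (p + s *\<^sub>R y) + H' (p + s *\<^sub>R y) (- (s *\<^sub>R y)) \<le> H p"
      using convex_on_tangent_le[OF H d, of "p + s *\<^sub>R y" p] by simp
    ultimately have "s * H' p y \<le> s * H' (p + s *\<^sub>R y) y"
      by (simp add: blinfun.bilinear_simps)
    then show "- H' (p + s *\<^sub>R y) y \<le> - H' p y + s * 0" using s by simp
  qed
  then show ?thesis by simp
qed

lemma semiconcave_hessian_le:
  fixes v :: "'a::real_inner \<Rightarrow> real"
  assumes sc: "semiconcave_const C v" and G: "\<And>x. (v has_derivative (\<lambda>y. G x \<bullet> y)) (at x)"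
    and M: "(G has_derivative M) (at x)"
  shows "M y \<bullet> y \<le> 2 * C * (norm y)\<^sup>2"
proof -
  have "((\<lambda>x. G x \<bullet> y) has_derivative (\<lambda>v. M v \<bullet> y)) (at x)"
    by (rule has_derivative_inner_left[OF M])
  then show ?thesis
  proof (rule has_derivative_le_of_increment[OF _ zero_less_one])
    fix s :: real assume s: "0 < s"
    have "v (x + s *\<^sub>R y) \<le> v x + s * (G x \<bullet> y) + C * (s\<^sup>2 * (norm y)\<^sup>2)"
      using semiconcave_tangent[OF sc G, of "x + s *\<^sub>R y" x] by (simp add: power_mult_distrib)
    moreover have "v x \<le> v (x + s *\<^sub>R y) - s * (G (x + s *\<^sub>R y) \<bullet> y) + C * (s\<^sup>2 * (norm y)\<^sup>2)"
      using semiconcave_tangent[OF sc G, of x "x + s *\<^sub>R y"] by (simp add: power_mult_distrib)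
    ultimately have "s * (G (x + s *\<^sub>R y) \<bullet> y) \<le> s * (G x \<bullet> y + s * (2 * C * (norm y)\<^sup>2))"
      by (simp add: algebra_simps power2_eq_square)
    then show "G (x + s *\<^sub>R y) \<bullet> y \<le> G x \<bullet> y + s * (2 * C * (norm y)\<^sup>2)"
      using s by (simp only: mult_le_cancel_left_pos)
  qed
qed

text \<open>
  In the application \<open>B\<close> is the Hessian of the Hamiltonian and \<open>M\<close> that of a semiconcave
  function. Positivity of \<open>c\<close> times the identity minus \<open>M\<close> gives the bound; \<open>B\<close> is replaced by
  its symmetric part \<open>A\<close>, which does not change the trace because \<open>M\<close> is symmetric.
\<close>
lemma trace_hessian_product_le:
  fixes B :: "real ^ 'd::finite \<Rightarrow> real ^ 'd \<Rightarrow> real" and M :: "real ^ 'd \<Rightarrow> real ^ 'd"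
  assumes B: "\<And>y. linear (B y)" "\<And>y. linear (\<lambda>x. B x y)" and psd: "\<And>y. 0 \<le> B y y"
    and M: "linear M" and sym: "\<And>v w. M v \<bullet> w = M w \<bullet> v" and le: "\<And>y. M y \<bullet> y \<le> c * (norm y)\<^sup>2"
  shows "(\<Sum>i\<in>UNIV. B (M (axis i 1)) (axis i 1)) \<le> c * (\<Sum>i\<in>UNIV. B (axis i 1) (axis i 1))"
proof -
  define A where "A i j = (B (axis i 1) (axis j 1) + B (axis j 1) (axis i 1)) / 2" for i j
  define N where "N i j = c * (if i = j then 1 else 0) - M (axis i 1) \<bullet> axis j 1" for i j
  have bil: "B (\<Sum>i\<in>UNIV. (x $ i) *\<^sub>R axis i 1) (\<Sum>j\<in>UNIV. (y $ j) *\<^sub>R axis j 1)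
      = (\<Sum>i\<in>UNIV. \<Sum>j\<in>UNIV. x $ i * y $ j * B (axis i 1) (axis j 1))" for x y :: "real ^ 'd"
    by (simp add: linear_sum[OF B(1)] linear_sum[OF B(2)] linear_scale[OF B(1)] linear_scale[OF B(2)]
      sum_distrib_left mult_ac) (rule sum.swap)
  have "0 \<le> (\<Sum>i\<in>UNIV. \<Sum>j\<in>UNIV. A i j * N i j)"
  proof (rule psd_trace_product_nonneg)
    show "A i j = A j i" for i j by (simp add: A_def)
    show "0 \<le> (\<Sum>i\<in>UNIV. \<Sum>j\<in>UNIV. x i * x j * A i j)" for x :: "'d \<Rightarrow> real"
    proof -
      let ?y = "\<chi> i. x i"
      let ?Q = "\<Sum>i\<in>UNIV. \<Sum>j\<in>UNIV. x i * x j * B (axis i 1) (axis j 1)"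
      have "B ?y ?y = ?Q" using bil[of ?y ?y] axis_expansion[of ?y] by simp
      moreover have "(\<Sum>i\<in>UNIV. \<Sum>j\<in>UNIV. x i * x j * B (axis j 1) (axis i 1)) = ?Q"
        by (subst sum.swap) (simp add: mult.commute mult.left_commute)
      moreover have "(\<Sum>i\<in>UNIV. \<Sum>j\<in>UNIV. x i * x j * A i j)
          = (?Q + (\<Sum>i\<in>UNIV. \<Sum>j\<in>UNIV. x i * x j * B (axis j 1) (axis i 1))) / 2"
        unfolding A_def sum.distrib[symmetric] sum_divide_distrib
        by (intro sum.cong refl) (simp add: algebra_simps)
      ultimately show ?thesis using psd[of ?y] by simp
    qed
    show "0 \<le> (\<Sum>i\<in>UNIV. \<Sum>j\<in>UNIV. x i * x j * N i j)" for x :: "'d \<Rightarrow> real"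
    proof -
      let ?y = "\<chi> i. x i"
      have "M ?y \<bullet> ?y = M (\<Sum>i\<in>UNIV. x i *\<^sub>R axis i 1) \<bullet> (\<Sum>j\<in>UNIV. x j *\<^sub>R axis j 1)"
        using axis_expansion[of ?y] by simp
      also have "\<dots> = (\<Sum>i\<in>UNIV. \<Sum>j\<in>UNIV. x i * x j * (M (axis i 1) \<bullet> axis j 1))"
        by (simp add: linear_sum[OF M] linear_scale[OF M] inner_sum_left inner_sum_right sum_distrib_left mult_ac)
          (subst sum.swap, simp add: mult.left_commute)
      finally have 1: "M ?y \<bullet> ?y = (\<Sum>i\<in>UNIV. \<Sum>j\<in>UNIV. x i * x j * (M (axis i 1) \<bullet> axis j 1))" .
      have 2: "(norm ?y)\<^sup>2 = (\<Sum>i\<in>UNIV. \<Sum>j\<in>UNIV. x i * x j * (if i = j then 1 else 0))"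
        unfolding power2_norm_eq_inner inner_vec_def by (simp add: if_distrib cong: if_cong)
      have "(\<Sum>i\<in>UNIV. \<Sum>j\<in>UNIV. x i * x j * N i j) = c * (norm ?y)\<^sup>2 - M ?y \<bullet> ?y"
        unfolding 1 2 N_def sum_distrib_left sum_subtractf[symmetric]
        by (intro sum.cong refl) (simp add: algebra_simps)
      then show ?thesis using le[of ?y] by simp
    qed
  qed simp
  also have "(\<Sum>i\<in>UNIV. \<Sum>j\<in>UNIV. A i j * N i j)
      = c * (\<Sum>i\<in>UNIV. B (axis i 1) (axis i 1)) - (\<Sum>i\<in>UNIV. B (M (axis i 1)) (axis i 1))"
  proof -
    let ?P = "\<Sum>i\<in>UNIV. \<Sum>j\<in>UNIV. B (axis j 1) (axis i 1) * (M (axis i 1) \<bullet> axis j 1)"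
    have 1: "(\<Sum>i\<in>UNIV. B (M (axis i 1)) (axis i 1)) = ?P"
    proof (intro sum.cong refl)
      fix i
      have "B (M (axis i 1)) (axis i 1) = B (\<Sum>j\<in>UNIV. (M (axis i 1) $ j) *\<^sub>R axis j 1) (axis i 1)"
        using axis_expansion[of "M (axis i 1)"] by simp
      also have "\<dots> = (\<Sum>j\<in>UNIV. B (axis j 1) (axis i 1) * (M (axis i 1) \<bullet> axis j 1))"
        by (simp add: linear_sum[OF B(2)] linear_scale[OF B(2)] inner_axis mult.commute)
      finally show "B (M (axis i 1)) (axis i 1) = (\<Sum>j\<in>UNIV. B (axis j 1) (axis i 1) * (M (axis i 1) \<bullet> axis j 1))" .
    qed
    have 2: "(\<Sum>i\<in>UNIV. \<Sum>j\<in>UNIV. B (axis i 1) (axis j 1) * (M (axis i 1) \<bullet> axis j 1)) = ?P"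
      by (subst sum.swap) (simp add: sym)
    have 3: "(\<Sum>i\<in>UNIV. \<Sum>j\<in>UNIV. A i j * (c * (if i = j then 1 else 0))) = c * (\<Sum>i\<in>UNIV. B (axis i 1) (axis i 1))"
      by (simp add: A_def if_distrib sum_distrib_left mult.commute cong: if_cong)
    have 4: "(\<Sum>i\<in>UNIV. \<Sum>j\<in>UNIV. A i j * (M (axis i 1) \<bullet> axis j 1)) = ?P"
    proof -
      have "(\<Sum>i\<in>UNIV. \<Sum>j\<in>UNIV. A i j * (M (axis i 1) \<bullet> axis j 1))
          = ((\<Sum>i\<in>UNIV. \<Sum>j\<in>UNIV. B (axis i 1) (axis j 1) * (M (axis i 1) \<bullet> axis j 1)) + ?P) / 2"
        unfolding A_def sum.distrib[symmetric] sum_divide_distrib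
        by (intro sum.cong refl) (simp add: algebra_simps)
      then show ?thesis using 2 by simp
    qed
    show ?thesis
      unfolding N_def right_diff_distrib sum_subtractf 3 4 1 ..
  qed
  finally show ?thesis by simp
qed

text \<open>
  Integration by parts moves the derivative from \<open>z\<close> to the velocity field \<open>DH \<circ> G\<close>. Its
  divergence is the trace of the product of the Hessians of \<open>H\<close> and \<open>v\<close>, which is bounded from
  above as \<open>v\<close> is semiconcave; an upper bound is enough because \<open>z\<close> is nonnegative.
\<close>
lemma torus_divergence_estimate:
  fixes H z :: "real ^ 'd::finite \<Rightarrow> real"
  assumes H: "convex_on UNIV H" and d: "\<And>p. (H has_derivative blinfun_apply (H' p)) (at p)"
    and dd: "\<And>p. (H' has_derivative blinfun_apply (H'' p)) (at p)" and Hc: "continuous_on UNIV H''"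
    and v: "torus_periodic v" "semiconcave_const C v" "0 \<le> C"
    and G: "\<And>x. (v has_derivative (\<lambda>y. G x \<bullet> y)) (at x)" and Gc: "continuous_on UNIV G"
    and M: "\<And>x. (G has_derivative M x) (at x)" and Mc: "\<And>y. continuous_on UNIV (\<lambda>x. M x y)"
    and sym: "\<And>x v w. M x v \<bullet> w = M x w \<bullet> v"
    and bound: "\<And>x. (\<Sum>i\<in>UNIV. H'' (G x) (axis i 1) (axis i 1)) \<le> B"
    and z: "torus_periodic z" "\<And>x. 0 \<le> z x"
    and Gz: "\<And>x. (z has_derivative (\<lambda>y. Gz x \<bullet> y)) (at x)" and Gzc: "continuous_on UNIV Gz"
  shows "- torus_integral (\<lambda>x. H' (G x) (Gz x)) \<le> 2 * C * B * torus_integral z"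
proof -
  have zc: "continuous_on UNIV z" and H'c: "continuous_on UNIV H'" by (rule has_derivative_imp_continuous[OF Gz], rule has_derivative_imp_continuous[OF dd])
  have Gp: "G (x + axis j 1) = G x" for x j
  proof -
    have "G (x + axis j 1) \<bullet> y = G x \<bullet> y" for y
      by (rule fun_cong[OF torus_periodic_derivative[OF v(1) G]])
    then have "(G (x + axis j 1) - G x) \<bullet> (G (x + axis j 1) - G x) = 0" by (simp only: inner_diff_left diff_self)
    then show ?thesis by simp
  qed
  define D where "D i x y = z x * H'' (G x) (M x y) (axis i 1) + (Gz x \<bullet> y) * H' (G x) (axis i 1)" for i x y
  have HGc: "continuous_on UNIV (\<lambda>x. H'' (G x))" "continuous_on UNIV (\<lambda>x. H' (G x))"
    by (auto intro!: continuous_on_compose2[OF Hc] continuous_on_compose2[OF H'c] Gc)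
  have Dd: "((\<lambda>x. z x * H' (G x) (axis i 1)) has_derivative D i x) (at x)" for i x
  proof -
    have "((\<lambda>x. H' (G x)) has_derivative (\<lambda>y. H'' (G x) (M x y))) (at x)"
      by (rule has_derivative_compose[OF M dd])
    then have "((\<lambda>x. H' (G x) (axis i 1)) has_derivative (\<lambda>y. H'' (G x) (M x y) (axis i 1))) (at x)"
      by (rule bounded_linear.has_derivative[OF blinfun.bounded_linear_left])
    from has_derivative_mult[OF Gz this] show ?thesis
      by (rule has_derivative_eq_rhs) (simp add: D_def fun_eq_iff)
  qed
  have Dc: "continuous_on UNIV (\<lambda>x. D i x y)" for i y
    unfolding D_def by (intro continuous_intros zc HGc Mc Gzc)
  have "torus_integral (\<lambda>x. D i x (axis i 1)) = 0" for i
    by (rule torus_integral_derivative[OF _ Dd Dc]) (use z(1) Gp in \<open>simp add: torus_periodic_def\<close>)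
  then have "torus_integral (\<lambda>x. \<Sum>i\<in>UNIV. D i x (axis i 1)) = 0"
    by (subst torus_integral_sum) (auto intro: Dc)
  moreover have "(\<Sum>i\<in>UNIV. D i x (axis i 1)) = z x * (\<Sum>i\<in>UNIV. H'' (G x) (M x (axis i 1)) (axis i 1)) + H' (G x) (Gz x)" for x
  proof -
    have "H' (G x) (Gz x) = H' (G x) (\<Sum>i\<in>UNIV. (Gz x $ i) *\<^sub>R axis i 1)"
      using axis_expansion[of "Gz x"] by simp
    also have "\<dots> = (\<Sum>i\<in>UNIV. (Gz x \<bullet> axis i 1) * H' (G x) (axis i 1))"
      by (simp add: blinfun.sum_right blinfun.scaleR_right inner_axis)
    finally show ?thesis by (simp add: D_def sum.distrib sum_distrib_left)
  qed
  moreover have dc: "continuous_on UNIV (\<lambda>x. z x * (\<Sum>i\<in>UNIV. H'' (G x) (M x (axis i 1)) (axis i 1)))"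
    by (intro continuous_intros zc HGc Mc)
  moreover have Hzc: "continuous_on UNIV (\<lambda>x. H' (G x) (Gz x))"
    by (intro continuous_intros HGc Gzc)
  ultimately have "- torus_integral (\<lambda>x. H' (G x) (Gz x))
      = torus_integral (\<lambda>x. z x * (\<Sum>i\<in>UNIV. H'' (G x) (M x (axis i 1)) (axis i 1)))"
    by (simp add: torus_integral_add)
  also have "\<dots> \<le> torus_integral (\<lambda>x. 2 * C * B * z x)"
  proof (intro torus_integral_mono dc continuous_intros zc)
    fix x
    have "(\<Sum>i\<in>UNIV. H'' (G x) (M x (axis i 1)) (axis i 1)) \<le> 2 * C * (\<Sum>i\<in>UNIV. H'' (G x) (axis i 1) (axis i 1))"
    proof (rule trace_hessian_product_le[where B="\<lambda>y w. H'' (G x) y w"])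
      show "linear (\<lambda>w. H'' (G x) y w)" for y
        by (rule bounded_linear.linear[OF blinfun.bounded_linear_right])
      show "linear (\<lambda>y. H'' (G x) y w)" for w
        by (intro linearI) (simp_all add: blinfun.bilinear_simps)
      show "0 \<le> H'' (G x) y y" for y by (rule convex_hessian_psd[OF H d dd])
      show "linear (M x)" by (rule has_derivative_linear[OF M])
      show "M x v \<bullet> w = M x w \<bullet> v" for v w by (rule sym)
      show "M x y \<bullet> y \<le> 2 * C * (norm y)\<^sup>2" for y
        by (rule semiconcave_hessian_le[OF v(2) G M])
    qed
    also have "\<dots> \<le> 2 * C * B" using bound[of x] v(3) by (intro mult_left_mono) auto
    finally show "z x * (\<Sum>i\<in>UNIV. H'' (G x) (M x (axis i 1)) (axis i 1)) \<le> 2 * C * B * z x"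
      using z(2)[of x] by (simp add: mult.commute mult_left_mono)
  qed
  finally show ?thesis by simp
qed

text \<open>
  Mean value inequality for the upper right Dini derivative, by extending the estimate beyond
  the last time up to which it holds.
\<close>
lemma dini_upper_bound:
  fixes D :: "real \<Rightarrow> real"
  assumes D: "continuous_on {a..b} D" and ab: "a \<le> b"
    and dini: "\<And>t \<sigma>. t \<in> {a..<b} \<Longrightarrow> \<sigma> > 0 \<Longrightarrow>
      \<exists>e>0. \<forall>s. 0 < s \<longrightarrow> s < e \<longrightarrow> t + s \<le> b \<longrightarrow> D (t + s) \<le> D t + s * (A + \<sigma>)"
  shows "D b \<le> D a + (b - a) * A"
proof -
  have main: "D b \<le> D a + (b - a) * (A + \<sigma>)" if s: "\<sigma> > 0" for \<sigma>
  proof (rule ccontr)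
    assume neg: "\<not> D b \<le> D a + (b - a) * (A + \<sigma>)"
    define f where "f t = D t - D a - (t - a) * (A + \<sigma>)" for t
    let ?E = "{t \<in> {a..b}. f t \<le> 0}"
    have fc: "continuous_on {a..b} f" unfolding f_def by (intro continuous_intros D)
    have "closed ?E"
      by (rule continuous_on_closed_Collect_le[OF fc continuous_on_const closed_atLeastAtMost])
    moreover have a: "a \<in> ?E" using ab by (simp add: f_def)
    moreover have bd: "bdd_above ?E" by (auto intro: bdd_aboveI[of _ b])
    ultimately have c: "Sup ?E \<in> ?E" by (intro closed_contains_Sup) auto
    define c where "c = Sup ?E"
    have cE: "c \<in> ?E" using c unfolding c_def .
    have "f b > 0" using neg by (simp add: f_def)
    then have "c \<noteq> b" using cE by auto
    then have c': "c \<in> {a..<b}" "f c \<le> 0" using cE by auto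
    obtain e where e: "e > 0" "\<And>s. 0 < s \<Longrightarrow> s < e \<Longrightarrow> c + s \<le> b \<Longrightarrow> D (c + s) \<le> D c + s * (A + \<sigma>)"
      using dini[OF c'(1) s] by blast
    define r where "r = min (e / 2) (b - c)"
    have r: "0 < r" "r < e" "c + r \<le> b" using e(1) c' by (auto simp: r_def)
    have "f (c + r) \<le> 0" using e(2)[OF r] c'(2) by (simp add: f_def algebra_simps)
    then have "c + r \<in> ?E" using r c' by auto
    then have "c + r \<le> c" unfolding c_def by (intro cSup_upper bd)
    then show False using r by simp
  qed
  show ?thesis
  proof (cases "a = b")
    case False
    then have p: "b - a > 0" using ab by simp
    show ?thesis
    proof (rule field_le_epsilon)
      fix e :: real assume "e > 0"
      moreover have "(b - a) * (A + e / (b - a)) = (b - a) * A + e" using p by (simp add: distrib_left)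
      ultimately show "D b \<le> D a + (b - a) * A + e"
        using main[of "e / (b - a)"] p by simp
    qed
  qed simp
qed

section \<open>Growth of the integral of the solution\<close>

lemma lip_le_gradient:
  fixes v :: "'a::real_inner \<Rightarrow> real"
  assumes v: "lip_le L v" and L: "0 \<le> L" and G: "(v has_derivative (\<lambda>y. G \<bullet> y)) (at x)"
  shows "norm G \<le> L"
proof -
  have "G \<bullet> G \<le> L * norm G"
  proof (rule has_derivative_le_of_increment[OF G zero_less_one])
    fix s :: real assume "0 < s"
    then show "v (x + s *\<^sub>R G) \<le> v x + s * (L * norm G)"
      using v[unfolded lip_le_def, rule_format, of "x + s *\<^sub>R G" x] by (simp add: mult_ac)
  qed
  then have "norm G * norm G \<le> L * norm G"
    by (simp flip: power2_norm_eq_inner power2_eq_square)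
  then show ?thesis using L by (cases "norm G = 0") (auto simp: mult_le_cancel_right)
qed

lemma lip_le_mollify:
  assumes V: "lip_le L V" and h: "h > 0" shows "lip_le L (mollify h V)"
  unfolding lip_le_def
proof (intro allI)
  fix x y
  have Vc: "continuous_on UNIV V" by (rule lip_le_continuous[OF V])
  have "mollify h V x \<le> wavg h (\<lambda>w. 1 * V (y + w) + 0 * V (y + w) + L * norm (x - y))"
    unfolding mollify_def
  proof (rule wavg_mono[OF continuous_translate[OF Vc] _ h])
    show "V (x + w) \<le> 1 * V (y + w) + 0 * V (y + w) + L * norm (x - y)" for w
      using V[unfolded lip_le_def, rule_format, of "x + w" "y + w"] by simp
  qed (intro continuous_intros continuous_translate[OF Vc])
  also have "\<dots> = mollify h V y + L * norm (x - y)"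
    unfolding mollify_def by (subst wavg_affine[OF continuous_translate[OF Vc] continuous_translate[OF Vc] h]) simp
  finally show "mollify h V x \<le> mollify h V y + L * norm (x - y)" .
qed

lemma DERIV_eventually_le:
  fixes \<Phi> :: "real \<Rightarrow> real"
  assumes d: "(\<Phi> has_real_derivative m) (at 0)" and s: "\<sigma> > 0"
  obtains e where "e > 0" "\<And>s. 0 < s \<Longrightarrow> s < e \<Longrightarrow> \<Phi> s \<le> \<Phi> 0 + s * (m + \<sigma>)"
proof -
  have "((\<lambda>s. (\<Phi> (0 + s) - \<Phi> 0) / s) \<longlongrightarrow> m) (at_right 0)"
    using d unfolding DERIV_def by (rule filterlim_mono) (auto intro: at_le)
  then have "\<forall>\<^sub>F s in at_right 0. (\<Phi> (0 + s) - \<Phi> 0) / s < m + \<sigma>"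
    by (rule order_tendstoD) (use s in simp)
  then obtain e where e: "e > 0" "\<And>s. 0 < s \<Longrightarrow> s < e \<Longrightarrow> (\<Phi> (0 + s) - \<Phi> 0) / s < m + \<sigma>"
    unfolding eventually_at_right_field by auto
  show ?thesis
  proof (rule that[OF e(1)])
    fix s assume s: "0 < s" "s < e"
    then have "(\<Phi> s - \<Phi> 0) / s < m + \<sigma>" using e(2)[OF s] by simp
    then show "\<Phi> s \<le> \<Phi> 0 + s * (m + \<sigma>)" using s by (simp add: divide_less_eq mult.commute)
  qed
qed

text \<open>
  Formally the integral of \<open>u\<close> decays at the rate of the integral of \<open>H (Du)\<close>, and by
  convexity \<open>H (Du) \<ge> H (Dv) + DH (Dv) \<bullet> D(u - v)\<close>, where \<open>v\<close> is the mollification of \<open>V\<close>. The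
  last term is bounded by the divergence estimate as soon as \<open>u - v + c\<close> is nonnegative. To
  avoid differentiating \<open>u\<close>, the argument is run with the mollification of \<open>u\<close>: it has the
  same integral, and the transport inequality holds for it with the velocity \<open>DH (Dv)\<close> at each
  point, since the inequality for constant velocities is preserved by averaging.
\<close>
lemma torus_mass_growth:
  fixes H :: "real ^ 'd::finite \<Rightarrow> real" and u :: "real ^ 'd \<Rightarrow> real \<Rightarrow> real"
  assumes H: "convex_on UNIV H" and d: "\<And>p. (H has_derivative blinfun_apply (H' p)) (at p)"
    and dd: "\<And>p. (H' has_derivative blinfun_apply (H'' p)) (at p)" and Hc: "continuous_on UNIV H''"
    and per: "\<And>t. t \<in> {0..T} \<Longrightarrow> torus_periodic (\<lambda>x. u x t)"
    and cont: "continuous_on (UNIV \<times> {0..T}) (\<lambda>(x, t). u x t)"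
    and transport: "\<And>v l x t s. (\<And>p. v \<bullet> p - l \<le> H p) \<Longrightarrow> 0 \<le> t \<Longrightarrow> 0 \<le> s \<Longrightarrow> t + s \<le> T \<Longrightarrow>
      u x (t + s) \<le> u (x - s *\<^sub>R v) t + s * l"
    and V: "lip_le L V" "0 \<le> L" "torus_periodic V" "semiconcave_const C V" "0 \<le> C" and h: "h > 0"
    and G: "\<And>x. (mollify h V has_derivative (\<lambda>y. G x \<bullet> y)) (at x)" and Gc: "continuous_on UNIV G"
    and M: "\<And>x. (G has_derivative M x) (at x)" and Mc: "\<And>y. continuous_on UNIV (\<lambda>x. M x y)"
    and sym: "\<And>x v w. M x v \<bullet> w = M x w \<bullet> v"
    and B: "\<And>p. norm p \<le> L \<Longrightarrow> (\<Sum>i\<in>UNIV. H'' p (axis i 1) (axis i 1)) \<le> B" "0 \<le> B"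
    and l0: "\<And>p. v0 \<bullet> p - l0 \<le> H p" "0 \<le> l0"
    and t: "0 \<le> t0" "t0 \<le> t1" "t1 \<le> T"
    and low: "\<And>x t. t \<in> {t0..t1} \<Longrightarrow> V x - c \<le> u x t"
  shows "torus_integral (\<lambda>x. u x t1) \<le> torus_integral (\<lambda>x. u x t0) + (t1 - t0) *
    (2 * C * B * (torus_integral (\<lambda>x. u x t0) - torus_integral V + (t1 - t0) * l0 + c) - torus_integral (\<lambda>x. H (G x)))"
proof -
  let ?v = "mollify h V"
  let ?A = "2 * C * B * (torus_integral (\<lambda>x. u x t0) - torus_integral V + (t1 - t0) * l0 + c) - torus_integral (\<lambda>x. H (G x))"
  have Vc: "continuous_on UNIV V" by (rule lip_le_continuous[OF V(1)])
  have vc: "continuous_on UNIV ?v" by (rule has_derivative_imp_continuous[OF G])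
  have Hcont: "continuous_on UNIV H" by (rule has_derivative_imp_continuous[OF d])
  have H'c: "continuous_on UNIV H'" by (rule has_derivative_imp_continuous[OF dd])
  have vper: "torus_periodic ?v" by (rule mollify_periodic[OF V(3)])
  have vsc: "semiconcave_const C ?v" by (rule mollify_semiconcave[OF Vc V(3-5) h])
  have GL: "norm (G x) \<le> L" for x by (rule lip_le_gradient[OF lip_le_mollify[OF V(1) h] V(2) G])
  have uc: "continuous_on UNIV (\<lambda>x. u x t)" and up: "torus_periodic (\<lambda>x. u x t)" if "t \<in> {t0..t1}" for t
    using viscosity_solution_slice_continuous[OF cont] per that t by auto
  define b :: "real ^ 'd \<Rightarrow> real ^ 'd" where
    "b x = (\<Sum>i\<in>UNIV. blinfun_apply (H' (G x)) (axis i 1) *\<^sub>R axis i 1)" for x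
  have bp: "b x \<bullet> p = H' (G x) p" for x p
    unfolding b_def by (rule inner_gradient)
  have HGc: "continuous_on UNIV (\<lambda>x. H' (G x))" "continuous_on UNIV (\<lambda>x. H (G x))"
    by (auto intro!: continuous_on_compose2[OF H'c] continuous_on_compose2[OF Hcont] Gc)
  have bc: "continuous_on UNIV b" unfolding b_def by (intro continuous_intros HGc)
  define l where "l x = b x \<bullet> G x - H (G x)" for x
  have lc: "continuous_on UNIV l" unfolding l_def by (intro continuous_intros bc Gc HGc)
  have adm: "b x \<bullet> p - l x \<le> H p" for x p
    using convex_on_tangent_le[OF H d, of "G x" p]
    by (simp add: l_def bp blinfun.diff_right)
  define D where "D t = torus_integral (\<lambda>x. u x t)" for t
  have growth: "D t \<le> D t0 + (t - t0) * l0" if tt: "t \<in> {t0..t1}" for t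
  proof -
    have "u x (t0 + (t - t0)) \<le> u (x - (t - t0) *\<^sub>R v0) t0 + (t - t0) * l0" for x
      by (rule transport[OF l0(1)]) (use tt t in auto)
    moreover have c0: "continuous_on UNIV (\<lambda>x. u (x - (t - t0) *\<^sub>R v0) t0)"
      by (rule continuous_on_compose2[OF uc[of t0]]) (use t in \<open>auto intro!: continuous_intros\<close>)
    ultimately have "D t \<le> torus_integral (\<lambda>x. u (x - (t - t0) *\<^sub>R v0) t0 + (t - t0) * l0)"
      unfolding D_def by (intro torus_integral_mono uc tt continuous_intros) auto
    also have "\<dots> = torus_integral (\<lambda>x. u (x + - ((t - t0) *\<^sub>R v0)) t0) + (t - t0) * l0"
      by (subst torus_integral_add[OF c0]) (auto simp: )
    also have "torus_integral (\<lambda>x. u (x + - ((t - t0) *\<^sub>R v0)) t0) = D t0"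
      unfolding D_def by (rule torus_integral_shift[OF uc up]) (use t in auto)
    finally show ?thesis .
  qed
  have Dc: "continuous_on {t0..t1} D"
    unfolding D_def
  proof (rule integral_continuous_on_param)
    have "continuous_on ({t0..t1} \<times> cbox 0 1) (\<lambda>z. (\<lambda>(x, t). u x t) (snd z, fst z))"
      by (rule continuous_on_compose2[OF cont]) (use t in \<open>auto intro!: continuous_intros\<close>)
    then show "continuous_on ({t0..t1} \<times> cbox 0 1) (\<lambda>(t, x). u x t)" by (simp add: split_beta)
  qed
  have "D t1 \<le> D t0 + (t1 - t0) * ?A"
  proof (rule dini_upper_bound[OF Dc t(2)])
    fix t \<sigma> :: real assume tt: "t \<in> {t0..<t1}" and s: "\<sigma> > 0"
    then have tt': "t \<in> {t0..t1}" by auto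
    let ?u = "\<lambda>x. u x t"
    let ?U = "mollify h ?u"
    note c = uc[OF tt'] and p = up[OF tt']
    obtain GU and MU :: "real ^ 'd \<Rightarrow> real ^ 'd \<Rightarrow> real ^ 'd" where
      GU: "\<And>x. (?U has_derivative (\<lambda>v. GU x \<bullet> v)) (at x)" and GUc: "continuous_on UNIV GU"
      by (rule mollify_C2[OF c h]) blast
    have Uc: "continuous_on UNIV ?U" by (rule has_derivative_imp_continuous[OF GU])
    define \<Phi> where "\<Phi> s = torus_integral (\<lambda>x. ?U (x - s *\<^sub>R b x))" for s
    \<comment> \<open>the mollified solution is displaced backwards along the velocity field \<open>b\<close>\<close>
    have "(\<Phi> has_real_derivative torus_integral (\<lambda>x. - (GU (x - 0 *\<^sub>R b x) \<bullet> b x))) (at 0 within UNIV)"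
      unfolding \<Phi>_def[abs_def]
    proof (rule leibniz_rule_field_derivative)
      fix s x
      have "((\<lambda>s. x - s *\<^sub>R b x) has_derivative (\<lambda>r. - (r *\<^sub>R b x))) (at s)"
        by (auto intro!: derivative_eq_intros)
      from has_derivative_compose[OF this GU]
      show "((\<lambda>s. ?U (x - s *\<^sub>R b x)) has_real_derivative - (GU (x - s *\<^sub>R b x) \<bullet> b x)) (at s within UNIV)"
        unfolding has_field_derivative_def by (rule has_derivative_eq_rhs) (simp add: fun_eq_iff)
    next
      show "(\<lambda>x. ?U (x - s *\<^sub>R b x)) integrable_on cbox 0 1" for s
        by (intro torus_integrable continuous_on_compose2[OF Uc] continuous_intros bc) auto
      show "continuous_on (UNIV \<times> cbox 0 1) (\<lambda>(s, x). - (GU (x - s *\<^sub>R b x) \<bullet> b x))"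
        unfolding split_beta
        by (intro continuous_intros continuous_on_compose2[OF GUc] continuous_on_compose2[OF bc]) auto
    qed auto
    then have "(\<Phi> has_real_derivative - torus_integral (\<lambda>x. GU x \<bullet> b x)) (at 0)" by simp
    from DERIV_eventually_le[OF this s] obtain e where e: "e > 0"
      "\<And>s. 0 < s \<Longrightarrow> s < e \<Longrightarrow> \<Phi> s \<le> \<Phi> 0 + s * (- torus_integral (\<lambda>x. GU x \<bullet> b x) + \<sigma>)" by blast
    have A: "- torus_integral (\<lambda>x. GU x \<bullet> b x) + torus_integral l \<le> ?A"
    proof -
      let ?z = "\<lambda>x. ?U x - ?v x + c"
      have gc: "continuous_on UNIV (\<lambda>x. GU x \<bullet> b x)" "continuous_on UNIV (\<lambda>x. H' (G x) (GU x - G x))"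
        "continuous_on UNIV (\<lambda>x. H' (G x) (G x))"
        by (intro continuous_intros GUc bc HGc Gc)+
      have zpos: "0 \<le> ?z x" for x
      proof -
        have "wavg h (\<lambda>y. 1 * V (x + y) + 0 * V (x + y) + - c) \<le> wavg h (\<lambda>y. u (x + y) t)"
        proof (rule wavg_mono[OF _ continuous_translate[OF c] h])
          show "1 * V (x + y) + 0 * V (x + y) + - c \<le> u (x + y) t" for y using low[OF tt', of "x + y"] by simp
        qed (intro continuous_intros continuous_translate[OF Vc])
        then show ?thesis
          unfolding wavg_affine[OF continuous_translate[OF Vc] continuous_translate[OF Vc] h]
          by (simp add: mollify_def)
      qed
      have "- torus_integral (\<lambda>x. H' (G x) (GU x - G x)) \<le> 2 * C * B * torus_integral ?z"
      proof (rule torus_divergence_estimate[OF H d dd Hc vper vsc V(5) G Gc M Mc sym])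
        show "(\<Sum>i\<in>UNIV. H'' (G x) (axis i 1) (axis i 1)) \<le> B" for x by (rule B(1)[OF GL])
        show "torus_periodic ?z"
          using mollify_periodic[OF p, of h] vper by (simp add: torus_periodic_def)
        show "0 \<le> ?z x" for x by (rule zpos)
        show "(?z has_derivative (\<lambda>y. (GU x - G x) \<bullet> y)) (at x)" for x
          by (rule has_derivative_eq_rhs[OF has_derivative_add[OF has_derivative_diff[OF GU G] has_derivative_const]])
            (simp add: inner_diff_left)
        show "continuous_on UNIV (\<lambda>x. GU x - G x)" by (intro continuous_intros GUc Gc)
      qed
      also have "torus_integral ?z = D t - torus_integral V + c"
      proof -
        have "torus_integral ?z = torus_integral (\<lambda>x. ?U x - ?v x) + torus_integral (\<lambda>x :: real ^ 'd. c)"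
          by (intro torus_integral_add continuous_intros Uc vc)
        then show ?thesis
          by (simp add: torus_integral_diff[OF Uc vc] torus_integral_mollify[OF c p h]
            torus_integral_mollify[OF Vc V(3) h] D_def)
      qed
      also have "2 * C * B * (D t - torus_integral V + c) \<le> 2 * C * B * (D t0 - torus_integral V + (t1 - t0) * l0 + c)"
      proof (rule mult_left_mono)
        have "(t - t0) * l0 \<le> (t1 - t0) * l0" using tt' l0(2) by (intro mult_right_mono) auto
        then show "D t - torus_integral V + c \<le> D t0 - torus_integral V + (t1 - t0) * l0 + c"
          using growth[OF tt'] by linarith
      qed (use V(5) B(2) in auto)
      finally have 1: "- torus_integral (\<lambda>x. H' (G x) (GU x - G x)) \<le> 2 * C * B * (D t0 - torus_integral V + (t1 - t0) * l0 + c)" .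
      have "(\<lambda>x. GU x \<bullet> b x) = (\<lambda>x. H' (G x) (GU x - G x) + H' (G x) (G x))"
        by (simp add: fun_eq_iff inner_commute[of "GU _"] bp blinfun.diff_right)
      then have 2: "torus_integral (\<lambda>x. GU x \<bullet> b x) = torus_integral (\<lambda>x. H' (G x) (GU x - G x)) + torus_integral (\<lambda>x. H' (G x) (G x))"
        by (simp only: torus_integral_add[OF gc(2,3)])
      have 3: "torus_integral l = torus_integral (\<lambda>x. H' (G x) (G x)) - torus_integral (\<lambda>x. H (G x))"
        unfolding l_def bp by (rule torus_integral_diff[OF gc(3) HGc(2)])
      show ?thesis using 1 unfolding 2 3 D_def by linarith
    qed
    show "\<exists>e>0. \<forall>s. 0 < s \<longrightarrow> s < e \<longrightarrow> t + s \<le> t1 \<longrightarrow> D (t + s) \<le> D t + s * (?A + \<sigma>)"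
    proof (intro exI[of _ e] conjI allI impI e(1))
      fix s assume s0: "0 < s" "s < e" "t + s \<le> t1"
      have ts: "t + s \<in> {t0..t1}" using tt s0 by auto
      note c' = uc[OF ts] and p' = up[OF ts]
      have mc': "continuous_on UNIV (mollify h (\<lambda>x. u x (t + s)))"
        by (rule mollify_C2[OF c' h]) (rule has_derivative_imp_continuous)
      have pw: "mollify h (\<lambda>x. u x (t + s)) x \<le> ?U (x - s *\<^sub>R b x) + s * l x" for x
      proof -
        have "mollify h (\<lambda>x. u x (t + s)) x \<le> wavg h (\<lambda>y. 1 * u (x - s *\<^sub>R b x + y) t + 0 * u (x - s *\<^sub>R b x + y) t + s * l x)"
          unfolding mollify_def
        proof (rule wavg_mono[OF continuous_translate[OF c'] _ h])
          fix y :: "real ^ 'd"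
          have "u (x + y) (t + s) \<le> u (x + y - s *\<^sub>R b x) t + s * l x"
            by (rule transport[OF adm]) (use tt t ts s0 in auto)
          moreover have "x + y - s *\<^sub>R b x = x - s *\<^sub>R b x + y" by simp
          ultimately show "u (x + y) (t + s) \<le> 1 * u (x - s *\<^sub>R b x + y) t + 0 * u (x - s *\<^sub>R b x + y) t + s * l x"
            by simp
        qed (intro continuous_intros continuous_translate[OF c])
        also have "\<dots> = ?U (x - s *\<^sub>R b x) + s * l x"
          unfolding mollify_def by (subst wavg_affine[OF continuous_translate[OF c] continuous_translate[OF c] h]) simp
        finally show ?thesis .
      qed
      have Ubc: "continuous_on UNIV (\<lambda>x. ?U (x - s *\<^sub>R b x))"
        by (intro continuous_on_compose2[OF Uc] continuous_intros bc) auto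
      have "D (t + s) = torus_integral (mollify h (\<lambda>x. u x (t + s)))"
        unfolding D_def by (rule torus_integral_mollify[OF c' p' h, symmetric])
      also have "\<dots> \<le> torus_integral (\<lambda>x. ?U (x - s *\<^sub>R b x) + s * l x)"
        by (intro torus_integral_mono mc' pw continuous_on_add Ubc continuous_on_mult_left lc)
      also have "\<dots> = \<Phi> s + s * torus_integral l"
        by (subst torus_integral_add[OF Ubc]) (auto simp: \<Phi>_def intro!: continuous_intros lc)
      also have "\<Phi> s \<le> \<Phi> 0 + s * (- torus_integral (\<lambda>x. GU x \<bullet> b x) + \<sigma>)" by (rule e(2)[OF s0(1,2)])
      also have "\<Phi> 0 = D t" by (simp add: \<Phi>_def D_def torus_integral_mollify[OF c p h])
      finally have "D (t + s) \<le> D t + s * ((- torus_integral (\<lambda>x. GU x \<bullet> b x) + torus_integral l) + \<sigma>)"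
        by (simp add: algebra_simps)
      also have "s * ((- torus_integral (\<lambda>x. GU x \<bullet> b x) + torus_integral l) + \<sigma>) \<le> s * (?A + \<sigma>)"
        using A s0 by (intro mult_left_mono) auto
      finally show "D (t + s) \<le> D t + s * (?A + \<sigma>)" by simp
    qed
  qed
  then show ?thesis unfolding D_def .
qed

lemma discrete_gronwall:
  fixes X :: "nat \<Rightarrow> real"
  assumes a: "0 \<le> a" and b: "0 \<le> b" and t: "0 \<le> \<tau>" and X0: "X 0 \<le> 0"
    and step: "\<And>n. n < N \<Longrightarrow> X (Suc n) \<le> X n + \<tau> * (a * X n + b)" and n: "n \<le> N"
  shows "X n \<le> real n * \<tau> * b * exp (a * (real n * \<tau>))"
  using n
proof (induction n)
  case (Suc n)
  let ?e = "exp (a * (real n * \<tau>))"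
  have "X (Suc n) \<le> (1 + a * \<tau>) * X n + \<tau> * b"
    using step[of n] Suc.prems by (simp add: algebra_simps)
  also have "(1 + a * \<tau>) * X n \<le> (1 + a * \<tau>) * (real n * \<tau> * b * ?e)"
    using Suc a t by (intro mult_left_mono) auto
  also have "\<dots> \<le> exp (a * \<tau>) * (real n * \<tau> * b * ?e)"
    using t b exp_ge_add_one_self[of "a * \<tau>"] by (intro mult_right_mono) auto
  also have "\<dots> = real n * \<tau> * b * exp (a * (real (Suc n) * \<tau>))"
    by (simp add: exp_add algebra_simps)
  also have "\<tau> * b \<le> \<tau> * b * exp (a * (real (Suc n) * \<tau>))"
  proof -
    have "\<tau> * b * 1 \<le> \<tau> * b * exp (a * (real (Suc n) * \<tau>))"
      using a t b by (intro mult_left_mono) auto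
    then show ?thesis by simp
  qed
  finally show ?case by (simp add: algebra_simps)
qed (use X0 in simp)

section \<open>Error of the scheme\<close>

lemma hopf_lax_scheme_instance:
  fixes F :: "(real ^ 'd::finite) \<times> (real ^ 'd) \<Rightarrow> real"
  assumes F: "convex_on UNIV F" "\<And>z. (F has_derivative blinfun_apply (F' z)) (at z)" "continuous_on UNIV F'"
    and R: "0 < R" and L: "0 \<le> L" "L \<le> R" and g: "lip_le L g"
    and K: "\<And>z. z \<in> rbox R \<Longrightarrow> (\<Sum>k\<in>UNIV. F' z (sbasis k)) \<le> K"
    and K2: "\<And>z. z \<in> rbox R \<Longrightarrow> \<bar>F' z z - F z\<bar> \<le> K2"
    and h: "0 < h" "0 < \<tau>" and mc: "monotonicity_condition F R h \<tau>"
  shows "hopf_lax_scheme F (\<lambda>z. blinfun_apply (F' z)) h \<tau> R K L K2 g"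
proof -
  have ms: "monotone_scheme F (\<lambda>z. blinfun_apply (F' z)) h \<tau> R K"
    using F h K monotonicity_condition_rbox[OF mc h R F(2,3)] by unfold_locales auto
  have "\<bar>monotone_scheme.cost F (\<lambda>z. blinfun_apply (F' z)) (- p, p)\<bar> \<le> K2" if "norm p \<le> L" for p
    unfolding monotone_scheme.cost_def[OF ms] using that L by (intro K2 lip_le_norm_rbox) simp
  then show ?thesis
    using L g by (intro hopf_lax_scheme.intro ms hopf_lax_scheme_axioms.intro) auto
qed

text \<open>
  The constants are chosen before \<open>h\<close> and \<open>\<tau>\<close>: \<open>K\<close>, \<open>K2\<close> and \<open>B\<close> bound the first derivatives
  of \<open>F\<close>, its running costs and the trace of the Hessian of \<open>H\<close> on the slopes allowed by \<open>R\<close>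
  and \<open>L\<close>, \<open>cA\<close> is the constant of the one-sided bound, \<open>cB\<close> its version for times between two
  time steps, and \<open>cF\<close> the consistency error of the numerical flux in \<open>L\<^sup>1\<close>.
\<close>
lemma scheme_error_estimates:
  fixes H g :: "real ^ 'd::finite \<Rightarrow> real"
    and F :: "(real ^ 'd) \<times> (real ^ 'd) \<Rightarrow> real"
    and u :: "real ^ 'd \<Rightarrow> real \<Rightarrow> real"
  assumes T: "T > 0" and H: "C2 H" "convex_on UNIV H"
    and g: "torus_periodic g" "L-lipschitz_on UNIV g" "semiconcave g"
    and F: "C2 F" "convex_on UNIV F" "\<And>p. F (- p, p) = H p"
    and R: "R > 0" "L \<le> R" and u: "viscosity_solution H g T u"
  obtains A1 A2 where "A1 > 0" "A2 > 0" "0 \<le> L"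
    "\<And>h \<tau> N n. discretization T h \<tau> N \<Longrightarrow> monotonicity_condition F R h \<tau> \<Longrightarrow> n \<le> N \<Longrightarrow>
      lip_le L ((update_op F h \<tau> ^^ n) g) \<and>
      (\<forall>x. \<bar>(update_op F h \<tau> ^^ n) g x - u x (real n * \<tau>)\<bar> \<le> A1 * sqrt (h + \<tau>)) \<and>
      torus_integral (\<lambda>x. \<bar>(update_op F h \<tau> ^^ n) g x - u x (real n * \<tau>)\<bar>) \<le> A2 * (h + \<tau>)"
proof -
  obtain F' F'' where F': "\<And>z. (F has_derivative blinfun_apply (F' z)) (at z)"
    and F'': "\<And>z. (F' has_derivative blinfun_apply (F'' z)) (at z)"
    using F(1) unfolding C2_def by blast
  obtain H' H'' where H': "\<And>p. (H has_derivative blinfun_apply (H' p)) (at p)"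
    and H'': "\<And>p. (H' has_derivative blinfun_apply (H'' p)) (at p)" and H''c: "continuous_on UNIV H''"
    using H(1) unfolding C2_def by blast
  have F'c: "continuous_on UNIV F'"
    by (rule has_derivative_imp_continuous[OF F''])
  have Fc: "continuous_on UNIV F"
    by (rule has_derivative_imp_continuous[OF F'])
  have L: "0 \<le> L" using g(2) by (simp add: lipschitz_on_def)
  have lg: "lip_le L g"
    unfolding lip_le_def
  proof (intro allI)
    fix x y
    have "\<bar>g x - g y\<bar> \<le> L * norm (x - y)"
      using lipschitz_onD[OF g(2), of x y] by (simp add: dist_norm)
    then show "g x \<le> g y + L * norm (x - y)" by linarith
  qed
  obtain C where C: "C > 0" and sc: "semiconcave_const C g"
    using g(3) unfolding semiconcave_def semiconcave_const_def by blast
  obtain K where K: "K > 0" "\<And>z. z \<in> rbox R \<Longrightarrow> \<bar>\<Sum>k\<in>UNIV. F' z (sbasis k)\<bar> \<le> K"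
    by (rule continuous_bounded_on_rbox[where f="\<lambda>z. \<Sum>k\<in>UNIV. F' z (sbasis k)" and R=R])
      (auto intro!: continuous_intros F'c)
  have K': "(\<Sum>k\<in>UNIV. F' z (sbasis k)) \<le> K" if "z \<in> rbox R" for z
    using K(2)[OF that] by simp
  obtain K2 where K2: "K2 > 0" "\<And>z. z \<in> rbox R \<Longrightarrow> \<bar>F' z z - F z\<bar> \<le> K2"
    by (rule continuous_bounded_on_rbox[where f="\<lambda>z. F' z z - F z" and R=R])
      (auto intro!: continuous_intros F'c Fc)
  obtain B where B: "B > 0" "\<And>p. norm p \<le> L \<Longrightarrow> (\<Sum>i\<in>UNIV. H'' p (axis i 1) (axis i 1)) \<le> B"
  proof -
    let ?f = "\<lambda>p. \<Sum>i\<in>UNIV. H'' p (axis i 1) (axis i 1)"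
    have "bounded (?f ` cball 0 L)"
      by (intro compact_imp_bounded compact_continuous_image continuous_intros continuous_on_subset[OF H''c]) auto
    then obtain B where B: "B > 0" "\<forall>y\<in>?f ` cball 0 L. norm y \<le> B"
      unfolding bounded_pos by blast
    have "?f p \<le> B" if "norm p \<le> L" for p
    proof -
      have "?f p \<in> ?f ` cball 0 L" using that by (intro imageI) simp
      then have "norm (?f p) \<le> B" using B(2) by blast
      then show ?thesis by simp
    qed
    then show thesis using that[of B] B(1) by blast
  qed
  define v0 :: "real ^ 'd" where "v0 = (\<Sum>i\<in>UNIV. blinfun_apply (H' 0) (axis i 1) *\<^sub>R axis i 1)"
  define l0 where "l0 = \<bar>H 0\<bar>"
  have l0: "0 \<le> l0" and v0: "v0 \<bullet> p - l0 \<le> H p" for p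
  proof -
    show "0 \<le> l0" by (simp add: l0_def)
    have "v0 \<bullet> p = H' 0 p"
      unfolding v0_def by (rule inner_gradient)
    then show "v0 \<bullet> p - l0 \<le> H p"
      using convex_on_tangent_le[OF H(2) H', of 0 p] by (simp add: l0_def)
  qed
  have uper: "torus_periodic (\<lambda>x. u x t)" if "t \<in> {0..T}" for t
    using u that by (simp add: viscosity_solution_def)
  have ucont: "continuous_on (UNIV \<times> {0..T}) (\<lambda>(x, t). u x t)"
    and usub: "viscosity_subsolution H T u" and usuper: "viscosity_supersolution H T u"
    and u0: "u x 0 = g x" for x
    using u by (auto simp: viscosity_solution_def)
  have transport: "u x (t + s) \<le> u (x - s *\<^sub>R v) t + s * l"
    if "\<And>p. v \<bullet> p - l \<le> H p" "0 \<le> t" "0 \<le> s" "t + s \<le> T" for v l x t s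
    by (rule subsolution_transport[OF uper ucont usub that])
  define cA where "cA = T * C * (K + K\<^sup>2)"
  define cB where "cB = cA + (L * K + K2)"
  define cF where "cF = K * real CARD('d + 'd) * (6 * C)"
  define a where "a = 2 * C * B"
  define A1 where "A1 = L\<^sup>2 / 2 + T * K / 2 + cA * sqrt (1 + T) + 1"
  define A2 where "A2 = T * (a * (l0 + cB) + cF) * exp (a * T) + 2 * cA + 1"
  have pos: "0 \<le> cA" "0 \<le> cB" "0 \<le> cF" "0 \<le> a"
    using T C K(1) K2(1) L B(1) by (auto simp: cA_def cB_def cF_def a_def)
  have A: "A1 > 0" "A2 > 0"
    using T K(1) pos l0 by (auto simp: A1_def A2_def intro!: add_nonneg_pos add_nonneg_nonneg mult_nonneg_nonneg)
  show thesis
  proof (rule that[OF A L])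
    fix h \<tau> :: real and N n :: nat
    assume disc: "discretization T h \<tau> N" and mc: "monotonicity_condition F R h \<tau>" and nN: "n \<le> N"
    define \<epsilon> where "\<epsilon> = h + \<tau>"
    obtain I :: nat where I: "I \<ge> 1" "h = 1 / real I" using disc by (auto simp: discretization_def)
    have h: "0 < h" "h \<le> 1" using I by auto
    have tau: "0 < \<tau>" and NT: "real N * \<tau> = T" and N1: "N \<ge> 1" using disc by (auto simp: discretization_def)
    have tauT: "\<tau> \<le> T"
      using NT N1 tau mult_right_mono[of 1 "real N" \<tau>] by simp
    have eps: "0 < \<epsilon>" "h \<le> \<epsilon>" "\<tau> \<le> \<epsilon>" "\<epsilon> \<le> 1 + T" using h tau tauT by (auto simp: \<epsilon>_def)
    have time: "real m * \<tau> \<le> T" if "m \<le> N" for m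
      using mult_right_mono[of "real m" "real N" \<tau>] that tau NT by simp
    interpret hs: hopf_lax_scheme F "\<lambda>z. blinfun_apply (F' z)" h \<tau> R K L K2 g
      by (rule hopf_lax_scheme_instance[OF F(2) F' F'c R(1) L R(2) lg K' K2(2) h(1) tau mc])
    let ?V = "\<lambda>m. (update_op F h \<tau> ^^ m) g"
    have Vlip: "lip_le L (?V m)" for m by (rule hs.iterate_lip[OF lg R(2)])
    have Vsc: "semiconcave_const C (?V m)" for m by (rule hs.iterate_semiconcave[OF lg R(2) sc])
    have Vper: "torus_periodic (?V m)" for m by (rule hs.iterate_periodic[OF g(1)])
    have Vc: "continuous_on UNIV (?V m)" for m by (rule lip_le_continuous[OF Vlip])
    have uc: "continuous_on UNIV (\<lambda>x. u x (real m * \<tau>))" if "m \<le> N" for m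
      using viscosity_solution_slice_continuous[OF ucont] time[OF that] tau by simp
    have wu: "hopf_lax_scheme.w F (\<lambda>z. blinfun_apply (F' z)) L g x t \<le> u x t" if "t \<in> {0..T}" for x t
      by (rule hs.hopf_lax_le_supersolution[OF uper ucont usuper F(3) _ g(1) that]) (simp_all add: u0)
    have VW: "?V m x \<le> hopf_lax_scheme.w F (\<lambda>z. blinfun_apply (F' z)) L g x (real m * \<tau>) + cA * \<epsilon>" if "m \<le> N" for m x
    proof -
      have "real m * (C * \<tau> * (h * K + \<tau> * K\<^sup>2)) = (real m * \<tau>) * (C * (h * K + \<tau> * K\<^sup>2))" by simp
      also have "\<dots> \<le> T * (C * (\<epsilon> * K + \<epsilon> * K\<^sup>2))"
        using time[OF that] eps h tau C K(1) T by (intro mult_mono add_mono mult_nonneg_nonneg) auto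
      also have "\<dots> = cA * \<epsilon>" by (simp add: cA_def algebra_simps)
      finally show ?thesis using hs.iterate_le_hopf_lax[OF sc less_imp_le[OF C], of m x] by linarith
    qed
    have upper: "?V m x \<le> u x (real m * \<tau>) + cA * \<epsilon>" if "m \<le> N" for m x
      using VW[OF that, of x] wu[of "real m * \<tau>" x] time[OF that] tau by simp
    have low: "?V m x - cB * \<epsilon> \<le> u x t" if m: "Suc m \<le> N" and t: "t \<in> {real m * \<tau>..real (Suc m) * \<tau>}" for m x t
    proof -
      have tT: "t \<in> {0..T}" using t time[OF m] tau by (auto intro: order_trans[of 0 "real m * \<tau>"])
      have "\<bar>real m * \<tau> - t\<bar> \<le> \<epsilon>" using t eps by (auto simp: algebra_simps)
      then have "(L * K + K2) * \<bar>real m * \<tau> - t\<bar> \<le> (L * K + K2) * \<epsilon>"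
        using L K(1) K2(1) by (intro mult_left_mono) auto
      then show ?thesis
        using VW[of m x] wu[OF tT, of x] hs.hopf_lax_change[of x "real m * \<tau>" x t] m
        by (simp add: cB_def distrib_right)
    qed
    have sqrt_h: "0 < sqrt h" using h by simp
    have lower: "u x (real n * \<tau>) - ?V n x \<le> (L\<^sup>2 / 2 + T * K / 2) * sqrt \<epsilon>" for x
    proof -
      have "u x (real n * \<tau>) - ?V n x \<le> (norm (x - x))\<^sup>2 / (2 * sqrt h) + sqrt h * L\<^sup>2 / 2 + real n * (\<tau> * h * K) / (2 * sqrt h)"
      proof (rule hs.doubling_estimate[OF lg R(2) sqrt_h _ _ nN])
        show "u x (real 0 * \<tau>) \<le> g x" for x by (simp add: u0)
        fix m x and z :: "(real ^ 'd) \<times> (real ^ 'd)" assume m: "m < N" and "z \<in> rbox R"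
        have "u x (real m * \<tau> + \<tau>) \<le> u (x - \<tau> *\<^sub>R hs.vel z) (real m * \<tau>) + \<tau> * hs.cost z"
        proof (rule transport)
          show "hs.vel z \<bullet> p - hs.cost z \<le> H p" for p
            using hs.cost_transport[of z p] by (simp add: F(3))
          show "real m * \<tau> + \<tau> \<le> T" using time[of "Suc m"] m by (simp add: algebra_simps)
        qed (use tau in auto)
        then show "u x (real (Suc m) * \<tau>) \<le> u (x - \<tau> *\<^sub>R hs.vel z) (real m * \<tau>) + \<tau> * hs.cost z"
          by (simp add: algebra_simps)
      qed
      also have "real n * (\<tau> * h * K) / (2 * sqrt h) = (real n * \<tau>) * K / 2 * (h / sqrt h)"
        using sqrt_h by (simp add: field_simps)
      also have "h / sqrt h = sqrt h" using h by (simp add: real_div_sqrt)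
      also have "(real n * \<tau>) * K / 2 * sqrt h \<le> T * K / 2 * sqrt h"
        using time[OF nN] K(1) h by (intro mult_right_mono divide_right_mono) auto
      finally have "u x (real n * \<tau>) - ?V n x \<le> (L\<^sup>2 / 2 + T * K / 2) * sqrt h"
        by (simp add: algebra_simps)
      also have "\<dots> \<le> (L\<^sup>2 / 2 + T * K / 2) * sqrt \<epsilon>"
        using eps T K(1) by (intro mult_left_mono) auto
      finally show ?thesis .
    qed
    have sup: "\<bar>?V n x - u x (real n * \<tau>)\<bar> \<le> A1 * sqrt \<epsilon>" for x
    proof -
      have "cA * \<epsilon> \<le> cA * sqrt (1 + T) * sqrt \<epsilon>"
      proof -
        have "\<epsilon> = sqrt \<epsilon> * sqrt \<epsilon>" using eps by simp
        also have "\<dots> \<le> sqrt (1 + T) * sqrt \<epsilon>" using eps by (intro mult_right_mono) auto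
        finally show ?thesis using pos(1) by (simp add: mult.assoc mult_left_mono)
      qed
      moreover have "0 \<le> (L\<^sup>2 / 2 + T * K / 2) * sqrt \<epsilon>" "0 \<le> cA * sqrt (1 + T) * sqrt \<epsilon>" "0 \<le> sqrt \<epsilon>"
        using eps T K(1) pos by auto
      ultimately show ?thesis
        using upper[OF nN, of x] lower[of x] unfolding A1_def distrib_right abs_le_iff
        by (intro conjI; linarith)
    qed
    define X where "X m = torus_integral (\<lambda>x. u x (real m * \<tau>)) - torus_integral (?V m)" for m
    define b where "b = (a * (l0 + cB) + cF) * \<epsilon>"
    have Xn: "X n \<le> real n * \<tau> * b * exp (a * (real n * \<tau>))"
    proof (rule discrete_gronwall[OF pos(4) _ less_imp_le[OF tau] _ _ nN])
      show "0 \<le> b" using pos l0 eps by (simp add: b_def)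
      show "X 0 \<le> 0" by (simp add: X_def u0)
      fix m assume m: "m < N"
      let ?t = "real m * \<tau>"
      obtain G and M :: "real ^ 'd \<Rightarrow> real ^ 'd \<Rightarrow> real ^ 'd" where
        G: "\<And>x. (mollify h (?V m) has_derivative (\<lambda>v. G x \<bullet> v)) (at x)" "continuous_on UNIV G"
        and M: "\<And>x. (G has_derivative M x) (at x)" "\<And>v. continuous_on UNIV (\<lambda>x. M x v)"
          "\<And>x v w. M x v \<bullet> w = M x w \<bullet> v"
        by (rule mollify_C2[OF Vc[of m] h(1)]) (rule that)
      have flux: "torus_integral (\<lambda>x. F (slopes h (?V m) x)) \<le> torus_integral (\<lambda>x. H (G x)) + cF * h"
        using hs.numerical_flux_integral[OF Vlip R(2) Vper Vsc less_imp_le[OF C] G]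
        by (simp add: F(3) cF_def)
      have "torus_integral (\<lambda>x. u x (real (Suc m) * \<tau>)) \<le> torus_integral (\<lambda>x. u x ?t) + (real (Suc m) * \<tau> - ?t) *
        (2 * C * B * (torus_integral (\<lambda>x. u x ?t) - torus_integral (?V m) + (real (Suc m) * \<tau> - ?t) * l0 + cB * \<epsilon>)
          - torus_integral (\<lambda>x. H (G x)))"
      proof (rule torus_mass_growth[OF H(2) H' H'' H''c uper ucont transport Vlip L Vper Vsc less_imp_le[OF C] h(1) G M B(2) less_imp_le[OF B(1)] v0 l0])
        show "real (Suc m) * \<tau> \<le> T" using time[of "Suc m"] m by simp
        show "?V m x - cB * \<epsilon> \<le> u x t" if "t \<in> {?t..real (Suc m) * \<tau>}" for x t
          using low[of m t x] that m by simp
      qed (use tau in \<open>auto simp: mult_right_mono\<close>)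
      moreover have "real (Suc m) * \<tau> - ?t = \<tau>" by (simp add: algebra_simps)
      ultimately have grow: "torus_integral (\<lambda>x. u x (real (Suc m) * \<tau>)) \<le> torus_integral (\<lambda>x. u x ?t)
          + \<tau> * (a * (X m + \<tau> * l0 + cB * \<epsilon>) - torus_integral (\<lambda>x. H (G x)))"
        by (simp add: a_def X_def)
      have Fsc: "continuous_on UNIV (\<lambda>x. F (slopes h (?V m) x))"
      proof (rule continuous_on_compose2[OF Fc])
        show "continuous_on UNIV (slopes h (?V m))"
          unfolding slopes_def diff_fwd_def diff_bwd_def
          by (intro continuous_intros Vc continuous_on_compose2[OF Vc]) (use h in auto)
      qed auto
      have "torus_integral (?V (Suc m)) = torus_integral (\<lambda>x. ?V m x - \<tau> * F (slopes h (?V m) x))"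
        by (simp add: update_op_def[abs_def] slopes_def)
      also have "\<dots> = torus_integral (?V m) - \<tau> * torus_integral (\<lambda>x. F (slopes h (?V m) x))"
        by (subst torus_integral_diff[OF Vc]) (auto intro!: continuous_intros Fsc)
      also have "\<dots> \<ge> torus_integral (?V m) - \<tau> * (torus_integral (\<lambda>x. H (G x)) + cF * h)"
        using flux tau by (intro diff_left_mono mult_left_mono) auto
      finally have "X (Suc m) \<le> X m + \<tau> * (a * (X m + \<tau> * l0 + cB * \<epsilon>) - torus_integral (\<lambda>x. H (G x)))
          + \<tau> * (torus_integral (\<lambda>x. H (G x)) + cF * h)"
        using grow unfolding X_def by linarith
      also have "\<dots> = X m + \<tau> * (a * (X m + \<tau> * l0 + cB * \<epsilon>) + cF * h)"
        by (simp add: algebra_simps)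
      also have "\<dots> \<le> X m + \<tau> * (a * X m + b)"
      proof -
        have "\<tau> * l0 \<le> \<epsilon> * l0" "cF * h \<le> cF * \<epsilon>"
          using eps l0 pos by (auto intro!: mult_right_mono mult_left_mono)
        moreover from this have "a * (X m + \<tau> * l0 + cB * \<epsilon>) \<le> a * (X m + \<epsilon> * l0 + cB * \<epsilon>)"
          using pos(4) by (intro mult_left_mono) auto
        ultimately have "a * (X m + \<tau> * l0 + cB * \<epsilon>) + cF * h \<le> a * (X m + \<epsilon> * l0 + cB * \<epsilon>) + cF * \<epsilon>"
          by linarith
        also have "\<dots> = a * X m + b" by (simp add: b_def algebra_simps)
        finally show ?thesis using tau by (intro add_left_mono mult_left_mono) auto
      qed
      finally show "X (Suc m) \<le> X m + \<tau> * (a * X m + b)" .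
    qed
    have X2: "X n \<le> T * (a * (l0 + cB) + cF) * exp (a * T) * \<epsilon>"
    proof -
      have "real n * \<tau> * b * exp (a * (real n * \<tau>)) \<le> T * b * exp (a * T)"
        using time[OF nN] tau pos l0 eps T by (intro mult_mono) (auto simp: b_def intro!: mult_left_mono)
      then show ?thesis using Xn by (simp add: b_def mult_ac)
    qed
    have dc: "continuous_on UNIV (\<lambda>x. u x (real n * \<tau>) - ?V n x)" by (intro continuous_intros uc nN Vc)
    have "torus_integral (\<lambda>x. \<bar>?V n x - u x (real n * \<tau>)\<bar>) \<le> torus_integral (\<lambda>x. (u x (real n * \<tau>) - ?V n x) + 2 * (cA * \<epsilon>))"
    proof (intro torus_integral_mono continuous_intros uc nN Vc)
      fix x
      have "0 \<le> cA * \<epsilon>" using pos eps by simp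
      then show "\<bar>?V n x - u x (real n * \<tau>)\<bar> \<le> (u x (real n * \<tau>) - ?V n x) + 2 * (cA * \<epsilon>)"
        using upper[OF nN, of x] by linarith
    qed
    also have "\<dots> = X n + 2 * (cA * \<epsilon>)"
      by (subst torus_integral_add[OF dc]) (simp_all add: X_def torus_integral_diff[OF uc[OF nN] Vc])
    also have "\<dots> \<le> A2 * \<epsilon>"
      using X2 eps(1) unfolding A2_def by (simp add: distrib_right)
    finally have L1: "torus_integral (\<lambda>x. \<bar>?V n x - u x (real n * \<tau>)\<bar>) \<le> A2 * \<epsilon>" .
    show "lip_le L (?V n) \<and> (\<forall>x. \<bar>?V n x - u x (real n * \<tau>)\<bar> \<le> A1 * sqrt (h + \<tau>)) \<and>
      torus_integral (\<lambda>x. \<bar>?V n x - u x (real n * \<tau>)\<bar>) \<le> A2 * (h + \<tau>)"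
      using Vlip sup L1 by (simp add: \<epsilon>_def)
  qed
qed

section \<open>Interpolation and norms\<close>

lemma interp_weight_nonneg: "0 \<le> interp_weight h x \<sigma>"
  unfolding interp_weight_def by (intro prod_nonneg) (auto simp: less_imp_le[OF frac_lt_1])

lemma sum_interp_weight: "(\<Sum>\<sigma>\<in>UNIV. interp_weight h x \<sigma>) = 1"
proof -
  let ?f = "\<lambda>j. frac (x $ j / h)"
  have "interp_weight h x \<sigma> = (\<Prod>j\<in>\<sigma>. ?f j) * (\<Prod>j\<in>UNIV - \<sigma>. 1 - ?f j)" for \<sigma>
    unfolding interp_weight_def by (subst prod.If_cases) (auto simp: Compl_eq_Diff_UNIV)
  then have "(\<Sum>\<sigma>\<in>UNIV. interp_weight h x \<sigma>) = (\<Prod>j\<in>UNIV. ?f j + (1 - ?f j))"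
    using prod_add[of UNIV ?f "\<lambda>j. 1 - ?f j"] by simp
  then show ?thesis by simp
qed

lemma norm_cell_vertex_diff:
  fixes x :: "real ^ 'd::finite"
  assumes h: "h > 0" shows "norm (cell_vertex h x \<sigma> - x) \<le> real CARD('d) * h"
proof -
  have "norm (cell_vertex h x \<sigma> - x) \<le> (\<Sum>j\<in>UNIV. \<bar>(cell_vertex h x \<sigma> - x) $ j\<bar>)"
    by (rule norm_le_l1_cart)
  also have "\<dots> \<le> (\<Sum>j\<in>(UNIV :: 'd set). h)"
  proof (rule sum_mono)
    fix j
    define r where "r = x $ j / h"
    have x: "x $ j = h * r" using h by (simp add: r_def)
    have "(cell_vertex h x \<sigma> - x) $ j = h * ((if j \<in> \<sigma> then 1 else 0) - frac r)"
      by (simp add: cell_vertex_def r_def[symmetric] x frac_def algebra_simps)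
    also have "\<bar>\<dots>\<bar> \<le> h * 1"
      unfolding abs_mult using h frac_ge_0[of r] frac_lt_1[of r]
      by (intro mult_mono) auto
    finally show "\<bar>(cell_vertex h x \<sigma> - x) $ j\<bar> \<le> h" by simp
  qed
  finally show ?thesis by simp
qed

lemma interpolant_close:
  fixes V :: "real ^ 'd::finite \<Rightarrow> real"
  assumes V: "lip_le L V" "0 \<le> L" and h: "h > 0"
  shows "\<bar>interpolant h V x - V x\<bar> \<le> L * real CARD('d) * h"
proof -
  have "interpolant h V x - V x = (\<Sum>\<sigma>\<in>UNIV. interp_weight h x \<sigma> * (V (cell_vertex h x \<sigma>) - V x))"
    by (simp add: interpolant_def right_diff_distrib sum_subtractf sum_distrib_right[symmetric] sum_interp_weight)
  also have "\<bar>\<dots>\<bar> \<le> (\<Sum>\<sigma>\<in>UNIV. \<bar>interp_weight h x \<sigma> * (V (cell_vertex h x \<sigma>) - V x)\<bar>)"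
    by (rule sum_abs)
  also have "\<dots> \<le> (\<Sum>\<sigma>\<in>UNIV. interp_weight h x \<sigma> * (L * real CARD('d) * h))"
  proof (rule sum_mono)
    fix \<sigma> :: "'d set"
    have "\<bar>V (cell_vertex h x \<sigma>) - V x\<bar> \<le> L * norm (cell_vertex h x \<sigma> - x)"
      using V(1)[unfolded lip_le_def, rule_format, of "cell_vertex h x \<sigma>" x]
        V(1)[unfolded lip_le_def, rule_format, of x "cell_vertex h x \<sigma>"]
      by (simp add: abs_le_iff norm_minus_commute)
    also have "\<dots> \<le> L * (real CARD('d) * h)"
      by (intro mult_left_mono norm_cell_vertex_diff h V)
    finally show "\<bar>interp_weight h x \<sigma> * (V (cell_vertex h x \<sigma>) - V x)\<bar> \<le> interp_weight h x \<sigma> * (L * real CARD('d) * h)"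
      by (simp add: abs_mult interp_weight_nonneg mult_left_mono mult.assoc)
  qed
  also have "\<dots> = L * real CARD('d) * h"
    by (simp add: sum_distrib_right[symmetric] sum_interp_weight)
  finally show ?thesis .
qed

lemma cell_vertex_lattice: "cell_vertex h x \<sigma> \<in> lattice h"
  unfolding lattice_def cell_vertex_def
  by (rule range_eqI[of _ _ "\<chi> j. \<lfloor>x $ j / h\<rfloor> + (if j \<in> \<sigma> then 1 else 0)"]) (simp add: vec_eq_iff)

lemma lattice_shift:
  assumes "x \<in> lattice h" shows "x + h *\<^sub>R axis i 1 \<in> lattice h" "x - h *\<^sub>R axis i 1 \<in> lattice h"
proof -
  obtain k :: "int ^ 'a" where k: "x = (\<chi> j. h * of_int (k $ j))" using assms by (auto simp: lattice_def)
  show "x + h *\<^sub>R axis i 1 \<in> lattice h"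
    unfolding lattice_def k
    by (rule range_eqI[of _ _ "k + axis i 1"]) (auto simp: vec_eq_iff axis_def algebra_simps)
  show "x - h *\<^sub>R axis i 1 \<in> lattice h"
    unfolding lattice_def k
    by (rule range_eqI[of _ _ "k - axis i 1"]) (auto simp: vec_eq_iff axis_def algebra_simps)
qed

text \<open>
  The difference quotients at a lattice point only see lattice points, so the grid solution is
  the restriction of the iterates on the whole space.
\<close>
lemma fd_solution_eq_iterate:
  assumes U: "fd_solution F g h \<tau> N U" and n: "n \<le> N" and x: "x \<in> lattice h"
  shows "U n x = (update_op F h \<tau> ^^ n) g x"
  using n x
proof (induction n arbitrary: x)
  case 0
  then show ?case using U by (simp add: fd_solution_def)
next
  case (Suc n)
  let ?V = "(update_op F h \<tau> ^^ n) g"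
  have eq: "U n y = ?V y" if "y \<in> lattice h" for y using Suc.IH[of y] Suc.prems that by simp
  have "diff_fwd h (U n) x = diff_fwd h ?V x" "diff_bwd h (U n) x = diff_bwd h ?V x"
    using eq[OF Suc.prems(2)] eq[OF lattice_shift(1)[OF Suc.prems(2)]] eq[OF lattice_shift(2)[OF Suc.prems(2)]]
    by (simp_all add: diff_fwd_def diff_bwd_def)
  moreover have "U (Suc n) x = U n x - \<tau> * F (- diff_fwd h (U n) x, diff_bwd h (U n) x)"
    using U Suc.prems by (auto simp: fd_solution_def algebra_simps)
  ultimately show ?case
    using eq[OF Suc.prems(2)] by (simp add: update_op_def[of F h \<tau> ?V x])
qed

text \<open>
  Needed for the supremum norm, because the essential supremum of a nonmeasurable function is
  infinite by definition.
\<close>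
lemma interpolant_measurable:
  fixes V :: "real ^ 'd::finite \<Rightarrow> real"
  assumes V: "continuous_on UNIV V"
  shows "interpolant h V \<in> borel_measurable borel"
proof -
  have nth: "(\<lambda>x :: real ^ 'd. x $ j / h) \<in> borel_measurable borel" for j
    by (intro borel_measurable_continuous_onI) (simp add: divide_inverse continuous_intros)
  have flr: "(\<lambda>x :: real ^ 'd. real_of_int \<lfloor>x $ j / h\<rfloor>) \<in> borel_measurable borel" for j
  proof -
    have "(\<lambda>x :: real ^ 'd. \<lfloor>x $ j / h\<rfloor>) \<in> measurable borel (count_space UNIV)"
      by (rule measurable_compose[OF nth measurable_real_floor])
    then show ?thesis by (rule measurable_compose) simp
  qed
  have w: "(\<lambda>x. interp_weight h x \<sigma>) \<in> borel_measurable borel" for \<sigma> :: "'d set"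
    unfolding interp_weight_def frac_def
    by (intro borel_measurable_prod) (auto intro!: borel_measurable_diff nth flr)
  have v: "(\<lambda>x. cell_vertex h x \<sigma>) \<in> borel_measurable borel" for \<sigma> :: "'d set"
  proof (subst borel_measurable_euclidean_space, rule ballI)
    fix b :: "real ^ 'd" assume "b \<in> Basis"
    then obtain j where b: "b = axis j 1" by (auto simp: Basis_vec_def)
    have "cell_vertex h x \<sigma> \<bullet> b = h * (real_of_int \<lfloor>x $ j / h\<rfloor> + (if j \<in> \<sigma> then 1 else 0))" for x
      by (simp add: b inner_axis cell_vertex_def)
    then show "(\<lambda>x. cell_vertex h x \<sigma> \<bullet> b) \<in> borel_measurable borel"
      by (simp only:) (intro borel_measurable_times borel_measurable_add flr borel_measurable_const)
  qed
  have "(\<lambda>x. V (cell_vertex h x \<sigma>)) \<in> borel_measurable borel" for \<sigma>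
    by (rule measurable_compose[OF v borel_measurable_continuous_onI[OF V]])
  then show ?thesis
    unfolding interpolant_def[abs_def] by (intro borel_measurable_sum borel_measurable_times w)
qed

text \<open>
  All but one of the factors \<open>\<bar>f x\<bar>\<close> in the power are estimated by the uniform
  bound \<open>S\<close>, and the last one by a continuous majorant.
\<close>
lemma torus_Lp_norm_finite_le:
  fixes f e :: "real ^ 'd::finite \<Rightarrow> real"
  assumes r: "1 \<le> r" and e: "continuous_on UNIV e" "\<And>x. \<bar>f x\<bar> \<le> e x" and S: "\<And>x. \<bar>f x\<bar> \<le> S" "0 \<le> S"
    and I: "torus_integral e \<le> J"
  shows "torus_Lp_norm (ereal r) f \<le> ennreal ((S powr (r - 1) * J) powr (1 / r))"
proof -
  let ?J = "\<integral>\<^sup>+ x. ennreal (\<bar>f x\<bar> powr r) \<partial>lebesgue_on (cbox 0 1)"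
  let ?F = "\<lambda>x. S powr (r - 1) * e x"
  have epos: "0 \<le> e x" for x using e(2)[of x] by linarith
  have "?J \<le> (\<integral>\<^sup>+ x. ennreal (?F x) \<partial>lebesgue_on (cbox 0 1))"
  proof (intro nn_integral_mono ennreal_leI)
    fix x
    have "\<bar>f x\<bar> powr r = \<bar>f x\<bar> powr (r - 1) * \<bar>f x\<bar>"
    proof (cases "f x = 0")
      case False
      have "\<bar>f x\<bar> powr ((r - 1) + 1) = \<bar>f x\<bar> powr (r - 1) * \<bar>f x\<bar> powr 1" by (rule powr_add)
      then show ?thesis using False by simp
    qed simp
    also have "\<dots> \<le> S powr (r - 1) * e x"
      using S e(2) r by (intro mult_mono powr_mono2) auto
    finally show "\<bar>f x\<bar> powr r \<le> ?F x" .
  qed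
  also have "\<dots> = (\<integral>\<^sup>+ x. ennreal (?F x) * indicator (cbox 0 1) x \<partial>lborel)"
    by (subst nn_integral_restrict_space) (auto simp: nn_integral_completion)
  also have "\<dots> = ennreal (torus_integral ?F)"
    by (intro nn_integral_has_integral_lebesgue' integrable_integral torus_integrable continuous_intros e(1))
      (simp add: epos)
  also have "torus_integral ?F \<le> S powr (r - 1) * J"
    using I by (simp add: mult_left_mono)
  finally have J: "?J \<le> ennreal (S powr (r - 1) * J)" by (simp add: ennreal_leI)
  have "0 \<le> torus_integral e"
    using torus_integral_mono[of "\<lambda>_. 0" e] e(1) epos by simp
  then have J0: "0 \<le> S powr (r - 1) * J" using I by simp
  have fin: "?J \<noteq> \<infinity>" using J by (auto simp: top_unique)
  have "enn2real ?J \<le> S powr (r - 1) * J"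
    using enn2real_mono[OF J] J0 by simp
  then have "enn2real ?J powr (1 / r) \<le> (S powr (r - 1) * J) powr (1 / r)"
    using r by (intro powr_mono2) auto
  then show ?thesis
    using fin by (simp add: torus_Lp_norm_def ennreal_leI)
qed

lemma half_reciprocal_ereal:
  assumes "1 \<le> r" shows "real_of_ereal (1 / (2 * ereal r)) = 1 / (2 * r)"
proof -
  have "1 / (2 * ereal r) = ereal (1 / (2 * r))"
    using assms by (simp add: numeral_eq_ereal one_ereal_def)
  then show ?thesis by simp
qed

lemma torus_Linf_norm_le:
  fixes f :: "real ^ 'd::finite \<Rightarrow> real"
  assumes "f \<in> borel_measurable borel" "\<And>x. \<bar>f x\<bar> \<le> S"
  shows "torus_Lp_norm \<infinity> f \<le> ennreal S"
proof -
  have "(\<lambda>x. ennreal \<bar>f x\<bar>) \<in> borel_measurable lborel" using assms(1) by simp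
  then have "(\<lambda>x. ennreal \<bar>f x\<bar>) \<in> borel_measurable (lebesgue_on (cbox 0 1))"
    by (intro measurable_restrict_space1 measurable_completion)
  then show ?thesis
    using assms(2) by (auto simp: torus_Lp_norm_def intro!: esssup_I ennreal_leI)
qed

theorem corollary2p10:
  fixes H g :: "real ^ 'd::finite \<Rightarrow> real"
    and F :: "(real ^ 'd) \<times> (real ^ 'd) \<Rightarrow> real"
    and u :: "real ^ 'd \<Rightarrow> real \<Rightarrow> real"
    and T L R :: real
  assumes "T > 0"
    and "C2 H" and "convex_on UNIV H" and "coercive H"
    and "torus_periodic g" and "L-lipschitz_on UNIV g" and "semiconcave g"
    and "C2 F" and "convex_on UNIV F" and "\<And>p. F (- p, p) = H p"
    and "R > 0" and "L \<le> R"
    and "viscosity_solution H g T u"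
  shows "(\<exists>C>0. \<forall>h \<Delta>t N U.
            discretization T h \<Delta>t N \<longrightarrow> monotonicity_condition F R h \<Delta>t \<longrightarrow>
            fd_solution F g h \<Delta>t N U \<longrightarrow>
            (SUP n\<in>{0..N}. torus_Lp_norm 1 (\<lambda>x. interpolant h (U n) x - u x (real n * \<Delta>t)))
              \<le> ennreal (C * (h + \<Delta>t)))
       \<and> (\<forall>p::ereal. 1 \<le> p \<longrightarrow>
          (\<exists>C>0. \<forall>h \<Delta>t N U.
            discretization T h \<Delta>t N \<longrightarrow> monotonicity_condition F R h \<Delta>t \<longrightarrow>
            fd_solution F g h \<Delta>t N U \<longrightarrow>
            (SUP n\<in>{0..N}. torus_Lp_norm p (\<lambda>x. interpolant h (U n) x - u x (real n * \<Delta>t)))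
              \<le> ennreal (C * (h + \<Delta>t) powr (1/2 + real_of_ereal (1 / (2 * p))))))"
proof -
  let ?d = "real CARD('d)"
  obtain A1 A2 where A: "A1 > 0" "A2 > 0" and L: "0 \<le> L" and err:
    "\<And>h \<tau> N n. discretization T h \<tau> N \<Longrightarrow> monotonicity_condition F R h \<tau> \<Longrightarrow> n \<le> N \<Longrightarrow>
      lip_le L ((update_op F h \<tau> ^^ n) g) \<and>
      (\<forall>x. \<bar>(update_op F h \<tau> ^^ n) g x - u x (real n * \<tau>)\<bar> \<le> A1 * sqrt (h + \<tau>)) \<and>
      torus_integral (\<lambda>x. \<bar>(update_op F h \<tau> ^^ n) g x - u x (real n * \<tau>)\<bar>) \<le> A2 * (h + \<tau>)"
    using scheme_error_estimates[OF assms(1,2,3,5-13)] by blast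
  define S where "S = A1 + L * ?d"
  define J where "J = A2 + L * ?d"
  have SJ: "S > 0" "J > 0" using A L by (auto simp: S_def J_def intro: add_pos_nonneg)
  have key: "\<exists>C>0. \<forall>h \<Delta>t N U.
            discretization T h \<Delta>t N \<longrightarrow> monotonicity_condition F R h \<Delta>t \<longrightarrow>
            fd_solution F g h \<Delta>t N U \<longrightarrow>
            (SUP n\<in>{0..N}. torus_Lp_norm p (\<lambda>x. interpolant h (U n) x - u x (real n * \<Delta>t)))
              \<le> ennreal (C * (h + \<Delta>t) powr (1/2 + real_of_ereal (1 / (2 * p))))"
    if p: "1 \<le> p" for p :: ereal
  proof -
    define C where "C = (if p = \<infinity> then S else (S powr (real_of_ereal p - 1) * J) powr (1 / real_of_ereal p))"
    have "C > 0" using SJ by (auto simp: C_def)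
    moreover have "torus_Lp_norm p (\<lambda>x. interpolant h (U n) x - u x (real n * \<tau>))
        \<le> ennreal (C * (h + \<tau>) powr (1/2 + real_of_ereal (1 / (2 * p))))"
      if disc: "discretization T h \<tau> N" and mc: "monotonicity_condition F R h \<tau>"
        and U: "fd_solution F g h \<tau> N U" and n: "n \<le> N" for h \<tau> N U n
    proof -
      define V where "V = (update_op F h \<tau> ^^ n) g"
      define f where "f = (\<lambda>x. interpolant h V x - u x (real n * \<tau>))"
      let ?\<epsilon> = "h + \<tau>"
      obtain I :: nat where I: "I \<ge> 1" "h = 1 / real I" using disc by (auto simp: discretization_def)
      have h: "0 < h" "h \<le> 1" using I by auto
      have tau: "0 < \<tau>" and NT: "real N * \<tau> = T" using disc by (auto simp: discretization_def)
      have tT: "real n * \<tau> \<in> {0..T}"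
        using mult_right_mono[of "real n" "real N" \<tau>] n tau NT by simp
      have V: "lip_le L V" "\<And>x. \<bar>V x - u x (real n * \<tau>)\<bar> \<le> A1 * sqrt ?\<epsilon>"
        "torus_integral (\<lambda>x. \<bar>V x - u x (real n * \<tau>)\<bar>) \<le> A2 * ?\<epsilon>"
        using err[OF disc mc n] by (auto simp: V_def)
      have Vc: "continuous_on UNIV V" by (rule lip_le_continuous[OF V(1)])
      have uc: "continuous_on UNIV (\<lambda>x. u x (real n * \<tau>))"
        using viscosity_solution_slice_continuous[OF _ tT] assms(13) by (auto simp: viscosity_solution_def)
      have "interpolant h (U n) = interpolant h V"
        using fd_solution_eq_iterate[OF U n cell_vertex_lattice]
        by (simp add: interpolant_def[abs_def] V_def)
      then have feq: "(\<lambda>x. interpolant h (U n) x - u x (real n * \<tau>)) = f" by (simp add: f_def)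
      let ?e = "\<lambda>x. \<bar>V x - u x (real n * \<tau>)\<bar> + L * ?d * h"
      have fe: "\<bar>f x\<bar> \<le> ?e x" for x
        using interpolant_close[OF V(1) L h(1), of x] unfolding f_def by linarith
      have ec: "continuous_on UNIV ?e" by (intro continuous_intros Vc uc)
      have hs: "h \<le> sqrt ?\<epsilon>"
      proof -
        have "h * h \<le> 1 * h" using h by (intro mult_right_mono) auto
        then have "h\<^sup>2 \<le> ?\<epsilon>" using tau by (simp add: power2_eq_square)
        then show ?thesis using h by (simp add: real_le_rsqrt)
      qed
      have fS: "\<bar>f x\<bar> \<le> S * sqrt ?\<epsilon>" for x
      proof -
        have "L * ?d * h \<le> L * ?d * sqrt ?\<epsilon>" using hs L by (intro mult_left_mono) auto
        then show ?thesis using fe[of x] V(2)[of x] by (simp add: S_def distrib_right)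
      qed
      have eJ: "torus_integral ?e \<le> J * ?\<epsilon>"
      proof -
        have "torus_integral ?e = torus_integral (\<lambda>x. \<bar>V x - u x (real n * \<tau>)\<bar>) + torus_integral (\<lambda>x :: real ^ 'd. L * ?d * h)"
          by (intro torus_integral_add continuous_intros Vc uc)
        moreover have "L * ?d * h \<le> L * ?d * ?\<epsilon>" using tau L by (intro mult_left_mono) auto
        ultimately show ?thesis using V(3) by (simp add: J_def distrib_right)
      qed
      have eps: "0 < ?\<epsilon>" using h tau by simp
      show ?thesis
      proof (cases "p = \<infinity>")
        case True
        have "f \<in> borel_measurable borel"
          unfolding f_def
          by (intro borel_measurable_diff interpolant_measurable Vc borel_measurable_continuous_onI uc)
        from torus_Linf_norm_le[OF this fS] show ?thesis
          unfolding feq using True eps by (simp add: C_def powr_half_sqrt)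
      next
        case False
        then obtain r where r: "p = ereal r" "1 \<le> r" using p by (cases p) auto
        have ex: "1/2 + real_of_ereal (1 / (2 * p)) = (r - 1) / (2 * r) + 1 / r"
          using r(2) unfolding r(1) half_reciprocal_ereal[OF r(2)] by (simp add: field_simps)
        have "torus_Lp_norm p f \<le> ennreal (((S * sqrt ?\<epsilon>) powr (r - 1) * (J * ?\<epsilon>)) powr (1 / r))"
          unfolding r(1) by (rule torus_Lp_norm_finite_le[OF r(2) ec fe fS _ eJ]) (use SJ eps in simp)
        also have "((S * sqrt ?\<epsilon>) powr (r - 1) * (J * ?\<epsilon>)) powr (1 / r)
            = (S powr (r - 1) * J) powr (1 / r) * ((sqrt ?\<epsilon> powr (r - 1)) powr (1 / r) * ?\<epsilon> powr (1 / r))"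
          using SJ eps by (simp add: powr_mult mult_ac)
        also have "(sqrt ?\<epsilon> powr (r - 1)) powr (1 / r) = ?\<epsilon> powr ((r - 1) / (2 * r))"
          using eps by (simp add: powr_half_sqrt[symmetric] powr_powr)
        also have "\<dots> * ?\<epsilon> powr (1 / r) = ?\<epsilon> powr (1/2 + real_of_ereal (1 / (2 * p)))"
          unfolding ex by (rule powr_add[symmetric])
        finally show ?thesis unfolding feq C_def using r False by simp
      qed
    qed
    ultimately show ?thesis
      by (intro exI[of _ C] conjI allI impI SUP_least) (simp_all only: atLeastAtMost_iff)
  qed
  have e1: "1/2 + real_of_ereal (1 / (2 * 1)) = 1"
    using half_reciprocal_ereal[of 1] by (simp add: one_ereal_def)
  have pos: "(h + \<Delta>t) powr 1 = h + \<Delta>t" if "discretization T h \<Delta>t N" for h \<Delta>t N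
  proof -
    have "0 < h + \<Delta>t" using that by (auto simp: discretization_def intro: add_nonneg_pos)
    then show ?thesis by simp
  qed
  obtain C where C0: "C > 0" and C: "\<forall>h \<Delta>t N U.
            discretization T h \<Delta>t N \<longrightarrow> monotonicity_condition F R h \<Delta>t \<longrightarrow>
            fd_solution F g h \<Delta>t N U \<longrightarrow>
            (SUP n\<in>{0..N}. torus_Lp_norm 1 (\<lambda>x. interpolant h (U n) x - u x (real n * \<Delta>t)))
              \<le> ennreal (C * (h + \<Delta>t) powr 1)"
    using key[OF order_refl] unfolding e1 by blast
  have "\<exists>C>0. \<forall>h \<Delta>t N U.
            discretization T h \<Delta>t N \<longrightarrow> monotonicity_condition F R h \<Delta>t \<longrightarrow>
            fd_solution F g h \<Delta>t N U \<longrightarrow>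
            (SUP n\<in>{0..N}. torus_Lp_norm 1 (\<lambda>x. interpolant h (U n) x - u x (real n * \<Delta>t)))
              \<le> ennreal (C * (h + \<Delta>t))"
  proof (intro exI[of _ C] conjI C0 allI impI)
    fix h \<Delta>t N U
    assume "discretization T h \<Delta>t N" "monotonicity_condition F R h \<Delta>t" "fd_solution F g h \<Delta>t N U"
    with C[rule_format, of h \<Delta>t N U]
    show "(SUP n\<in>{0..N}. torus_Lp_norm 1 (\<lambda>x. interpolant h (U n) x - u x (real n * \<Delta>t)))
        \<le> ennreal (C * (h + \<Delta>t))"
      by (simp only: pos)
  qed
  then show ?thesis using key by blast
qed

end
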